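(* Let $(G_N)_{N\ge1}$ be a sequence of generalized random graphs $\mathrm{GRG}_N(\boldsymbol w)$ whose deterministic weights satisfy the weight regularity condition. Then, for all $(\beta,B)\in\mathcal U^{\mathrm{an}}$, the total spin satisfies $$\frac{S_N-\widetilde P_N(S_N)}{\sqrt N}\ \xrightarrow{\ \mathcal D\ }\ \mathcal N(0,\widetilde\chi)\qquad\text{w.r.t. }\widetilde P_N,\quad\text{as }N\to\infty,$$ where $\widetilde\chi=\widetilde\chi(\beta,B)=\lim_{N\to\infty}\widetilde\chi_N(\beta,B)$ is the thermodynamic limit of the annealed susceptibility and $\mathcal N(0,\sigma^2)$ denotes a centered normal random variable with variance $\sigma^2$.
   Context: Generalized random graph: for each $N$, let $\boldsymbol w=(w_i)_{i\in[N]}$ be deterministic weights $w_i>0$, $[N]=\{1,\dots,N\}$, and $\ell_N=\sum_{i=1}^N w_i$. In $\mathrm{GRG}_N(\boldsymbol w)$ with vertex set $[N]$, the edges $\{i,j\}$, $i<j$, are present independently with probability $p_{ij}=\frac{w_iw_j}{\ell_N+w_iw_j}$. Let $W_N=w_{I_N}$ with $I_N$ uniform in $[N]$. Weight regularity condition: there is a random variable $W$ such that, as $N\to\infty$, (a) $W_N\to W$ in distribution; (b) $\mathbb E[W_N]=\frac1N\sum_i w_i\to\mathbb E[W]<\infty$; (c) $\mathbb E[W_N^2]=\frac1N\sum_i w_i^2\to\mathbb E[W^2]<\infty$; and $\mathbb E[W]>0$. Annealed Ising model: let $Q_N$ denote the law of the random graph $G_N=([N],E_N)$ and also the corresponding expectation.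 For $\beta\ge0$, $B\in\mathbb R$ the annealed measure on $\sigma\in\{-1,1\}^N$ is $$\widetilde P_N(\sigma)=\frac{Q_N\big(\exp[\beta\sum_{(i,j)\in E_N}\sigma_i\sigma_j+B\sum_{i\in[N]}\sigma_i]\big)}{Q_N(Z_N(\beta,B))},\qquad Z_N(\beta,B)=\sum_{\sigma\in\{-1,1\}^N}\exp\Big[\beta\sum_{(i,j)\in E_N}\sigma_i\sigma_j+B\sum_{i\in[N]}\sigma_i\Big]$$ (each edge counted once). $\widetilde P_N(\cdot)$ also denotes expectation. $S_N=\sum_{i\in[N]}\sigma_i$ is the total spin; $\widetilde M_N(\beta,B)=\widetilde P_N(S_N/N)$; the annealed susceptibility is $\widetilde\chi_N(\beta,B)=\frac{\partial}{\partial B}\widetilde M_N(\beta,B)=\mathrm{Var}_{\widetilde P_N}(S_N/\sqrt N)$. For $(\beta,B)\in\mathcal U^{\mathrm{an}}$ the limits $\widetilde M(\beta,B)=\lim_N\widetilde M_N(\beta,B)$ and $\widetilde\chi(\beta,B)=\lim_N\widetilde\chi_N(\beta,B)$ exist. Here $\mathcal U^{\mathrm{an}}=\{(\beta,B):\beta\ge0,\ B\ne0\ \text{ or }\ 0<\beta<\beta_c^{\mathrm{an}},\ B=0\}$ and $\beta_c^{\mathrm{an}}:=\inf\{\beta>0:\lim_{B\to0^+}\widetilde M(\beta,B)>0\}$, which equals $\operatorname{asinh}(\mathbb E[W]/\mathbb E[W^2])$. *)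

theory Defs
  imports "HOL-Probability.Probability"
begin

text \<open>
  Everything at a fixed size \<open>N\<close> takes a weight vector \<open>v\<close>, of which only the entries
  \<open>v i\<close> with \<open>i \<in> {1..N}\<close> matter. A sequence of graphs is given by a triangular array
  \<open>w\<close>, where \<open>w N\<close> is the weight vector of the graph on \<open>{1..N}\<close>.
\<close>

definition total_weight :: "nat \<Rightarrow> (nat \<Rightarrow> real) \<Rightarrow> real" where
  "total_weight N v = (\<Sum>i\<in>{1..N}. v i)"

definition edge_prob :: "nat \<Rightarrow> (nat \<Rightarrow> real) \<Rightarrow> nat \<Rightarrow> nat \<Rightarrow> real" where
  "edge_prob N v i j = v i * v j / (total_weight N v + v i * v j)"

text \<open>The unordered pair of two distinct vertices is represented by \<open>(i, j)\<close> with \<open>i < j\<close>,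
  so that sums over an edge set count each edge once.\<close>

definition vertex_pairs :: "nat \<Rightarrow> (nat \<times> nat) set" where
  "vertex_pairs N = {(i, j). i \<in> {1..N} \<and> j \<in> {1..N} \<and> i < j}"

definition grg :: "nat \<Rightarrow> (nat \<Rightarrow> real) \<Rightarrow> (nat \<times> nat) set pmf" where
  "grg N v = map_pmf (\<lambda>present. {e \<in> vertex_pairs N. present e})
     (Pi_pmf (vertex_pairs N) False (\<lambda>(i, j). bernoulli_pmf (edge_prob N v i j)))"

text \<open>The limit variable \<open>W\<close> lives on an arbitrary probability space \<open>\<Omega>\<close>;
  \<open>W\<^sub>N\<close> is \<open>w N\<close> evaluated at a uniform vertex.\<close>

definition weight_regularity ::
    "(nat \<Rightarrow> nat \<Rightarrow> real) \<Rightarrow> 'a measure \<Rightarrow> ('a \<Rightarrow> real) \<Rightarrow> bool" where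
  "weight_regularity w \<Omega> W \<longleftrightarrow>
     prob_space \<Omega> \<and> W \<in> borel_measurable \<Omega> \<and>
     weak_conv_m (\<lambda>N. distr (measure_pmf (pmf_of_set {1..N})) borel (w N)) (distr \<Omega> borel W) \<and>
     integrable \<Omega> W \<and>
     (\<lambda>N. measure_pmf.expectation (pmf_of_set {1..N}) (w N))
       \<longlonglongrightarrow> integral\<^sup>L \<Omega> W \<and>
     integrable \<Omega> (\<lambda>x. (W x)\<^sup>2) \<and>
     (\<lambda>N. measure_pmf.expectation (pmf_of_set {1..N}) (\<lambda>i. (w N i)\<^sup>2))
       \<longlonglongrightarrow> integral\<^sup>L \<Omega> (\<lambda>x. (W x)\<^sup>2) \<and>
     integral\<^sup>L \<Omega> W > 0"

definition spin_configs :: "nat \<Rightarrow> (nat \<Rightarrow> real) set" where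
  "spin_configs N = {1..N} \<rightarrow>\<^sub>E {-1, 1}"

definition total_spin :: "nat \<Rightarrow> (nat \<Rightarrow> real) \<Rightarrow> real" where
  "total_spin N \<sigma> = (\<Sum>i\<in>{1..N}. \<sigma> i)"

definition boltzmann ::
    "nat \<Rightarrow> (nat \<times> nat) set \<Rightarrow> real \<Rightarrow> real \<Rightarrow> (nat \<Rightarrow> real) \<Rightarrow> real" where
  "boltzmann N E \<beta> B \<sigma> = exp (\<beta> * (\<Sum>(i, j)\<in>E. \<sigma> i * \<sigma> j) + B * total_spin N \<sigma>)"

definition partition_function ::
    "nat \<Rightarrow> (nat \<times> nat) set \<Rightarrow> real \<Rightarrow> real \<Rightarrow> real" where
  "partition_function N E \<beta> B = (\<Sum>\<sigma>\<in>spin_configs N. boltzmann N E \<beta> B \<sigma>)"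

definition annealed_measure ::
    "nat \<Rightarrow> (nat \<Rightarrow> real) \<Rightarrow> real \<Rightarrow> real \<Rightarrow> (nat \<Rightarrow> real) measure" where
  "annealed_measure N v \<beta> B = point_measure (spin_configs N)
     (\<lambda>\<sigma>. ennreal (measure_pmf.expectation (grg N v) (\<lambda>E. boltzmann N E \<beta> B \<sigma>) /
                   measure_pmf.expectation (grg N v) (\<lambda>E. partition_function N E \<beta> B)))"

definition magnetization :: "nat \<Rightarrow> (nat \<Rightarrow> real) \<Rightarrow> real \<Rightarrow> real \<Rightarrow> real" where
  "magnetization N v \<beta> B = (\<integral>\<sigma>. total_spin N \<sigma> / real N \<partial>annealed_measure N v \<beta> B)"

definition susceptibility :: "nat \<Rightarrow> (nat \<Rightarrow> real) \<Rightarrow> real \<Rightarrow> real \<Rightarrow> real" where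
  "susceptibility N v \<beta> B = deriv (\<lambda>b. magnetization N v \<beta> b) B"

definition magnetization_limit :: "(nat \<Rightarrow> nat \<Rightarrow> real) \<Rightarrow> real \<Rightarrow> real \<Rightarrow> real" where
  "magnetization_limit w \<beta> B = lim (\<lambda>N. magnetization N (w N) \<beta> B)"

definition susceptibility_limit :: "(nat \<Rightarrow> nat \<Rightarrow> real) \<Rightarrow> real \<Rightarrow> real \<Rightarrow> real" where
  "susceptibility_limit w \<beta> B = lim (\<lambda>N. susceptibility N (w N) \<beta> B)"

definition annealed_critical :: "(nat \<Rightarrow> nat \<Rightarrow> real) \<Rightarrow> real" where
  "annealed_critical w =
     Inf {\<beta>. \<beta> > 0 \<and> (\<exists>m>0. ((\<lambda>B. magnetization_limit w \<beta> B) \<longlongrightarrow> m) (at_right 0))}"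

definition uniqueness_regime :: "(nat \<Rightarrow> nat \<Rightarrow> real) \<Rightarrow> (real \<times> real) set" where
  "uniqueness_regime w =
     {(\<beta>, B). \<beta> \<ge> 0 \<and> B \<noteq> 0 \<or> 0 < \<beta> \<and> \<beta> < annealed_critical w \<and> B = 0}"

text \<open>The case distinction is needed because the library's \<open>normal_density 0 0\<close> is
  identically zero.\<close>

definition centered_normal :: "real \<Rightarrow> real measure" where
  "centered_normal v =
     (if v = 0 then return borel 0 else density lborel (normal_density 0 (sqrt v)))"

end

theory Submission
  imports Defs "HOL-Complex_Analysis.Complex_Analysis"
begin

text \<open>Averaging over the graph turns the annealed weight of a spin configuration into a product over
  vertex pairs, hence into an Ising model on the complete graph. The pair \<open>{i, j}\<close> has
  coupling \<open>1/2 ln ((1 + x exp \<beta>) / (1 + x exp (- \<beta>)))\<close>, where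
  \<open>x = w\<^sub>i w\<^sub>j / \<ell>\<^sub>N\<close>. To first order in \<open>x\<close> this is \<open>sinh \<beta> x = a\<^sub>i a\<^sub>j\<close> with
  \<open>a\<^sub>i = w\<^sub>i sqrt (sinh \<beta> / \<ell>\<^sub>N)\<close>, which makes the interaction half a square,
  \<open>(\<Sum> a\<^sub>i \<sigma>\<^sub>i)\<^sup>2 / 2\<close>. The remaining couplings are of order \<open>x\<^sup>2\<close>. Their total effect
  on the exponent is of order one, so they cannot be dropped at once; but they concentrate around a
  deterministic value, and a deterministic factor cancels in the normalisation
  (\<open>pair_energy_second_moment\<close>, \<open>perturbed_mgf_tendsto\<close>).

  A Gaussian integral linearises the square (\<open>hubbard_stratonovich\<close>): the Curie--Weiss part is a
  mixture of product measures, with mixing density proportional to \<open>exp (G z)\<close> for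
  \<open>G z = - z\<^sup>2 / 2 + \<Sum> ln (cosh (a\<^sub>i z + B))\<close>. Around a critical point \<open>y\<close> of \<open>G\<close>, both the
  mixing density and the conditional law of the total spin become Gaussian. Everything rests on one
  inequality that holds for all \<open>z\<close> and, with a fixed \<open>c > 0\<close>, for all large \<open>N\<close>:
  \<open>G z - G y \<le> - c (z - y)\<^sup>2\<close>. It is an integrable majorant on the whole line, so Laplace's
  method is a single application of dominated convergence. For \<open>B > 0\<close> the inequality follows from
  the concavity of \<open>tanh\<close> on the positive half-line (\<open>cw_potential_quadratic_bound\<close>), for
  \<open>B < 0\<close> by symmetry, and for \<open>B = 0\<close> from \<open>ln (cosh x) \<le> x\<^sup>2 / 2\<close>, provided that
  \<open>sinh \<beta> \<cdot> E W\<^sup>2 / E W < 1\<close>.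

  The limits of the coefficients are limits of averages \<open>(1/N) \<Sum> F (w\<^sub>i)\<close> with \<open>F\<close> of at most
  quadratic growth; these converge under the weight regularity condition
  (\<open>empirical_average_limit\<close>). As a result, the moment generating function of
  \<open>(S\<^sub>N - \<Sum> tanh (a\<^sub>i y + B)) / sqrt N\<close> converges on the real line to \<open>exp (\<kappa> t\<^sup>2 / 2)\<close>. By Montel's
  theorem and the identity theorem it converges on the complex plane
  (\<open>gaussian_mgf_convergence\<close>), which gives the characteristic functions and the first two
  moments at once. The variance of \<open>S\<^sub>N / sqrt N\<close> is the susceptibility, so \<open>\<kappa>\<close> is its limit.

  At \<open>B = 0\<close> it remains to see that \<open>\<beta>\<close> below the critical value implies
  \<open>sinh \<beta> \<cdot> E W\<^sup>2 / E W < 1\<close>. If this number exceeds one, the saddle points for \<open>B > 0\<close> stay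
  away from zero, so the magnetization, which increases with \<open>B\<close>, has a positive limit as
  \<open>B\<close> decreases to \<open>0\<close> (\<open>spontaneous_magnetization\<close>).\<close>

section \<open>Inequalities for hyperbolic functions\<close>

lemma tanh_sq_le_1: "(tanh (x::real))\<^sup>2 \<le> 1"
  by (metis abs_le_square_iff abs_one less_eq_real_def one_power2 tanh_real_abs tanh_real_lt_1)

lemma abs_tanh_le_1: "\<bar>tanh (x::real)\<bar> \<le> 1"
  by (metis less_eq_real_def tanh_real_abs tanh_real_lt_1)

lemma DERIV_ln_cosh [THEN DERIV_chain2, derivative_intros]:
  "((\<lambda>x::real. ln (cosh x)) has_real_derivative tanh x) (at x)"
  by (auto intro!: derivative_eq_intros simp: tanh_def field_simps cosh_real_pos)

lemma DERIV_tanh_real: "(tanh has_real_derivative 1 - (tanh x)\<^sup>2) (at (x::real))"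
  by (auto intro!: derivative_eq_intros simp: cosh_real_nonzero)

lemma tanh_lipschitz: "\<bar>tanh x - tanh y\<bar> \<le> \<bar>x - (y::real)\<bar>"
proof -
  have "norm (tanh x - tanh y) \<le> 1 * norm (x - y)"
    by (rule field_differentiable_bound[of UNIV tanh "\<lambda>x. 1 - (tanh x)\<^sup>2"])
       (use tanh_sq_le_1 in \<open>auto intro!: DERIV_tanh_real\<close>)
  then show ?thesis by simp
qed

lemma ln_cosh_taylor3:
  "\<bar>ln (cosh (h + e)) - ln (cosh h) - e * tanh h - e\<^sup>2 / 2 * (1 - (tanh h)\<^sup>2)\<bar> \<le> \<bar>e::real\<bar> ^ 3"
proof (cases "e = 0")
  case False
  define d :: "nat \<Rightarrow> real \<Rightarrow> real" where
    "d = (\<lambda>n. if n = 0 then (\<lambda>x. ln (cosh x)) else if n = 1 then tanh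
        else if n = 2 then (\<lambda>x. 1 - (tanh x)\<^sup>2) else (\<lambda>x. - 2 * tanh x * (1 - (tanh x)\<^sup>2)))"
  have D: "DERIV (d m) t :> d (Suc m) t" if m3: "m < 3" for m t
  proof -
    consider "m = 0" | "m = 1" | "m = 2" using m3 by atomize_elim arith
    then show ?thesis
    proof cases
      case 3
      have "((\<lambda>x. 1 - (tanh x)\<^sup>2) has_real_derivative - 2 * tanh t * (1 - (tanh t)\<^sup>2)) (at t)"
        by (auto intro!: derivative_eq_intros)
      with 3 show ?thesis by (simp add: d_def)
    qed (use DERIV_tanh_real DERIV_ln_cosh[OF DERIV_ident] in \<open>simp_all add: d_def\<close>)
  qed
  have "\<exists>t. (if h + e < h then h + e < t \<and> t < h else h < t \<and> t < h + e) \<and>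
    ln (cosh (h + e)) = (\<Sum>m<3. (d m h / fact m) * (h + e - h)^m) + (d 3 t / fact 3) * (h + e - h)^3"
    by (rule Taylor[where a = "min h (h+e)" and b = "max h (h+e)"]) (use False D in \<open>auto simp: d_def\<close>)
  then obtain t where t: "ln (cosh (h + e)) = (\<Sum>m<3. (d m h / fact m) * e^m) + (d 3 t / fact 3) * e^3"
    by auto
  have "\<bar>d 3 t\<bar> \<le> 2"
    using mult_mono[of "\<bar>tanh t\<bar>" 1 "1 - (tanh t)\<^sup>2" 1] abs_tanh_le_1[of t] tanh_sq_le_1[of t]
    by (auto simp: d_def abs_mult)
  then have "\<bar>d 3 t / fact 3\<bar> \<le> 1"
    by (simp add: fact_numeral)
  moreover have "ln (cosh (h + e)) - ln (cosh h) - e * tanh h - e\<^sup>2 / 2 * (1 - (tanh h)\<^sup>2)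
      = (d 3 t / fact 3) * e^3"
    unfolding t by (simp add: eval_nat_numeral d_def field_simps)
  ultimately show ?thesis
    using mult_right_mono[of "\<bar>d 3 t / fact 3\<bar>" 1 "\<bar>e\<bar> ^ 3"] by (simp only: abs_mult power_abs) simp
qed auto

lemma ln_cosh_taylor2:
  "ln (cosh (h + e)) \<le> ln (cosh h) + e * tanh h + (e::real)\<^sup>2 / 2"
proof (cases "e = 0")
  case False
  define d :: "nat \<Rightarrow> real \<Rightarrow> real" where
    "d = (\<lambda>n. if n = 0 then (\<lambda>x. ln (cosh x)) else if n = 1 then tanh
        else (\<lambda>x. 1 - (tanh x)\<^sup>2))"
  have D: "DERIV (d m) t :> d (Suc m) t" if m2: "m < 2" for m t
  proof -
    consider "m = 0" | "m = 1" using m2 by atomize_elim arith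
    then show ?thesis
      by cases (use DERIV_tanh_real DERIV_ln_cosh[OF DERIV_ident] in \<open>simp_all add: d_def\<close>)
  qed
  have "\<exists>t. (if h + e < h then h + e < t \<and> t < h else h < t \<and> t < h + e) \<and>
    ln (cosh (h + e)) = (\<Sum>m<2. (d m h / fact m) * (h + e - h)^m) + (d 2 t / fact 2) * (h + e - h)^2"
    by (rule Taylor[where a = "min h (h+e)" and b = "max h (h+e)"]) (use False D in \<open>auto simp: d_def\<close>)
  then obtain t where t: "ln (cosh (h + e)) = (\<Sum>m<2. (d m h / fact m) * e^m) + (d 2 t / fact 2) * e^2"
    by auto
  have "d 2 t \<le> 1" by (auto simp: d_def)
  then have "d 2 t * e\<^sup>2 \<le> 1 * e\<^sup>2" by (intro mult_right_mono) auto
  then show ?thesis unfolding t by (simp add: eval_nat_numeral d_def field_simps)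
qed auto

lemma tanh_concave: "concave_on {0..} (tanh :: real \<Rightarrow> real)"
  unfolding concave_on_def
proof (rule convex_on_realI)
  show "((\<lambda>x. - tanh x) has_real_derivative - (1 - (tanh x)\<^sup>2)) (at x)" for x :: real
    by (auto intro!: derivative_eq_intros simp: cosh_real_nonzero)
  show "- (1 - (tanh x)\<^sup>2) \<le> - (1 - (tanh y)\<^sup>2)" if "x \<in> {0..}" "x \<le> y" for x y :: real
    using that by (auto intro!: power_mono)
qed auto

text \<open>A rational lower bound for \<open>tanh\<close>, which turns estimates into inequalities between the first two
  moments of the weights.\<close>

lemma tanh_ge_frac: "q / (1 + q) \<le> tanh q" if "q \<ge> (0::real)"
proof -
  have e: "1 + 2 * q \<le> exp (2 * q)" by (rule exp_ge_add_one_self)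
  have "tanh q = 1 - 2 / (exp (2 * q) + 1)"
  proof -
    define E where "E = exp (2 * q)"
    have "E > 0" by (simp add: E_def)
    then have E: "E \<noteq> 0" "E + 1 \<noteq> 0" by linarith+
    have "1 + 1 / E = (E + 1) / E" "1 - 1 / E = (E - 1) / E" "1 - 2 / (E + 1) = (E - 1) / (E + 1)"
      using E by (simp_all add: field_simps)
    then have "(1 - 1 / E) / (1 + 1 / E) = 1 - 2 / (E + 1)" using E by simp
    moreover have "exp (- 2 * q) = 1 / E" by (simp add: E_def exp_minus inverse_eq_divide)
    ultimately show ?thesis by (simp only: tanh_real_altdef E_def)
  qed
  also have "\<dots> \<ge> 1 - 2 / (1 + 2 * q + 1)"
  proof -
    have "2 / (exp (2 * q) + 1) \<le> 2 / (1 + 2 * q + 1)"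
      by (rule divide_left_mono) (use e that in \<open>auto intro!: mult_pos_pos add_pos_nonneg\<close>)
    then show ?thesis by simp
  qed
  also have "1 - 2 / (1 + 2 * q + 1) = q / (1 + q)"
    using that by (simp add: field_simps)
  finally show ?thesis by simp
qed

text \<open>The left-hand side is \<open>2 artanh (tanh B tanh s)\<close>, and \<open>artanh x \<ge> x\<close> for \<open>x \<ge> 0\<close>.
  The proof compares derivatives.\<close>

lemma ln_cosh_diff_ge:
  fixes s B :: real
  assumes "s \<ge> 0" "B \<ge> 0"
  shows "ln (cosh (B + s)) - ln (cosh (B - s)) \<ge> 2 * tanh B * tanh s"
proof -
  have "((\<lambda>s. ln (cosh (B + s)) - ln (cosh (B - s)) - 2 * tanh B * tanh s) has_real_derivative
     tanh (B + s) + tanh (B - s) - 2 * tanh B * (1 - (tanh s)\<^sup>2)) (at s)" for s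
    by (auto intro!: derivative_eq_intros simp: cosh_real_nonzero)
  note D1 = this
  have "tanh (B + s) + tanh (B - s) - 2 * tanh B * (1 - (tanh s)\<^sup>2) \<ge> 0" for s
  proof -
    define b c where "b = tanh B" and "c = tanh s"
    have bc: "0 \<le> b" "b < 1" "-1 < c" "c < 1"
      using assms tanh_real_lt_1 tanh_real_gt_neg1 by (auto simp: b_def c_def)
    have "\<bar>b * c\<bar> < 1 * 1"
      unfolding abs_mult using bc by (intro mult_strict_mono) auto
    then have pos: "1 + b * c > 0" "1 - b * c > 0" by linarith+
    have "tanh (B + s) = (b + c) / (1 + b * c)" "tanh (B - s) = (b - c) / (1 - b * c)"
      using tanh_add[of B s] tanh_add[of B "-s"] by (simp_all add: b_def c_def cosh_real_nonzero)
    then have "tanh (B + s) + tanh (B - s) = 2 * b * (1 - c\<^sup>2) / (1 - (b * c)\<^sup>2)"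
    proof -
      have "1 - (b * c)\<^sup>2 = (1 + b * c) * (1 - b * c)" by (simp add: algebra_simps power2_eq_square)
      moreover have "(b + c) / (1 + b * c) + (b - c) / (1 - b * c)
          = ((b + c) * (1 - b * c) + (b - c) * (1 + b * c)) / ((1 + b * c) * (1 - b * c))"
        using pos by (simp add: add_frac_eq)
      moreover have "(b + c) * (1 - b * c) + (b - c) * (1 + b * c) = 2 * b * (1 - c\<^sup>2)"
        by (simp add: algebra_simps power2_eq_square)
      ultimately show ?thesis using \<open>tanh (B + s) = _\<close> \<open>tanh (B - s) = _\<close> by metis
    qed
    also have "\<dots> \<ge> 2 * b * (1 - c\<^sup>2) / 1"
    proof (rule divide_left_mono)
      show "0 \<le> 2 * b * (1 - c\<^sup>2)" using bc tanh_sq_le_1[of s] by (simp add: c_def)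
      have "(1 + b * c) * (1 - b * c) > 0" using pos by simp
      then show "0 < 1 * (1 - (b*c)\<^sup>2)" by (simp add: algebra_simps power2_eq_square)
    qed auto
    finally show ?thesis by (simp add: b_def c_def)
  qed
  note D = D1 this
  have "(\<lambda>s. ln (cosh (B + s)) - ln (cosh (B - s)) - 2 * tanh B * tanh s) 0 \<le>
    (\<lambda>s. ln (cosh (B + s)) - ln (cosh (B - s)) - 2 * tanh B * tanh s) s"
    by (rule DERIV_nonneg_imp_nondecreasing[OF assms(1)]) (use D in fast)
  then show ?thesis by simp
qed

section \<open>The Curie--Weiss potential\<close>

text \<open>The function \<open>\<phi> z = (\<Sum> b\<^sub>i tanh (c\<^sub>i z + B)) - z\<close> is concave on the positive half-line, vanishes at
  \<open>y\<close>, and its value at \<open>0\<close> is \<open>tanh B \<Sum> b\<^sub>i \<ge> tanh B y\<close>. The line through its values at \<open>0\<close> and \<open>y\<close>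
  has slope at most \<open>- tanh B\<close>; by concavity \<open>\<phi>\<close> lies above this line before \<open>y\<close> and below it
  after \<open>y\<close>. The constant depends on \<open>B\<close> only. This serves twice: for the derivative of \<open>G\<close>, and for the convergence of
  the saddle points.\<close>

lemma fixed_point_strong_monotone:
  fixes b c :: "'i \<Rightarrow> real" and B y z :: real
  assumes I: "finite I" and b: "\<And>i. i \<in> I \<Longrightarrow> b i \<ge> 0" and c: "\<And>i. i \<in> I \<Longrightarrow> c i \<ge> 0"
    and B: "B > 0" and y: "y = (\<Sum>i\<in>I. b i * tanh (c i * y + B))" and y0: "y \<ge> 0" and z: "z \<ge> 0"
  shows "(y - z) * ((\<Sum>i\<in>I. b i * tanh (c i * z + B)) - z) \<ge> tanh B * (y - z)\<^sup>2"
proof -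
  define \<phi> where "\<phi> = (\<lambda>z. (\<Sum>i\<in>I. b i * tanh (c i * z + B)) - z)"
  have tb: "0 < tanh B" using B by simp
  \<comment> \<open>Concavity of \<open>\<phi>\<close>, used only for segments that start at \<open>0\<close>.\<close>
  have conc: "\<phi> (t * x) \<ge> (1 - t) * \<phi> 0 + t * \<phi> x" if "x \<ge> 0" "0 \<le> t" "t \<le> 1" for t x
  proof -
    have "tanh (c i * (t * x) + B) \<ge> (1 - t) * tanh B + t * tanh (c i * x + B)" if "i \<in> I" for i
    proof -
      have "(1 - t) * tanh B + t * tanh (c i * x + B) \<le> tanh ((1 - t) *\<^sub>R B + t *\<^sub>R (c i * x + B))"
        by (rule concave_onD[OF tanh_concave, of t B "c i * x + B"])
          (use B \<open>0 \<le> t\<close> \<open>t \<le> 1\<close> \<open>x \<ge> 0\<close> c[OF that] in \<open>auto intro!: add_nonneg_nonneg\<close>)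
      then show ?thesis by (simp add: algebra_simps)
    qed
    then have "(\<Sum>i\<in>I. b i * tanh (c i * (t * x) + B)) \<ge> (\<Sum>i\<in>I. b i * ((1 - t) * tanh B + t * tanh (c i * x + B)))"
      using b by (intro sum_mono mult_left_mono) auto
    then show ?thesis
      by (simp add: \<phi>_def sum_distrib_left sum_distrib_right sum.distrib sum_subtractf algebra_simps)
  qed
  have \<phi>y: "\<phi> y = 0" using y by (simp add: \<phi>_def)
  have yS: "y \<le> (\<Sum>i\<in>I. b i)"
  proof -
    have "(\<Sum>i\<in>I. b i * tanh (c i * y + B)) \<le> (\<Sum>i\<in>I. b i * 1)"
      using b tanh_real_lt_1 by (intro sum_mono mult_left_mono) (auto intro: less_imp_le)
    then show ?thesis using y by simp
  qed
  have \<phi>0: "\<phi> 0 \<ge> tanh B * y"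
    using yS tb by (simp add: \<phi>_def sum_distrib_left[symmetric] mult.commute)
  have "(y - z) * \<phi> z \<ge> tanh B * (y - z)\<^sup>2"
  \<comment> \<open>For \<open>y = 0\<close> there is no chord; but then all \<open>b\<^sub>i\<close> vanish.\<close>
  proof (cases "y = 0")
    case True
    have "\<And>i. i \<in> I \<Longrightarrow> b i * tanh (c i * y + B) = 0"
      using True y b c B sum_nonneg_eq_0_iff[OF I, of "\<lambda>i. b i * tanh (c i * y + B)"] by auto
    then have "\<And>i. i \<in> I \<Longrightarrow> b i = 0" using True B by auto
    then have "\<phi> z = - z" by (simp add: \<phi>_def)
    then show ?thesis using True z tanh_real_lt_1[of B] 
      using mult_right_mono[of "tanh B" 1 "z * z"] by (simp add: power2_eq_square)
  next
    case False
    then have ypos: "y > 0" using y0 by simp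
    show ?thesis
    proof (cases "z \<le> y")
      case True
      have "\<phi> (z / y * y) \<ge> (1 - z / y) * \<phi> 0 + (z / y) * \<phi> y"
        by (rule conc) (use True z ypos in auto)
      then have "\<phi> z \<ge> (1 - z / y) * \<phi> 0" using \<phi>y ypos by simp
      also have "(1 - z / y) * \<phi> 0 \<ge> (1 - z / y) * (tanh B * y)"
        using True ypos \<phi>0 by (intro mult_left_mono) auto
      also (xtrans) have "(1 - z / y) * (tanh B * y) = tanh B * (y - z)" using ypos by (simp add: field_simps)
      finally have "(y - z) * \<phi> z \<ge> (y - z) * (tanh B * (y - z))"
        using True by (intro mult_left_mono) auto
      then show ?thesis by (simp add: power2_eq_square algebra_simps)
    next
      case False
      then have zy: "y < z" "0 < z" using ypos by auto
      have "\<phi> (y / z * z) \<ge> (1 - y / z) * \<phi> 0 + (y / z) * \<phi> z"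
        by (rule conc) (use zy ypos in auto)
      then have "(y / z) * \<phi> z \<le> - ((1 - y / z) * \<phi> 0)" using \<phi>y zy by simp
      also have "(1 - y / z) * \<phi> 0 \<ge> (1 - y / z) * (tanh B * y)"
        using zy ypos \<phi>0 by (intro mult_left_mono) auto
      then have "- ((1 - y / z) * \<phi> 0) \<le> - ((1 - y / z) * (tanh B * y))" by simp
      finally have "(z / y) * ((y / z) * \<phi> z) \<le> (z / y) * (- ((1 - y / z) * (tanh B * y)))"
        using zy ypos by (intro mult_left_mono) auto
      moreover have "(z / y) * ((y / z) * \<phi> z) = \<phi> z" using zy ypos by simp
      moreover have "(z / y) * (- ((1 - y / z) * (tanh B * y))) = - tanh B * (z - y)"
        using zy ypos by (simp add: field_simps)
      ultimately have "\<phi> z \<le> - tanh B * (z - y)" by simp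
      then have "(z - y) * \<phi> z \<le> (z - y) * (- tanh B * (z - y))"
        using zy by (intro mult_left_mono) auto
      then show ?thesis by (simp add: power2_eq_square algebra_simps)
    qed
  qed
  then show ?thesis by (simp add: \<phi>_def)
qed

lemma fixed_point_exists:
  fixes b c :: "'i \<Rightarrow> real" and B :: real
  assumes I: "finite I" and b: "\<And>i. i \<in> I \<Longrightarrow> b i \<ge> 0" and c: "\<And>i. i \<in> I \<Longrightarrow> c i \<ge> 0" and B: "B > 0"
  obtains y where "0 \<le> y" "y \<le> (\<Sum>i\<in>I. b i)" "y = (\<Sum>i\<in>I. b i * tanh (c i * y + B))"
proof -
  define \<phi> where "\<phi> = (\<lambda>z. (\<Sum>i\<in>I. b i * tanh (c i * z + B)) - z)"
  have "\<exists>x. 0 \<le> x \<and> x \<le> (\<Sum>i\<in>I. b i) \<and> \<phi> x = 0"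
  proof (rule IVT2)
    have "(\<Sum>i\<in>I. b i * tanh (c i * z + B)) \<le> (\<Sum>i\<in>I. b i * 1)" for z
      using b tanh_real_lt_1 by (intro sum_mono mult_left_mono) (auto intro: less_imp_le)
    then show "\<phi> (\<Sum>i\<in>I. b i) \<le> 0" by (simp add: \<phi>_def)
    show "0 \<le> \<phi> 0" using b B by (auto simp: \<phi>_def intro!: sum_nonneg)
    show "0 \<le> (\<Sum>i\<in>I. b i)" using b by (auto intro!: sum_nonneg)
    show "\<forall>x. 0 \<le> x \<and> x \<le> (\<Sum>i\<in>I. b i) \<longrightarrow> isCont \<phi> x"
      by (auto simp: \<phi>_def intro!: continuous_intros)
  qed
  then show ?thesis using that by (auto simp: \<phi>_def)
qed

definition cw_potential :: "'i set \<Rightarrow> ('i \<Rightarrow> real) \<Rightarrow> real \<Rightarrow> real \<Rightarrow> real" where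
  "cw_potential I a B z = - (z\<^sup>2 / 2) + (\<Sum>i\<in>I. ln (cosh (a i * z + B)))"

lemma DERIV_cw_potential:
  assumes "finite I"
  shows "(cw_potential I a B has_real_derivative (\<Sum>i\<in>I. a i * tanh (a i * z + B)) - z) (at z)"
  unfolding cw_potential_def[abs_def]
  by (auto intro!: derivative_eq_intros simp: mult.commute)

text \<open>On the positive half-line the quadratic bound is the integrated form of the previous
  monotonicity, with \<open>b = c = a\<close>.\<close>

lemma cw_potential_quadratic_nonneg:
  fixes a :: "'i \<Rightarrow> real" and B y z :: real
  assumes I: "finite I" and a: "\<And>i. i \<in> I \<Longrightarrow> a i \<ge> 0"
    and B: "B > 0" and y: "y = (\<Sum>i\<in>I. a i * tanh (a i * y + B))" and y0: "y \<ge> 0" and z: "z \<ge> 0"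
  shows "cw_potential I a B z - cw_potential I a B y \<le> - (tanh B / 2) * (z - y)\<^sup>2"
proof -
  define H where "H = (\<lambda>z. cw_potential I a B z + (tanh B / 2) * (z - y)\<^sup>2)"
  define \<phi> where "\<phi> = (\<lambda>z. (\<Sum>i\<in>I. a i * tanh (a i * z + B)) - z)"
  have D: "(H has_real_derivative \<phi> z + tanh B * (z - y)) (at z)" for z
    unfolding H_def \<phi>_def by (auto intro!: derivative_eq_intros DERIV_cw_potential[OF I])
  have key: "(y - z) * \<phi> z \<ge> tanh B * (y - z)\<^sup>2" if "z \<ge> 0" for z
    unfolding \<phi>_def by (rule fixed_point_strong_monotone[OF I a a B y y0 that])
  have "H z \<le> H y"
  proof (cases "z \<le> y")
    case True
    show ?thesis
    proof (rule DERIV_nonneg_imp_nondecreasing[OF True])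
      fix x assume "z \<le> x" "x \<le> y"
      then have "\<phi> x + tanh B * (x - y) \<ge> 0"
      proof (cases "x = y")
        case True then show ?thesis using y by (simp add: \<phi>_def)
      next
        case False
        have "(y - x) * (tanh B * (y - x)) \<le> (y - x) * \<phi> x"
          using key[of x] \<open>z \<le> x\<close> z by (simp add: power2_eq_square algebra_simps)
        then have "tanh B * (y - x) \<le> \<phi> x" by (rule mult_left_le_imp_le) (use False \<open>x \<le> y\<close> in auto)
        then show ?thesis by (simp add: algebra_simps)
      qed
      then show "\<exists>y. DERIV H x :> y \<and> 0 \<le> y" using D by blast
    qed
  next
    case False
    show ?thesis
    proof (rule DERIV_nonpos_imp_nonincreasing[of y z H])
      show "y \<le> z" using False by simp
      fix x assume "y \<le> x" "x \<le> z"
      then have "\<phi> x + tanh B * (x - y) \<le> 0"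
      proof (cases "x = y")
        case True then show ?thesis using y by (simp add: \<phi>_def)
      next
        case False
        have "(x - y) * (tanh B * (x - y)) \<le> (x - y) * (- \<phi> x)"
          using key[of x] \<open>y \<le> x\<close> y0 by (simp add: power2_eq_square algebra_simps)
        then have "tanh B * (x - y) \<le> - \<phi> x" by (rule mult_left_le_imp_le) (use False \<open>y \<le> x\<close> in auto)
        then show ?thesis by (simp add: algebra_simps)
      qed
      then show "\<exists>y. DERIV H x :> y \<and> y \<le> 0" using D by blast
    qed
  qed
  then show ?thesis by (simp add: H_def)
qed

text \<open>By \<open>tanh q \<ge> q / (1 + q)\<close> with \<open>q\<^sub>i = a\<^sub>i y / 2\<close>, it suffices to bound \<open>\<Sum> q\<^sub>i / (1 + q\<^sub>i)\<close> from
  below. Cauchy--Schwarz would do. Instead, \<open>1 / (1 + q)\<close> is replaced by its tangent at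
  \<open>1 + q = k\<close>, and \<open>k = 1 + \<theta> / 2\<close> makes the result \<open>y \<Sum> a\<^sub>i / (2 k)\<close>.\<close>

lemma sum_tanh_lower:
  fixes a :: "'i \<Rightarrow> real"
  assumes I: "finite I" and a: "\<And>i. i \<in> I \<Longrightarrow> a i \<ge> 0"
    and y0: "y \<ge> 0" and yS: "y \<le> (\<Sum>i\<in>I. a i)" and \<theta>: "(\<Sum>i\<in>I. (a i)\<^sup>2) \<le> \<theta>"
  shows "(\<Sum>i\<in>I. tanh (a i * (y / 2))) \<ge> y\<^sup>2 / (2 + \<theta>)"
proof -
  define k where "k = 1 + \<theta> / 2"
  have \<theta>0: "\<theta> \<ge> 0" using \<theta> sum_nonneg[of I "\<lambda>i. (a i)\<^sup>2"] by (simp add: order_trans)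
  then have k: "k > 0" by (simp add: k_def)
  define S where "S = (\<Sum>i\<in>I. a i)"
  have pt: "tanh q \<ge> q * (2 / k - (1 + q) / k\<^sup>2)" if "q \<ge> 0" for q
  proof -
    have "1 / (1 + q) - (2 / k - (1 + q) / k\<^sup>2) = (k - (1 + q))\<^sup>2 / ((1 + q) * k\<^sup>2)"
      using k that by (simp add: field_simps power2_eq_square)
    also have "\<dots> \<ge> 0" using k that by simp
    finally have "q * (1 / (1 + q)) \<ge> q * (2 / k - (1 + q) / k\<^sup>2)"
      using that by (intro mult_left_mono) auto
    with tanh_ge_frac[OF that] show ?thesis by simp
  qed
  have "(\<Sum>i\<in>I. tanh (a i * (y / 2))) \<ge> (\<Sum>i\<in>I. (a i * (y / 2)) * (2 / k - (1 + (a i * (y / 2))) / k\<^sup>2))"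
    using a y0 by (intro sum_mono pt) auto
  also have "(\<Sum>i\<in>I. (a i * (y / 2)) * (2 / k - (1 + (a i * (y / 2))) / k\<^sup>2)) =
    (\<Sum>i\<in>I. a i * (y / 2 * (2 / k - 1 / k\<^sup>2)) - (a i)\<^sup>2 * ((y/2)\<^sup>2 / k\<^sup>2))"
    by (intro sum.cong) (auto simp: algebra_simps power2_eq_square add_divide_distrib)
  also have "\<dots> = S * (y / 2 * (2 / k - 1 / k\<^sup>2)) - (\<Sum>i\<in>I. (a i)\<^sup>2) * ((y/2)\<^sup>2 / k\<^sup>2)"
    unfolding S_def by (simp only: sum_subtractf sum_distrib_right)
  finally have 1: "(\<Sum>i\<in>I. tanh (a i * (y / 2)))
      \<ge> S * (y / 2 * (2 / k - 1 / k\<^sup>2)) - (\<Sum>i\<in>I. (a i)\<^sup>2) * ((y/2)\<^sup>2 / k\<^sup>2)" .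
  have 2: "(\<Sum>i\<in>I. (a i)\<^sup>2) * ((y/2)\<^sup>2 / k\<^sup>2) \<le> \<theta> * (S * y / 4 / k\<^sup>2)"
  proof (rule mult_mono)
    show "(y/2)\<^sup>2 / k\<^sup>2 \<le> S * y / 4 / k\<^sup>2"
      using yS y0 by (intro divide_right_mono) (auto simp: S_def power2_eq_square intro!: mult_right_mono)
  qed (use \<theta> \<theta>0 in auto)
  have 3: "S * (y / 2 * (2 / k - 1 / k\<^sup>2)) - \<theta> * (S * y / 4 / k\<^sup>2) = S * y / 2 * ((2 * k - 1 - \<theta> / 2) / k\<^sup>2)"
    using k by (simp add: field_simps power2_eq_square)
  have "2 * k - 1 - \<theta> / 2 = k" by (simp add: k_def)
  then have 4: "S * y / 2 * ((2 * k - 1 - \<theta> / 2) / k\<^sup>2) = S * y / (2 * k)"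
    using k by (simp only: power2_eq_square) simp
  have 5: "2 * k = 2 + \<theta>" by (simp add: k_def)
  have "y\<^sup>2 / (2 + \<theta>) \<le> S * y / (2 + \<theta>)"
    using yS y0 \<theta>0 by (intro divide_right_mono) (auto simp: S_def power2_eq_square intro!: mult_right_mono)
  then have 6: "y\<^sup>2 / (2 + \<theta>) \<le> S * y / (2 * k)" unfolding 5 .
  from 1 2 3 4 6 show ?thesis by linarith
qed

text \<open>For \<open>B > 0\<close> the potential may have a second local maximum near \<open>- y\<close>, and the bound must keep
  it at a distance. Write \<open>z = - v\<close> with \<open>v > 0\<close> and
  \<open>D = G v - G (- v) \<ge> 2 tanh B \<Sum> tanh (a\<^sub>i v)\<close>. If \<open>v\<close> is not within \<open>y / 2\<close> of \<open>y\<close>, then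
  \<open>v + y \<le> 5 \<bar>v - y\<bar>\<close> and the bound at \<open>v\<close> suffices. If it is, then \<open>D\<close> is at least a multiple of
  \<open>y\<^sup>2\<close> by the previous lemma, and \<open>v + y \<le> 5 y / 2\<close>. The factor \<open>50 = 2 \<cdot> 5\<^sup>2\<close> accounts for the first case.
  The constant involves \<open>a\<close> only through the bound \<open>\<theta>\<close> for \<open>\<Sum> a\<^sub>i\<^sup>2\<close>, so it is uniform in \<open>N\<close>.\<close>

lemma cw_potential_quadratic_bound:
  fixes a :: "'i \<Rightarrow> real" and B y z :: real
  assumes I: "finite I" and a: "\<And>i. i \<in> I \<Longrightarrow> a i \<ge> 0"
    and B: "B > 0" and y: "y = (\<Sum>i\<in>I. a i * tanh (a i * y + B))" and y0: "y \<ge> 0"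
    and \<theta>: "(\<Sum>i\<in>I. (a i)\<^sup>2) \<le> \<theta>"
  shows "cw_potential I a B z - cw_potential I a B y \<le> - (tanh B / (50 * (2 + \<theta>))) * (z - y)\<^sup>2"
proof -
  have \<theta>0: "\<theta> \<ge> 0" using \<theta> sum_nonneg[of I "\<lambda>i. (a i)\<^sup>2"] by (simp add: order_trans)
  have tb: "0 < tanh B" using B by simp
  define c where "c = tanh B / (50 * (2 + \<theta>))"
  have c_le: "25 * c \<le> tanh B / 2" and c0: "c \<ge> 0" and c_le': "25 * c \<le> tanh B / (2 + \<theta>)"
    using tb \<theta>0 by (auto simp: c_def field_simps)
  show ?thesis
  proof (cases "z \<ge> 0")
    case True
    have "cw_potential I a B z - cw_potential I a B y \<le> - (tanh B / 2) * (z - y)\<^sup>2"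
      by (rule cw_potential_quadratic_nonneg[OF I a B y y0 True])
    also have "\<dots> \<le> - c * (z - y)\<^sup>2"
      using c_le c0 by (intro mult_right_mono) auto
    finally show ?thesis by (simp add: c_def)
  next
    case False
    define v where "v = - z"
    have v: "v > 0" "z = - v" using False by (auto simp: v_def)
    define D where "D = (\<Sum>i\<in>I. ln (cosh (B + a i * v)) - ln (cosh (B - a i * v)))"
    have GD: "cw_potential I a B z = cw_potential I a B v - D"
      by (simp add: cw_potential_def v(2) D_def sum_subtractf algebra_simps)
    have Dge: "D \<ge> 2 * tanh B * (\<Sum>i\<in>I. tanh (a i * v))"
      unfolding D_def sum_distrib_left using a v B
      by (intro sum_mono ln_cosh_diff_ge) auto
    have q: "cw_potential I a B v - cw_potential I a B y \<le> - (tanh B / 2) * (v - y)\<^sup>2"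
      by (rule cw_potential_quadratic_nonneg[OF I a B y y0]) (use v in auto)
    show ?thesis
    proof (cases "\<bar>v - y\<bar> \<ge> y / 2")
      case True
      have "0 \<le> (\<Sum>i\<in>I. tanh (a i * v))" using a v by (intro sum_nonneg) auto
      then have "D \<ge> 0" using Dge tb by (smt (verit) mult_nonneg_nonneg)
      then have 1: "cw_potential I a B z - cw_potential I a B y \<le> - (tanh B / 2) * (v - y)\<^sup>2"
        using q GD by simp
      have "\<bar>v + y\<bar> \<le> 5 * \<bar>v - y\<bar>" using True v y0 by (auto simp: abs_if split: if_splits)
      then have "(v + y)\<^sup>2 \<le> (5 * (v - y))\<^sup>2" by (subst abs_le_square_iff[symmetric], subst abs_mult) simp
      then have "c * (z - y)\<^sup>2 \<le> c * (25 * (v - y)\<^sup>2)"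
        using c0 v(2) by (intro mult_left_mono) (auto simp: power2_eq_square algebra_simps)
      also have "\<dots> \<le> (tanh B / 2) * (v - y)\<^sup>2"
        using c_le mult_right_mono[of "25 * c" "tanh B / 2" "(v - y)\<^sup>2"] by simp
      finally show ?thesis using 1 unfolding c_def[symmetric] by linarith
    next
      case False
      then have vy: "v \<ge> y / 2" "v + y \<le> 5 / 2 * y" by (auto simp: abs_if split: if_splits)
      have yS: "y \<le> (\<Sum>i\<in>I. a i)"
      proof -
        have "(\<Sum>i\<in>I. a i * tanh (a i * y + B)) \<le> (\<Sum>i\<in>I. a i * 1)"
          using a tanh_real_lt_1 by (intro sum_mono mult_left_mono) (auto intro: less_imp_le)
        then show ?thesis using y by simp
      qed
      have "y\<^sup>2 / (2 + \<theta>) \<le> (\<Sum>i\<in>I. tanh (a i * (y / 2)))"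
        by (rule sum_tanh_lower[OF I a y0 yS \<theta>])
      also have "\<dots> \<le> (\<Sum>i\<in>I. tanh (a i * v))"
      proof (rule sum_mono)
        fix i assume "i \<in> I"
        then have "a i * (y / 2) \<le> a i * v" using a vy by (intro mult_left_mono) auto
        then show "tanh (a i * (y / 2)) \<le> tanh (a i * v)" by (simp only: tanh_real_le_iff)
      qed
      finally have "2 * tanh B * (y\<^sup>2 / (2 + \<theta>)) \<le> 2 * tanh B * (\<Sum>i\<in>I. tanh (a i * v))"
        using tb by (intro mult_left_mono) auto
      then have D2: "D \<ge> 2 * tanh B * (y\<^sup>2 / (2 + \<theta>))" using Dge by linarith
      have "cw_potential I a B v - cw_potential I a B y \<le> 0"
        using q tb by (smt (verit) mult_nonneg_nonneg zero_le_power2 mult_minus_left divide_nonneg_nonneg)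
      then have 1: "cw_potential I a B z - cw_potential I a B y \<le> - (2 * tanh B * (y\<^sup>2 / (2 + \<theta>)))"
        using D2 GD by simp
      have "(v + y)\<^sup>2 \<le> (5 / 2 * y)\<^sup>2" using vy v y0 by (intro power_mono) auto
      then have "c * (z - y)\<^sup>2 \<le> c * (25 / 4 * y\<^sup>2)"
        using c0 v(2) by (intro mult_left_mono) (auto simp: power2_eq_square algebra_simps)
      also have "\<dots> = 25 * c * (y\<^sup>2 / 4)" by simp
      also have "\<dots> \<le> tanh B / (2 + \<theta>) * (y\<^sup>2 / 4)" using c_le' by (intro mult_right_mono) auto
      also have "\<dots> \<le> 2 * tanh B * (y\<^sup>2 / (2 + \<theta>))" 
        using tb \<theta>0 by (simp add: field_simps)
      finally show ?thesis using 1 unfolding c_def[symmetric] by linarith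
    qed
  qed
qed

lemma cw_potential_quadratic_bound_zero_field:
  fixes a :: "'i \<Rightarrow> real"
  assumes \<theta>: "(\<Sum>i\<in>I. (a i)\<^sup>2) \<le> \<theta>"
  shows "cw_potential I a 0 z - cw_potential I a 0 0 \<le> - ((1 - \<theta>) / 2) * z\<^sup>2"
proof -
  have "(\<Sum>i\<in>I. ln (cosh (a i * z))) \<le> (\<Sum>i\<in>I. (a i)\<^sup>2 * (z\<^sup>2 / 2))"
  proof (rule sum_mono)
    show "ln (cosh (a i * z)) \<le> (a i)\<^sup>2 * (z\<^sup>2 / 2)" for i
      using ln_cosh_taylor2[of 0 "a i * z"] by (simp add: power_mult_distrib)
  qed
  also have "\<dots> \<le> \<theta> * (z\<^sup>2 / 2)"
    using \<theta> unfolding sum_distrib_right[symmetric] by (intro mult_right_mono) auto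
  finally show ?thesis by (simp add: cw_potential_def algebra_simps diff_divide_distrib)
qed

lemma cw_potential_minus: "cw_potential I a (- B) (- z) = cw_potential I a B z"
proof -
  have "cosh (a i * (- z) + (- B)) = cosh (a i * z + B)" for i
  proof -
    have "a i * (- z) + (- B) = - (a i * z + B)" by simp
    then show ?thesis by (simp only: cosh_minus)
  qed
  then show ?thesis unfolding cw_potential_def by (simp only: power2_minus)
qed

section \<open>The annealed measure as a mean-field Ising model\<close>

lemma finite_spin_configs [simp]: "finite (spin_configs N)"
  by (auto simp: spin_configs_def intro!: finite_PiE)

lemma spin_configs_nonempty: "spin_configs N \<noteq> {}"
  by (simp add: spin_configs_def PiE_eq_empty_iff)

lemma spin_cases: "\<sigma> \<in> spin_configs N \<Longrightarrow> i \<in> {1..N} \<Longrightarrow> \<sigma> i = 1 \<or> \<sigma> i = -1"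
  unfolding spin_configs_def by (drule PiE_mem) auto

lemma spin_square: "\<sigma> \<in> spin_configs N \<Longrightarrow> i \<in> {1..N} \<Longrightarrow> \<sigma> i * \<sigma> i = 1"
  using spin_cases by fastforce

lemma abs_spin: "\<sigma> \<in> spin_configs N \<Longrightarrow> i \<in> {1..N} \<Longrightarrow> \<bar>\<sigma> i\<bar> = 1"
  using spin_cases by fastforce

lemma finite_vertex_pairs [simp]: "finite (vertex_pairs N)"
proof -
  have "vertex_pairs N \<subseteq> {1..N} \<times> {1..N}" by (auto simp: vertex_pairs_def)
  moreover have "finite ({1..N} \<times> {1..N})" by (intro finite_cartesian_product finite_atLeastAtMost)
  ultimately show ?thesis by (rule finite_subset)
qed

lemma vertex_pairs_Suc:
  "vertex_pairs (Suc N) = vertex_pairs N \<union> (\<lambda>i. (i, Suc N)) ` {1..N}"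
  by (auto simp: vertex_pairs_def image_iff le_Suc_eq)

lemma square_of_sum_vertex_pairs:
  fixes x :: "nat \<Rightarrow> real"
  shows "(\<Sum>i\<in>{1..N}. x i)\<^sup>2 = (\<Sum>i\<in>{1..N}. (x i)\<^sup>2) + 2 * (\<Sum>(i, j)\<in>vertex_pairs N. x i * x j)"
proof (induction N)
  case 0
  have "vertex_pairs 0 = {}" by (auto simp: vertex_pairs_def)
  then show ?case by simp
next
  case (Suc N)
  have "(\<Sum>(i, j)\<in>vertex_pairs (Suc N). x i * x j)
      = (\<Sum>(i, j)\<in>vertex_pairs N. x i * x j) + (\<Sum>(i, j)\<in>(\<lambda>i. (i, Suc N)) ` {1..N}. x i * x j)"
    unfolding vertex_pairs_Suc 
  proof (rule sum.union_disjoint)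
    show "vertex_pairs N \<inter> (\<lambda>i. (i, Suc N)) ` {1..N} = {}" by (auto simp: vertex_pairs_def)
  qed simp_all
  also have "(\<Sum>(i, j)\<in>(\<lambda>i. (i, Suc N)) ` {1..N}. x i * x j) = (\<Sum>i\<in>{1..N}. x i) * x (Suc N)"
    by (subst sum.reindex) (auto simp: inj_on_def sum_distrib_right)
  finally show ?case using Suc by (simp add: power2_eq_square algebra_simps)
qed

lemma edge_prob_bounds:
  assumes "\<And>i. i \<in> {1..N} \<Longrightarrow> v i > (0 :: real)" "(i, j) \<in> vertex_pairs N"
  shows "edge_prob N v i j \<in> {0..1}"
proof -
  have "total_weight N v \<ge> 0" unfolding total_weight_def using assms by (intro sum_nonneg) (auto intro: less_imp_le)
  moreover have "v i * v j > 0" using assms by (auto simp: vertex_pairs_def)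
  ultimately have "0 \<le> edge_prob N v i j" "edge_prob N v i j \<le> 1"
    by (simp_all only: edge_prob_def divide_le_eq_1 zero_le_divide_iff) auto
  then show ?thesis by simp
qed

definition annealed_weight :: "nat \<Rightarrow> (nat \<Rightarrow> real) \<Rightarrow> real \<Rightarrow> real \<Rightarrow> (nat \<Rightarrow> real) \<Rightarrow> real" where
  "annealed_weight N v \<beta> B \<sigma> = measure_pmf.expectation (grg N v) (\<lambda>E. boltzmann N E \<beta> B \<sigma>)"

lemma finite_set_pmf_grg: "finite (set_pmf (grg N v))"
  by (rule finite_subset[of _ "Pow (vertex_pairs N)"]) (auto simp: grg_def)

lemma annealed_weight_nonneg: "annealed_weight N v \<beta> B \<sigma> \<ge> 0"
  unfolding annealed_weight_def by (rule integral_nonneg_AE) (auto simp: boltzmann_def)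

text \<open>The exponential of a sum over the random edge set is a product over all vertex pairs of
  independent factors.\<close>

lemma annealed_weight_product:
  assumes v: "\<And>i. i \<in> {1..N} \<Longrightarrow> v i > 0"
  shows "annealed_weight N v \<beta> B \<sigma> = exp (B * total_spin N \<sigma>) *
    (\<Prod>(i, j)\<in>vertex_pairs N. 1 - edge_prob N v i j + edge_prob N v i j * exp (\<beta> * (\<sigma> i * \<sigma> j)))"
proof -
  define f where "f = (\<lambda>(i, j) b. if b then exp (\<beta> * (\<sigma> i * \<sigma> j)) else (1::real))"
  have "annealed_weight N v \<beta> B \<sigma> = measure_pmf.expectation
     (Pi_pmf (vertex_pairs N) False (\<lambda>(i, j). bernoulli_pmf (edge_prob N v i j)))
     (\<lambda>present. exp (B * total_spin N \<sigma>) * (\<Prod>e\<in>vertex_pairs N. f e (present e)))"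
  proof -
    have "boltzmann N {e \<in> vertex_pairs N. present e} \<beta> B \<sigma>
        = exp (B * total_spin N \<sigma>) * (\<Prod>e\<in>vertex_pairs N. f e (present e))" for present
    proof -
      have "(\<Prod>e\<in>vertex_pairs N. f e (present e)) = (\<Prod>e\<in>{e \<in> vertex_pairs N. present e}. exp (\<beta> * (case e of (i, j) \<Rightarrow> \<sigma> i * \<sigma> j)))"
        by (rule prod.mono_neutral_cong_right) (auto simp: f_def split: prod.splits)
      also have "\<dots> = exp (\<beta> * (\<Sum>(i, j)\<in>{e \<in> vertex_pairs N. present e}. \<sigma> i * \<sigma> j))"
        by (simp add: exp_sum[symmetric] sum_distrib_left)
      finally show ?thesis by (simp add: boltzmann_def exp_add mult.commute)
    qed
    then show ?thesis by (simp add: annealed_weight_def grg_def)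
  qed
  also have "\<dots> = exp (B * total_spin N \<sigma>) * measure_pmf.expectation
     (Pi_pmf (vertex_pairs N) False (\<lambda>(i, j). bernoulli_pmf (edge_prob N v i j)))
     (\<lambda>present. \<Prod>e\<in>vertex_pairs N. f e (present e))" by simp
  also have "measure_pmf.expectation
     (Pi_pmf (vertex_pairs N) False (\<lambda>(i, j). bernoulli_pmf (edge_prob N v i j)))
     (\<lambda>present. \<Prod>e\<in>vertex_pairs N. f e (present e)) =
     (\<Prod>e\<in>vertex_pairs N. measure_pmf.expectation (case e of (i, j) \<Rightarrow> bernoulli_pmf (edge_prob N v i j)) (f e))"
    by (rule expectation_prod_Pi_pmf) (auto simp: f_def intro!: integrable_measure_pmf_finite split: prod.splits)
  also have "\<dots> = (\<Prod>(i, j)\<in>vertex_pairs N. 1 - edge_prob N v i j + edge_prob N v i j * exp (\<beta> * (\<sigma> i * \<sigma> j)))"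
  proof (rule prod.cong[OF refl], clarify)
    fix i j assume "(i, j) \<in> vertex_pairs N"
    then have "edge_prob N v i j \<in> {0..1}" by (intro edge_prob_bounds v)
    then show "measure_pmf.expectation (bernoulli_pmf (edge_prob N v i j)) (f (i, j))
      = 1 - edge_prob N v i j + edge_prob N v i j * exp (\<beta> * (\<sigma> i * \<sigma> j))"
      by (subst integral_bernoulli_pmf) (auto simp: f_def)
  qed
  finally show ?thesis .
qed

text \<open>The linear coupling \<open>sinh \<beta> x\<close> minus the exact one, for a pair with \<open>w\<^sub>i w\<^sub>j / \<ell>\<^sub>N = x\<close>.\<close>

definition coupling_defect :: "real \<Rightarrow> real \<Rightarrow> real" where
  "coupling_defect \<beta> x = sinh \<beta> * x - (ln (1 + x * exp \<beta>) - ln (1 + x * exp (- \<beta>))) / 2"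

text \<open>The first-order terms in \<open>x\<close> cancel; the bound comes from \<open>u - u\<^sup>2 \<le> ln (1 + u) \<le> u\<close>.\<close>

lemma abs_coupling_defect_le:
  assumes "\<beta> \<ge> 0" "x \<ge> 0"
  shows "\<bar>coupling_defect \<beta> x\<bar> \<le> exp (2 * \<beta>) * x\<^sup>2"
proof -
  have ln_ge: "ln (1 + u) \<ge> u - u\<^sup>2" if "u \<ge> 0" for u :: real
  proof -
    have "((\<lambda>u. ln (1 + u) - u + u\<^sup>2) has_real_derivative 1 / (1 + x) - 1 + 2 * x) (at x)" if "0 \<le> x" for x :: real
      using that by (auto intro!: derivative_eq_intros)
    moreover have "1 / (1 + x) - 1 + 2 * x \<ge> 0" if "0 \<le> x" for x :: real
    proof -
      have "1 / (1 + x) - 1 + 2 * x = (x + 2 * x\<^sup>2) / (1 + x)" using that by (simp add: field_simps power2_eq_square)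
      then show ?thesis using that by simp
    qed
    ultimately have "(\<lambda>u. ln (1 + u) - u + u\<^sup>2) 0 \<le> (\<lambda>u. ln (1 + u) - u + u\<^sup>2) u"
      by (intro DERIV_nonneg_imp_nondecreasing[OF that]) blast
    then show ?thesis by simp
  qed
  have e: "exp (- \<beta>) \<le> exp \<beta>" using assms by simp
  have 1: "ln (1 + x * exp \<beta>) \<le> x * exp \<beta>" "ln (1 + x * exp (- \<beta>)) \<le> x * exp (- \<beta>)"
    using assms by (auto intro!: ln_add_one_self_le_self)
  have 2: "ln (1 + x * exp \<beta>) \<ge> x * exp \<beta> - (x * exp \<beta>)\<^sup>2"
    "ln (1 + x * exp (- \<beta>)) \<ge> x * exp (- \<beta>) - (x * exp (- \<beta>))\<^sup>2"
    using assms by (auto intro!: ln_ge)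
  have 3: "(x * exp (- \<beta>))\<^sup>2 \<le> (x * exp \<beta>)\<^sup>2"
    using assms e by (intro power_mono mult_left_mono) auto
  have 4: "(x * exp \<beta>)\<^sup>2 = exp (2 * \<beta>) * x\<^sup>2" by (simp add: power_mult_distrib exp_double)
  have 5: "sinh \<beta> * x = (x * exp \<beta> - x * exp (- \<beta>)) / 2" by (simp add: sinh_def algebra_simps)
  have bound: "\<bar>(p - q) / 2 - (lp - lq) / 2\<bar> \<le> p2"
    if "lp \<le> p" "lq \<le> q" "p - p2 \<le> lp" "q - q2 \<le> lq" "q2 \<le> p2" "0 \<le> p2" for p q lp lq p2 q2 :: real
    using that by (intro abs_leI) (simp_all add: field_simps)
  show ?thesis unfolding coupling_defect_def 5 4[symmetric] using 1 2 3 by (intro bound) auto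
qed

text \<open>A positive function of a sign \<open>s\<close> has the form \<open>C exp (J s)\<close>; here \<open>J\<close> is half the logarithm of
  the ratio of its two values.\<close>

lemma edge_factor:
  assumes l: "l > 0" and u: "u > 0" and s: "s = 1 \<or> s = -1"
  shows "1 - u / (l + u) + u / (l + u) * exp (\<beta> * s) =
    sqrt ((1 + u / l * exp \<beta>) * (1 + u / l * exp (- \<beta>))) / (1 + u / l) * exp ((sinh \<beta> * (u / l) - coupling_defect \<beta> (u / l)) * s)"
proof -
  define a b where "a = 1 + u / l * exp \<beta>" and "b = 1 + u / l * exp (- \<beta>)"
  have ab: "a > 0" "b > 0" using l u by (auto simp: a_def b_def intro!: add_pos_pos)
  have E: "exp ((sinh \<beta> * (u / l) - coupling_defect \<beta> (u / l)) * s) = exp ((ln a - ln b) / 2 * s)"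
    by (simp add: coupling_defect_def a_def b_def)
  have sq: "sqrt (a * b) = exp ((ln a + ln b) / 2)"
  proof -
    have "exp ((ln a + ln b) / 2) ^ 2 = exp (ln a + ln b)" unfolding exp_double[symmetric] by simp
    also have "\<dots> = a * b" using ab by (simp add: exp_add)
    finally have "exp ((ln a + ln b) / 2) ^ 2 = a * b" .
    then show ?thesis by (metis exp_ge_zero real_sqrt_unique)
  qed
  have "1 - u / (l + u) + u / (l + u) * exp (\<beta> * s) = (1 + u / l * exp (\<beta> * s)) / (1 + u / l)"
  proof -
    have "1 - u / (l + u) + u / (l + u) * exp (\<beta> * s) = (l + u * exp (\<beta> * s)) / (l + u)"
    proof -
      define q where "q = u / (l + u)"
      have q: "q * (l + u) = u" using l u by (simp add: q_def)
      have "(1 - q + q * exp (\<beta> * s)) * (l + u) = (l + u) - q * (l + u) + q * (l + u) * exp (\<beta> * s)"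
        by (simp add: algebra_simps)
      also have "\<dots> = l + u * exp (\<beta> * s)" unfolding q by simp
      finally show ?thesis unfolding q_def[symmetric] using l u by (simp add: eq_divide_eq)
    qed
    moreover have "1 + u / l * exp (\<beta> * s) = (l + u * exp (\<beta> * s)) / l" "1 + u / l = (l + u) / l"
      using l by (simp_all add: field_simps)
    ultimately show ?thesis using l by simp
  qed
  also have "1 + u / l * exp (\<beta> * s) = sqrt (a * b) * exp ((ln a - ln b) / 2 * s)"
    using s ab unfolding sq exp_add[symmetric] by (auto simp: a_def b_def add_divide_distrib[symmetric] diff_divide_distrib[symmetric])
  finally show ?thesis unfolding E a_def b_def by simp
qed

text \<open>The square root of the linear coupling: the product over two vertices is
  \<open>sinh \<beta> w\<^sub>i w\<^sub>j / \<ell>\<^sub>N\<close>.\<close>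

definition cw_coupling :: "nat \<Rightarrow> (nat \<Rightarrow> real) \<Rightarrow> real \<Rightarrow> nat \<Rightarrow> real" where
  "cw_coupling N v \<beta> i = v i * sqrt (sinh \<beta> / total_weight N v)"

definition cw_weight :: "nat \<Rightarrow> (nat \<Rightarrow> real) \<Rightarrow> real \<Rightarrow> (nat \<Rightarrow> real) \<Rightarrow> real" where
  "cw_weight N a B \<sigma> = exp ((\<Sum>i\<in>{1..N}. a i * \<sigma> i)\<^sup>2 / 2 + B * total_spin N \<sigma>)"

definition pair_energy :: "nat \<Rightarrow> (nat \<times> nat \<Rightarrow> real) \<Rightarrow> (nat \<Rightarrow> real) \<Rightarrow> real" where
  "pair_energy N r \<sigma> = (\<Sum>e\<in>vertex_pairs N. r e * (\<sigma> (fst e) * \<sigma> (snd e)))"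

definition edge_defect :: "nat \<Rightarrow> (nat \<Rightarrow> real) \<Rightarrow> real \<Rightarrow> nat \<times> nat \<Rightarrow> real" where
  "edge_defect N v \<beta> e = coupling_defect \<beta> (v (fst e) * v (snd e) / total_weight N v)"

text \<open>The sum of \<open>a\<^sub>i a\<^sub>j \<sigma>\<^sub>i \<sigma>\<^sub>j\<close> over pairs is half the square of \<open>\<Sum> a\<^sub>i \<sigma>\<^sub>i\<close> up to the diagonal, and the
  diagonal is constant because \<open>\<sigma>\<^sub>i\<^sup>2 = 1\<close>.\<close>

lemma annealed_weight_curie_weiss:
  assumes v: "\<And>i. i \<in> {1..N} \<Longrightarrow> v i > 0" and \<beta>: "\<beta> \<ge> 0" and N: "N > 0"
  shows "\<exists>C>0. \<forall>\<sigma>\<in>spin_configs N. annealed_weight N v \<beta> B \<sigma>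
    = C * (cw_weight N (cw_coupling N v \<beta>) B \<sigma> * exp (- pair_energy N (edge_defect N v \<beta>) \<sigma>))"
proof -
  define l where "l = total_weight N v"
  have l: "l > 0" unfolding l_def total_weight_def using v N by (intro sum_pos) auto
  define a where "a = cw_coupling N v \<beta>"
  define x where "x e = v (fst e) * v (snd e)" for e :: "nat \<times> nat"
  define \<kappa> where "\<kappa> e = sqrt ((1 + x e / l * exp \<beta>) * (1 + x e / l * exp (- \<beta>))) / (1 + x e / l)" for e
  have x: "x e > 0" if "e \<in> vertex_pairs N" for e
    using that v by (auto simp: vertex_pairs_def x_def)
  have \<kappa>: "\<kappa> e > 0" if "e \<in> vertex_pairs N" for e
    using x[OF that] l unfolding \<kappa>_def by (intro divide_pos_pos real_sqrt_gt_zero mult_pos_pos add_pos_pos) auto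
  define C where "C = (\<Prod>e\<in>vertex_pairs N. \<kappa> e) * exp (- (\<Sum>i\<in>{1..N}. (a i)\<^sup>2) / 2)"
  have "C > 0" unfolding C_def using \<kappa> by (intro mult_pos_pos prod_pos) auto
  moreover have "annealed_weight N v \<beta> B \<sigma> = C * (cw_weight N a B \<sigma> * exp (- pair_energy N (edge_defect N v \<beta>) \<sigma>))"
    if \<sigma>: "\<sigma> \<in> spin_configs N" for \<sigma>
  proof -
    have "(\<Prod>(i, j)\<in>vertex_pairs N. 1 - edge_prob N v i j + edge_prob N v i j * exp (\<beta> * (\<sigma> i * \<sigma> j)))
      = (\<Prod>e\<in>vertex_pairs N. \<kappa> e * exp ((sinh \<beta> * (x e / l) - edge_defect N v \<beta> e) * (\<sigma> (fst e) * \<sigma> (snd e))))"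
    proof (rule prod.cong[OF refl], clarify)
      fix i j assume ij: "(i, j) \<in> vertex_pairs N"
      have s: "\<sigma> i * \<sigma> j = 1 \<or> \<sigma> i * \<sigma> j = -1"
        using spin_cases[OF \<sigma>, of i] spin_cases[OF \<sigma>, of j] ij by (auto simp: vertex_pairs_def)
      show "1 - edge_prob N v i j + edge_prob N v i j * exp (\<beta> * (\<sigma> i * \<sigma> j))
        = \<kappa> (i, j) * exp ((sinh \<beta> * (x (i, j) / l) - edge_defect N v \<beta> (i, j)) * (\<sigma> (fst (i, j)) * \<sigma> (snd (i, j))))"
        using edge_factor[OF l x[OF ij] s, of \<beta>] unfolding edge_prob_def edge_defect_def \<kappa>_def l_def x_def by simp
    qed
    also have "\<dots> = (\<Prod>e\<in>vertex_pairs N. \<kappa> e) *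
       exp (\<Sum>e\<in>vertex_pairs N. (sinh \<beta> * (x e / l) - edge_defect N v \<beta> e) * (\<sigma> (fst e) * \<sigma> (snd e)))"
      by (simp add: prod.distrib exp_sum)
    also have "(\<Sum>e\<in>vertex_pairs N. (sinh \<beta> * (x e / l) - edge_defect N v \<beta> e) * (\<sigma> (fst e) * \<sigma> (snd e)))
       = (\<Sum>(i, j)\<in>vertex_pairs N. (a i * \<sigma> i) * (a j * \<sigma> j)) - pair_energy N (edge_defect N v \<beta>) \<sigma>"
    proof -
      have "sinh \<beta> * (x e / l) * (\<sigma> (fst e) * \<sigma> (snd e)) = (a (fst e) * \<sigma> (fst e)) * (a (snd e) * \<sigma> (snd e))" for e
      proof -
        have "sqrt (sinh \<beta> / l) * sqrt (sinh \<beta> / l) = sinh \<beta> / l"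
          using \<beta> l by (intro real_sqrt_mult_self[THEN trans]) auto
        then have "a (fst e) * a (snd e) = sinh \<beta> / l * x e"
          unfolding a_def cw_coupling_def x_def l_def[symmetric]
          by (metis (no_types, opaque_lifting) mult.assoc mult.commute)
        then show ?thesis by (simp add: algebra_simps)
      qed
      then show ?thesis
        unfolding pair_energy_def sum_subtractf[symmetric] by (intro sum.cong) (auto simp: left_diff_distrib)
    qed
    also have "(\<Sum>(i, j)\<in>vertex_pairs N. (a i * \<sigma> i) * (a j * \<sigma> j))
       = (\<Sum>i\<in>{1..N}. a i * \<sigma> i)\<^sup>2 / 2 + - (\<Sum>i\<in>{1..N}. (a i)\<^sup>2) / 2"
    proof -
      have "(\<Sum>i\<in>{1..N}. (a i * \<sigma> i)\<^sup>2) = (\<Sum>i\<in>{1..N}. (a i)\<^sup>2)"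
        using spin_square[OF \<sigma>] by (intro sum.cong) (auto simp: power_mult_distrib power2_eq_square)
      then have "(\<Sum>i\<in>{1..N}. a i * \<sigma> i)\<^sup>2 = (\<Sum>i\<in>{1..N}. (a i)\<^sup>2) + 2 * (\<Sum>(i, j)\<in>vertex_pairs N. (a i * \<sigma> i) * (a j * \<sigma> j))"
        using square_of_sum_vertex_pairs[of "\<lambda>i. a i * \<sigma> i" N] by (simp only:)
      then show ?thesis by (simp only: add_divide_distrib)
    qed
    finally have "annealed_weight N v \<beta> B \<sigma> = exp (B * total_spin N \<sigma>) * ((\<Prod>e\<in>vertex_pairs N. \<kappa> e) *
        exp ((\<Sum>i\<in>{1..N}. a i * \<sigma> i)\<^sup>2 / 2 + - (\<Sum>i\<in>{1..N}. (a i)\<^sup>2) / 2 - pair_energy N (edge_defect N v \<beta>) \<sigma>))"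
      by (subst annealed_weight_product) (use v in auto)
    then show ?thesis unfolding C_def cw_weight_def
      by (simp only: exp_add exp_diff exp_minus divide_inverse mult_ac diff_conv_add_uminus)
  qed
  ultimately show ?thesis unfolding a_def by blast
qed

section \<open>Linearising the quadratic interaction\<close>

lemma gaussian_integral:
  fixes k l :: real
  assumes k: "k > 0"
  shows "has_bochner_integral lborel (\<lambda>u. exp (- (k * u\<^sup>2 / 2) + l * u)) (sqrt (2 * pi / k) * exp (l\<^sup>2 / (2 * k)))"
proof -
  define s where "s = 1 / sqrt k"
  have s: "s > 0" using k by (simp add: s_def)
  have s2: "s\<^sup>2 = 1 / k" using k by (simp add: s_def power_divide)
  have "has_bochner_integral lborel (normal_density (l / k) s) 1"
    using integrable_normal_density[OF s] integral_normal_density[OF s] by (simp add: has_bochner_integral_iff)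
  then have "has_bochner_integral lborel (\<lambda>u. (sqrt (2 * pi / k) * exp (l\<^sup>2 / (2 * k))) * normal_density (l / k) s u) ((sqrt (2 * pi / k) * exp (l\<^sup>2 / (2 * k))) * 1)"
    by (rule has_bochner_integral_mult_right)
  moreover have "(sqrt (2 * pi / k) * exp (l\<^sup>2 / (2 * k))) * normal_density (l / k) s u = exp (- (k * u\<^sup>2 / 2) + l * u)" for u
  proof -
    have "sqrt (2 * pi / k) > 0" using k by simp
    moreover have "- (u - l / k)\<^sup>2 / (2 * (1 / k)) + l\<^sup>2 / (2 * k) = - (k * u\<^sup>2 / 2) + l * u"
      using k by (simp add: field_simps power2_eq_square)
    ultimately show ?thesis
      unfolding normal_density_def s2 using k by (simp add: exp_add[symmetric])
  qed
  ultimately show ?thesis by simp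
qed

text \<open>The law of independent spins in the external fields \<open>h\<^sub>i\<close>; spin \<open>i\<close> has mean \<open>tanh (h\<^sub>i)\<close>.\<close>

definition spin_weight :: "nat \<Rightarrow> (nat \<Rightarrow> real) \<Rightarrow> (nat \<Rightarrow> real) \<Rightarrow> real" where
  "spin_weight N h \<sigma> = (\<Prod>i\<in>{1..N}. exp (h i * \<sigma> i) / (2 * cosh (h i)))"

lemma spin_weight_nonneg: "spin_weight N h \<sigma> \<ge> 0"
  unfolding spin_weight_def by (intro prod_nonneg) (auto intro!: divide_nonneg_pos simp: cosh_real_pos)

lemma sum_spin_configs_prod:
  fixes f :: "nat \<Rightarrow> real \<Rightarrow> real"
  shows "(\<Sum>\<sigma>\<in>spin_configs N. \<Prod>i\<in>{1..N}. f i (\<sigma> i)) = (\<Prod>i\<in>{1..N}. f i (-1) + f i 1)"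
  unfolding spin_configs_def by (subst prod_sum_PiE[symmetric]) auto

lemma spin_weight_moment:
  assumes "A \<subseteq> {1..N}"
  shows "(\<Sum>\<sigma>\<in>spin_configs N. (\<Prod>i\<in>A. \<sigma> i) * spin_weight N h \<sigma>) = (\<Prod>i\<in>A. tanh (h i))"
proof -
  have ext: "(\<Prod>i\<in>A. g i) = (\<Prod>i\<in>{1..N}. if i \<in> A then g i else 1)" for g :: "nat \<Rightarrow> real"
    using assms by (simp add: prod.inter_restrict[symmetric] Int_absorb1)
  have "(\<Sum>\<sigma>\<in>spin_configs N. (\<Prod>i\<in>A. \<sigma> i) * spin_weight N h \<sigma>)
     = (\<Sum>\<sigma>\<in>spin_configs N. \<Prod>i\<in>{1..N}. (if i \<in> A then \<sigma> i else 1) * (exp (h i * \<sigma> i) / (2 * cosh (h i))))"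
    unfolding ext spin_weight_def prod.distrib[symmetric] ..
  also have "\<dots> = (\<Prod>i\<in>{1..N}. (if i \<in> A then -1 else 1) * (exp (h i * -1) / (2 * cosh (h i))) + (if i \<in> A then 1 else 1) * (exp (h i * 1) / (2 * cosh (h i))))"
    by (rule sum_spin_configs_prod)
  also have "\<dots> = (\<Prod>i\<in>{1..N}. if i \<in> A then tanh (h i) else 1)"
  proof (rule prod.cong[OF refl])
    fix i
    have c: "cosh (h i) \<noteq> 0" by simp
    have c2: "2 * cosh (h i) = exp (h i) + exp (- h i)" "2 * sinh (h i) = exp (h i) - exp (- h i)"
      by (simp_all add: sinh_def cosh_def)
    have nz: "exp (h i) + exp (- h i) \<noteq> 0" using c unfolding c2(1)[symmetric] by simp
    have "exp (h i * -1) / (2 * cosh (h i)) + exp (h i * 1) / (2 * cosh (h i)) = 1"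
      unfolding add_divide_distrib[symmetric] unfolding c2(1) using nz by (simp add: add.commute)
    moreover have "- 1 * (exp (h i * -1) / (2 * cosh (h i))) + exp (h i * 1) / (2 * cosh (h i)) = tanh (h i)"
    proof -
      have "- 1 * (exp (h i * -1) / (2 * cosh (h i))) + exp (h i * 1) / (2 * cosh (h i))
        = (exp (h i) - exp (- h i)) / (2 * cosh (h i))" by (simp add: diff_divide_distrib)
      also have "\<dots> = tanh (h i)" unfolding c2(2)[symmetric] tanh_def by simp
      finally show ?thesis .
    qed
    ultimately show "(if i \<in> A then -1 else 1) * (exp (h i * -1) / (2 * cosh (h i))) + (if i \<in> A then 1 else 1) * (exp (h i * 1) / (2 * cosh (h i)))
      = (if i \<in> A then tanh (h i) else 1)"
      by simp
  qed
  finally show ?thesis by (simp add: ext)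
qed

lemma spin_weight_mgf:
  "(\<Sum>\<sigma>\<in>spin_configs N. exp (s * total_spin N \<sigma>) * spin_weight N h \<sigma>) = (\<Prod>i\<in>{1..N}. cosh (h i + s) / cosh (h i))"
proof -
  have "(\<Sum>\<sigma>\<in>spin_configs N. exp (s * total_spin N \<sigma>) * spin_weight N h \<sigma>)
     = (\<Sum>\<sigma>\<in>spin_configs N. \<Prod>i\<in>{1..N}. exp (s * \<sigma> i) * (exp (h i * \<sigma> i) / (2 * cosh (h i))))"
    by (simp add: spin_weight_def total_spin_def sum_distrib_left exp_sum prod.distrib[symmetric])
  also have "\<dots> = (\<Prod>i\<in>{1..N}. exp (s * -1) * (exp (h i * -1) / (2 * cosh (h i))) + exp (s * 1) * (exp (h i * 1) / (2 * cosh (h i))))"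
    by (rule sum_spin_configs_prod)
  also have "\<dots> = (\<Prod>i\<in>{1..N}. cosh (h i + s) / cosh (h i))"
  proof (rule prod.cong[OF refl])
    fix i
    have "2 * cosh (h i + s) = exp (s * -1) * exp (h i * -1) + exp (s * 1) * exp (h i * 1)"
      by (simp add: cosh_def exp_add[symmetric] add.commute)
    then have "(2 * cosh (h i + s)) / (2 * cosh (h i)) = exp (s * -1) * (exp (h i * -1) / (2 * cosh (h i))) + exp (s * 1) * (exp (h i * 1) / (2 * cosh (h i)))"
      by (simp only: add_divide_distrib times_divide_eq_right)
    then show "exp (s * -1) * (exp (h i * -1) / (2 * cosh (h i))) + exp (s * 1) * (exp (h i * 1) / (2 * cosh (h i))) = cosh (h i + s) / cosh (h i)"
      by simp
  qed
  finally show ?thesis .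
qed

text \<open>The unnormalised mixing density, shifted to the point \<open>y\<close> and scaled to take the value \<open>1\<close> there.\<close>

definition mixture_density :: "nat \<Rightarrow> (nat \<Rightarrow> real) \<Rightarrow> real \<Rightarrow> real \<Rightarrow> real \<Rightarrow> real" where
  "mixture_density N a B y u = exp (cw_potential {1..N} a B (y + u) - cw_potential {1..N} a B y)"

lemma mixture_density_eq:
  "mixture_density N a B y u = exp (- (u\<^sup>2 / 2) - y * u) * (\<Prod>i\<in>{1..N}. cosh (a i * (y + u) + B) / cosh (a i * y + B))"
proof -
  have "(\<Prod>i\<in>{1..N}. cosh (a i * (y + u) + B) / cosh (a i * y + B))
    = exp (\<Sum>i\<in>{1..N}. ln (cosh (a i * (y + u) + B)) - ln (cosh (a i * y + B)))"
    by (simp add: exp_sum exp_diff cosh_real_pos)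
  moreover have "cw_potential {1..N} a B (y + u) - cw_potential {1..N} a B y = (- (u\<^sup>2 / 2) - y * u) + 
     (\<Sum>i\<in>{1..N}. ln (cosh (a i * (y + u) + B)) - ln (cosh (a i * y + B)))"
    by (simp add: cw_potential_def sum_subtractf power2_eq_square field_simps)
  ultimately show ?thesis unfolding mixture_density_def by (simp only: exp_add)
qed

text \<open>Since \<open>exp (Y\<^sup>2 / 2)\<close> is, up to a constant, the integral of \<open>exp (- z\<^sup>2 / 2 + z Y)\<close>, the weight with
  quadratic interaction is a mixture of product weights with fields \<open>a\<^sub>i z + B\<close>. The substitution
  \<open>z = y + u\<close> is built in, with an arbitrary \<open>y\<close>. The factor \<open>K\<close> is the same for all observables
  \<open>F\<close>, so it cancels in expectations.\<close>

theorem hubbard_stratonovich: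
  fixes a :: "nat \<Rightarrow> real" and B y :: real
  shows "\<exists>K>0. \<forall>F. has_bochner_integral lborel
      (\<lambda>u. mixture_density N a B y u * (\<Sum>\<sigma>\<in>spin_configs N. F \<sigma> * spin_weight N (\<lambda>i. a i * (y + u) + B) \<sigma>))
      (K * (\<Sum>\<sigma>\<in>spin_configs N. F \<sigma> * cw_weight N a B \<sigma>))"
proof -
  define D where "D = (\<Prod>i\<in>{1..N}. 2 * cosh (a i * y + B))"
  have D: "D > 0" unfolding D_def by (intro prod_pos) (auto simp: cosh_real_pos)
  define K where "K = sqrt (2 * pi) * exp (y\<^sup>2 / 2) / D"
  have K: "K > 0" using D by (simp add: K_def)
  have "has_bochner_integral lborel
      (\<lambda>u. mixture_density N a B y u * (\<Sum>\<sigma>\<in>spin_configs N. F \<sigma> * spin_weight N (\<lambda>i. a i * (y + u) + B) \<sigma>))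
      (K * (\<Sum>\<sigma>\<in>spin_configs N. F \<sigma> * cw_weight N a B \<sigma>))" for F
  proof -
    define Y where "Y \<sigma> = (\<Sum>i\<in>{1..N}. a i * \<sigma> i)" for \<sigma> :: "nat \<Rightarrow> real"
    define c where "c \<sigma> = exp (y * Y \<sigma> + B * total_spin N \<sigma>) / D" for \<sigma>
    have pt: "mixture_density N a B y u * spin_weight N (\<lambda>i. a i * (y + u) + B) \<sigma>
       = c \<sigma> * exp (- (1 * u\<^sup>2 / 2) + (Y \<sigma> - y) * u)" for \<sigma> u
    proof -
      have "(\<Prod>i\<in>{1..N}. cosh (a i * (y + u) + B) / cosh (a i * y + B)) * spin_weight N (\<lambda>i. a i * (y + u) + B) \<sigma>
        = (\<Prod>i\<in>{1..N}. exp ((a i * (y + u) + B) * \<sigma> i) / (2 * cosh (a i * y + B)))"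
        unfolding spin_weight_def prod.distrib[symmetric] by (intro prod.cong) auto
      also have "\<dots> = exp (\<Sum>i\<in>{1..N}. (a i * (y + u) + B) * \<sigma> i) / D"
        by (simp add: D_def prod_dividef exp_sum)
      also have "(\<Sum>i\<in>{1..N}. (a i * (y + u) + B) * \<sigma> i) = (y * Y \<sigma> + B * total_spin N \<sigma>) + Y \<sigma> * u"
        unfolding Y_def total_spin_def sum_distrib_left sum_distrib_right sum.distrib[symmetric]
        by (intro sum.cong) (auto simp: algebra_simps)
      finally have P: "(\<Prod>i\<in>{1..N}. cosh (a i * (y + u) + B) / cosh (a i * y + B)) * spin_weight N (\<lambda>i. a i * (y + u) + B) \<sigma>
        = exp ((y * Y \<sigma> + B * total_spin N \<sigma>) + Y \<sigma> * u) / D" .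
      have "(- (u\<^sup>2 / 2) - y * u) + ((y * Y \<sigma> + B * total_spin N \<sigma>) + Y \<sigma> * u)
        = (y * Y \<sigma> + B * total_spin N \<sigma>) + (- (1 * u\<^sup>2 / 2) + (Y \<sigma> - y) * u)"
        by (simp add: algebra_simps)
      then have "exp (- (u\<^sup>2 / 2) - y * u) * exp ((y * Y \<sigma> + B * total_spin N \<sigma>) + Y \<sigma> * u)
        = exp (y * Y \<sigma> + B * total_spin N \<sigma>) * exp (- (1 * u\<^sup>2 / 2) + (Y \<sigma> - y) * u)"
        by (simp only: exp_add[symmetric])
      then show ?thesis unfolding mixture_density_eq c_def mult.assoc P by simp
    qed
    have "has_bochner_integral lborel (\<lambda>u. \<Sum>\<sigma>\<in>spin_configs N. F \<sigma> * (c \<sigma> * exp (- (1 * u\<^sup>2 / 2) + (Y \<sigma> - y) * u)))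
      (\<Sum>\<sigma>\<in>spin_configs N. F \<sigma> * (c \<sigma> * (sqrt (2 * pi / 1) * exp ((Y \<sigma> - y)\<^sup>2 / (2 * 1)))))"
      by (intro has_bochner_integral_sum has_bochner_integral_mult_right gaussian_integral) auto
    moreover have "(\<lambda>u. \<Sum>\<sigma>\<in>spin_configs N. F \<sigma> * (c \<sigma> * exp (- (1 * u\<^sup>2 / 2) + (Y \<sigma> - y) * u)))
      = (\<lambda>u. mixture_density N a B y u * (\<Sum>\<sigma>\<in>spin_configs N. F \<sigma> * spin_weight N (\<lambda>i. a i * (y + u) + B) \<sigma>))"
      unfolding pt[symmetric] by (simp add: sum_distrib_left mult_ac)
    moreover have "c \<sigma> * (sqrt (2 * pi / 1) * exp ((Y \<sigma> - y)\<^sup>2 / (2 * 1))) = K * cw_weight N a B \<sigma>" for \<sigma>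
    proof -
      have "y * Y \<sigma> + B * total_spin N \<sigma> + (Y \<sigma> - y)\<^sup>2 / 2 = y\<^sup>2 / 2 + ((Y \<sigma>)\<^sup>2 / 2 + B * total_spin N \<sigma>)"
        by (simp add: power2_eq_square field_simps)
      then have "exp (y * Y \<sigma> + B * total_spin N \<sigma>) * exp ((Y \<sigma> - y)\<^sup>2 / 2) = exp (y\<^sup>2 / 2) * exp ((Y \<sigma>)\<^sup>2 / 2 + B * total_spin N \<sigma>)"
        by (simp only: exp_add[symmetric])
      then show ?thesis unfolding c_def K_def cw_weight_def Y_def[symmetric] by simp
    qed
    ultimately show ?thesis by (simp add: sum_distrib_left mult_ac)
  qed
  with K show ?thesis by blast
qed

section \<open>Laplace asymptotics of the mixture\<close>

lemma exp_neg_sq_integral: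
  assumes "c > (0::real)"
  shows "has_bochner_integral lborel (\<lambda>u. exp (- (c * u\<^sup>2))) (sqrt (pi / c))"
proof -
  have "has_bochner_integral lborel (\<lambda>u. exp (- (2 * c * u\<^sup>2 / 2) + 0 * u)) (sqrt (2 * pi / (2 * c)) * exp (0\<^sup>2 / (2 * (2 * c))))"
    using assms by (intro gaussian_integral) auto
  moreover have "2 * pi / (2 * c) = pi / c" using assms by simp
  ultimately show ?thesis by simp
qed

text \<open>The majorant for the Laplace asymptotics.\<close>

lemma exp_quadratic_abs_integrable:
  fixes k l :: real
  assumes "k > 0"
  shows "integrable lborel (\<lambda>u. exp (- (k * u\<^sup>2)) * exp (l * \<bar>u\<bar> + m))"
proof (rule Bochner_Integration.integrable_bound)
  show "integrable lborel (\<lambda>u. exp m * (exp (- (2 * k * u\<^sup>2 / 2) + l * u) + exp (- (2 * k * u\<^sup>2 / 2) + (- l) * u)))"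
    using gaussian_integral[of "2 * k" l] gaussian_integral[of "2 * k" "- l"] assms
    by (intro integrable_mult_right Bochner_Integration.integrable_add) (auto simp: has_bochner_integral_iff)
  have "exp (- (k * u\<^sup>2)) * exp (l * \<bar>u\<bar> + m) \<le> exp m * (exp (- (2 * k * u\<^sup>2 / 2) + l * u) + exp (- (2 * k * u\<^sup>2 / 2) + (- l) * u))" for u
  proof -
    have "exp (l * \<bar>u\<bar>) \<le> exp (l * u) + exp ((- l) * u)" by (cases "u \<ge> 0") auto
    then have "exp (- (k * u\<^sup>2)) * exp m * exp (l * \<bar>u\<bar>) \<le> exp (- (k * u\<^sup>2)) * exp m * (exp (l * u) + exp ((- l) * u))"
      by (intro mult_left_mono) auto
    moreover have "exp (- (2 * k * u\<^sup>2 / 2) + x) = exp (- (k * u\<^sup>2)) * exp x" for x by (simp add: exp_add[symmetric])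
    ultimately show ?thesis by (simp only: exp_add) (simp add: algebra_simps)
  qed
  then show "AE u in lborel. norm (exp (- (k * u\<^sup>2)) * exp (l * \<bar>u\<bar> + m)) \<le> norm (exp m * (exp (- (2 * k * u\<^sup>2 / 2) + l * u) + exp (- (2 * k * u\<^sup>2 / 2) + (- l) * u)))"
    by (intro AE_I2) (simp add: abs_of_pos add_pos_pos)
qed simp

lemma mixture_density_measurable [measurable]: "mixture_density N b B' x \<in> borel_measurable borel"
  unfolding mixture_density_def[abs_def] cw_potential_def
  by (intro borel_measurable_continuous_onI continuous_intros) (auto simp: cosh_real_pos)

text \<open>What the limit theorem needs to know about the couplings: \<open>y N\<close> is a critical point of the
  potential, the quadratic bound holds there with a fixed \<open>c\<close>, single couplings vanish uniformly,
  and the second-order coefficients of the expansion converge. With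
  \<open>s\<^sub>i = 1 - tanh\<^sup>2 (a\<^sub>i y + B)\<close>, the variance of spin \<open>i\<close>, these are \<open>\<Sum> a\<^sub>i\<^sup>2 s\<^sub>i\<close>,
  \<open>(\<Sum> a\<^sub>i s\<^sub>i) / sqrt N\<close> and \<open>(\<Sum> s\<^sub>i) / N\<close>.\<close>

locale curie_weiss_array =
  fixes a :: "nat \<Rightarrow> nat \<Rightarrow> real" and B :: real and y :: "nat \<Rightarrow> real"
    and c \<theta> K P Q V :: real and \<delta> :: "nat \<Rightarrow> real"
  assumes a_nonneg: "\<And>N i. i \<in> {1..N} \<Longrightarrow> a N i \<ge> 0"
    and crit: "\<And>N. y N = (\<Sum>i\<in>{1..N}. a N i * tanh (a N i * y N + B))"
    and c_pos: "c > 0"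
    and quad: "\<forall>\<^sub>F N in sequentially. \<forall>u. mixture_density N (a N) B (y N) u \<le> exp (- (c * u\<^sup>2))"
    and a_le: "\<And>N i. i \<in> {1..N} \<Longrightarrow> a N i \<le> \<delta> N" and \<delta>: "\<delta> \<longlonglongrightarrow> 0"
    and sum_sq: "\<And>N. (\<Sum>i\<in>{1..N}. (a N i)\<^sup>2) \<le> \<theta>"
    and sum_lin: "\<And>N. (\<Sum>i\<in>{1..N}. a N i) / sqrt N \<le> K"
    and limP: "(\<lambda>N. \<Sum>i\<in>{1..N}. (a N i)\<^sup>2 * (1 - (tanh (a N i * y N + B))\<^sup>2)) \<longlonglongrightarrow> P"
    and limQ: "(\<lambda>N. (\<Sum>i\<in>{1..N}. a N i * (1 - (tanh (a N i * y N + B))\<^sup>2)) / sqrt N) \<longlonglongrightarrow> Q"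
    and limV: "(\<lambda>N. (\<Sum>i\<in>{1..N}. 1 - (tanh (a N i * y N + B))\<^sup>2) / N) \<longlonglongrightarrow> V"
begin

abbreviation spin_variance :: "nat \<Rightarrow> nat \<Rightarrow> real" where
  "spin_variance N i \<equiv> 1 - (tanh (a N i * y N + B))\<^sup>2"

abbreviation spins_at :: "nat \<Rightarrow> real \<Rightarrow> (nat \<Rightarrow> real) \<Rightarrow> real" where
  "spins_at N u \<equiv> spin_weight N (\<lambda>i. a N i * (y N + u) + B)"

definition mean_spin :: "nat \<Rightarrow> real" where
  "mean_spin N = (\<Sum>i\<in>{1..N}. tanh (a N i * y N + B)) / N"

definition fluct :: "nat \<Rightarrow> (nat \<Rightarrow> real) \<Rightarrow> real" where
  "fluct N \<sigma> = (total_spin N \<sigma> - N * mean_spin N) / sqrt N"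

text \<open>The mixing density times the conditional moment generating function, given \<open>u\<close>, of the total
  spin, centred at \<open>\<Sum> tanh (a\<^sub>i y + B)\<close> and divided by \<open>sqrt N\<close>.\<close>

definition joint_density :: "nat \<Rightarrow> real \<Rightarrow> real \<Rightarrow> real" where
  "joint_density N t u = mixture_density N (a N) B (y N) u *
     (\<Sum>\<sigma>\<in>spin_configs N. exp (t * fluct N \<sigma>) * spins_at N u \<sigma>)"

lemma joint_density_eq:
  assumes "N > 0"
  shows "joint_density N t u = mixture_density N (a N) B (y N) u *
    exp (\<Sum>i\<in>{1..N}. ln (cosh (a N i * (y N + u) + B + t / sqrt N)) - ln (cosh (a N i * (y N + u) + B)) - t / sqrt N * tanh (a N i * y N + B))"
proof -
  have "exp (t * fluct N \<sigma>) = exp (t / sqrt N * total_spin N \<sigma>) * exp (- (\<Sum>i\<in>{1..N}. t / sqrt N * tanh (a N i * y N + B)))" for \<sigma>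
    using assms unfolding fluct_def mean_spin_def exp_add[symmetric] sum_distrib_left[symmetric]
    by (simp add: field_simps)
  then have "(\<Sum>\<sigma>\<in>spin_configs N. exp (t * fluct N \<sigma>) * spins_at N u \<sigma>)
     = (\<Sum>\<sigma>\<in>spin_configs N. exp (t / sqrt N * total_spin N \<sigma>) * spins_at N u \<sigma>) * exp (- (\<Sum>i\<in>{1..N}. t / sqrt N * tanh (a N i * y N + B)))"
    unfolding sum_distrib_right by (intro sum.cong) (auto simp: mult_ac)
  also have "(\<Sum>\<sigma>\<in>spin_configs N. exp (t / sqrt N * total_spin N \<sigma>) * spins_at N u \<sigma>)
     = exp (\<Sum>i\<in>{1..N}. ln (cosh (a N i * (y N + u) + B + t / sqrt N)) - ln (cosh (a N i * (y N + u) + B)))"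
    unfolding spin_weight_mgf by (simp add: exp_sum exp_diff cosh_real_pos)
  finally show ?thesis unfolding joint_density_def exp_add[symmetric] by (simp add: sum_subtractf)
qed

text \<open>Taylor expansion of \<open>ln (cosh (h\<^sub>i + e\<^sub>i))\<close> with \<open>e\<^sub>i = a\<^sub>i u + t / sqrt N\<close>. The terms of first order
  cancel: those in \<open>u\<close> because \<open>y\<close> is a critical point, those in \<open>t\<close> because of the centring. Third
  moments of the couplings need not stay bounded, so the cubic remainder is estimated by
  \<open>max \<bar>e\<^sub>i\<bar>\<close> times the sum of squares.\<close>

lemma ln_joint_density_expansion:
  assumes N: "N > 0"
  shows "\<exists>E. joint_density N t u = exp (- (u\<^sup>2 / 2)
      + (u\<^sup>2 * (\<Sum>i\<in>{1..N}. (a N i)\<^sup>2 * spin_variance N i)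
         + 2 * u * t * ((\<Sum>i\<in>{1..N}. a N i * spin_variance N i) / sqrt N)
         + t\<^sup>2 * ((\<Sum>i\<in>{1..N}. spin_variance N i) / N)) / 2 + E)
    \<and> \<bar>E\<bar> \<le> (\<delta> N * \<bar>u\<bar> + \<bar>t\<bar> / sqrt N) * (2 * (u\<^sup>2 * \<theta> + t\<^sup>2))"
proof -
  define n where "n = sqrt (real N)"
  have n: "n > 0" "n\<^sup>2 = real N" using N by (auto simp: n_def)
  define h where "h i = a N i * y N + B" for i
  define s where "s i = 1 - (tanh (h i))\<^sup>2" for i
  define e where "e i = a N i * u + t / n" for i
  define E where "E = (\<Sum>i\<in>{1..N}. ln (cosh (h i + e i)) - ln (cosh (h i)) - e i * tanh (h i) - (e i)\<^sup>2 / 2 * s i)"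
  have 1: "joint_density N t u = exp (- (u\<^sup>2 / 2) - y N * u + (\<Sum>i\<in>{1..N}. ln (cosh (h i + e i)) - ln (cosh (h i)) - t / n * tanh (h i)))"
  proof -
    have "h i + a N i * u + t / n = h i + e i" "a N i * (y N + u) + B = h i + a N i * u" for i
      by (simp_all add: h_def e_def algebra_simps)
    then have "joint_density N t u = mixture_density N (a N) B (y N) u *
      exp (\<Sum>i\<in>{1..N}. ln (cosh (h i + e i)) - ln (cosh (h i + a N i * u)) - t / n * tanh (h i))"
      unfolding joint_density_eq[OF N] n_def[symmetric] by (simp only: h_def[symmetric])
    also have "mixture_density N (a N) B (y N) u = exp (- (u\<^sup>2 / 2) - y N * u + (\<Sum>i\<in>{1..N}. ln (cosh (h i + a N i * u)) - ln (cosh (h i))))"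
    proof -
      have "cw_potential {1..N} (a N) B (y N + u) - cw_potential {1..N} (a N) B (y N)
        = - (u\<^sup>2 / 2) - y N * u + (\<Sum>i\<in>{1..N}. ln (cosh (h i + a N i * u)) - ln (cosh (h i)))"
        by (simp add: cw_potential_def h_def sum_subtractf power2_eq_square field_simps)
      then show ?thesis unfolding mixture_density_def by simp
    qed
    finally show ?thesis by (simp only: exp_add[symmetric]) (simp add: sum_subtractf)
  qed
  have 2: "(\<Sum>i\<in>{1..N}. ln (cosh (h i + e i)) - ln (cosh (h i)) - t / n * tanh (h i))
     = E + u * y N + (\<Sum>i\<in>{1..N}. (e i)\<^sup>2 / 2 * s i)"
  proof -
    have "u * y N = (\<Sum>i\<in>{1..N}. u * (a N i * tanh (h i)))"
      by (subst crit) (simp add: sum_distrib_left h_def)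
    then show ?thesis unfolding E_def sum.distrib[symmetric]
      by (simp only: sum.distrib[symmetric]) (rule sum.cong, auto simp: e_def algebra_simps)
  qed
  have 3: "(\<Sum>i\<in>{1..N}. (e i)\<^sup>2 / 2 * s i) = (u\<^sup>2 * (\<Sum>i\<in>{1..N}. (a N i)\<^sup>2 * s i)
      + 2 * u * t * ((\<Sum>i\<in>{1..N}. a N i * s i) / n) + t\<^sup>2 * ((\<Sum>i\<in>{1..N}. s i) / N)) / 2"
  proof -
    have "(e i)\<^sup>2 / 2 * s i = (u\<^sup>2 * ((a N i)\<^sup>2 * s i) + 2 * u * t * (a N i * s i / n) + t\<^sup>2 * (s i / N)) / 2" for i
      unfolding n(2)[symmetric] using n(1) by (simp add: e_def power2_eq_square field_simps)
    then show ?thesis by (simp only: sum_divide_distrib sum_distrib_left sum.distrib[symmetric])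
  qed
  have "\<bar>E\<bar> \<le> (\<delta> N * \<bar>u\<bar> + \<bar>t\<bar> / sqrt N) * (2 * (u\<^sup>2 * \<theta> + t\<^sup>2))"
  proof -
    have "\<bar>E\<bar> \<le> (\<Sum>i\<in>{1..N}. \<bar>e i\<bar> ^ 3)"
      unfolding E_def s_def by (intro sum_abs[THEN order_trans] sum_mono ln_cosh_taylor3)
    also have "\<dots> \<le> (\<Sum>i\<in>{1..N}. (\<delta> N * \<bar>u\<bar> + \<bar>t\<bar> / n) * (2 * (u\<^sup>2 * (a N i)\<^sup>2 + t\<^sup>2 / N)))"
    proof (rule sum_mono)
      fix i assume i: "i \<in> {1..N}"
      have "\<bar>e i\<bar> \<le> \<bar>a N i * u\<bar> + \<bar>t / n\<bar>" unfolding e_def by (rule abs_triangle_ineq)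
      also have "\<dots> \<le> \<delta> N * \<bar>u\<bar> + \<bar>t\<bar> / n"
        using a_nonneg[OF i] a_le[OF i] n by (simp add: abs_mult mult_right_mono)
      finally have 1: "\<bar>e i\<bar> \<le> \<delta> N * \<bar>u\<bar> + \<bar>t\<bar> / n" .
      have "(e i)\<^sup>2 \<le> 2 * ((a N i * u)\<^sup>2 + (t / n)\<^sup>2)"
        unfolding e_def using sum_squares_bound[of "a N i * u" "t / n"] by (simp add: power2_sum)
      then have 2: "(e i)\<^sup>2 \<le> 2 * (u\<^sup>2 * (a N i)\<^sup>2 + t\<^sup>2 / N)"
        by (simp add: power_mult_distrib power_divide n mult.commute)
      have "\<bar>e i\<bar> ^ 3 = \<bar>e i\<bar> * (e i)\<^sup>2" by (simp add: power3_eq_cube power2_eq_square)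
      also have "\<dots> \<le> (\<delta> N * \<bar>u\<bar> + \<bar>t\<bar> / n) * (2 * (u\<^sup>2 * (a N i)\<^sup>2 + t\<^sup>2 / N))"
        using 1 2 by (intro mult_mono) auto
      finally show "\<bar>e i\<bar> ^ 3 \<le> (\<delta> N * \<bar>u\<bar> + \<bar>t\<bar> / n) * (2 * (u\<^sup>2 * (a N i)\<^sup>2 + t\<^sup>2 / N))" .
    qed
    also have "\<dots> = (\<delta> N * \<bar>u\<bar> + \<bar>t\<bar> / n) * (2 * (u\<^sup>2 * (\<Sum>i\<in>{1..N}. (a N i)\<^sup>2) + t\<^sup>2))"
      using N by (simp add: sum_distrib_left[symmetric] sum.distrib)
    also have "\<dots> \<le> (\<delta> N * \<bar>u\<bar> + \<bar>t\<bar> / n) * (2 * (u\<^sup>2 * \<theta> + t\<^sup>2))"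
    proof (rule mult_left_mono)
      have "\<delta> N \<ge> 0" using a_nonneg[of N N] a_le[of N N] N by simp
      then show "0 \<le> \<delta> N * \<bar>u\<bar> + \<bar>t\<bar> / n" using n by simp
      show "2 * (u\<^sup>2 * (\<Sum>i\<in>{1..N}. (a N i)\<^sup>2) + t\<^sup>2) \<le> 2 * (u\<^sup>2 * \<theta> + t\<^sup>2)"
        using mult_left_mono[OF sum_sq, of "u\<^sup>2"] by simp
    qed
    finally show ?thesis by (simp add: n_def)
  qed
  moreover have "joint_density N t u = exp (- (u\<^sup>2 / 2)
      + (u\<^sup>2 * (\<Sum>i\<in>{1..N}. (a N i)\<^sup>2 * spin_variance N i)
         + 2 * u * t * ((\<Sum>i\<in>{1..N}. a N i * spin_variance N i) / sqrt N)
         + t\<^sup>2 * ((\<Sum>i\<in>{1..N}. spin_variance N i) / N)) / 2 + E)"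
    unfolding 1 2 3 by (simp add: n_def s_def h_def algebra_simps)
  ultimately show ?thesis by blast
qed

lemma joint_density_tendsto:
  "(\<lambda>N. joint_density N t u) \<longlonglongrightarrow> exp (- ((1 - P) * u\<^sup>2 / 2) + (t * Q) * u) * exp (V * t\<^sup>2 / 2)"
proof -
  define M where "M N = - (u\<^sup>2 / 2)
      + (u\<^sup>2 * (\<Sum>i\<in>{1..N}. (a N i)\<^sup>2 * spin_variance N i)
         + 2 * u * t * ((\<Sum>i\<in>{1..N}. a N i * spin_variance N i) / sqrt N)
         + t\<^sup>2 * ((\<Sum>i\<in>{1..N}. spin_variance N i) / N)) / 2" for N
  have "\<forall>N. \<exists>E. N > 0 \<longrightarrow> joint_density N t u = exp (M N + E) \<and> \<bar>E\<bar> \<le> (\<delta> N * \<bar>u\<bar> + \<bar>t\<bar> / sqrt N) * (2 * (u\<^sup>2 * \<theta> + t\<^sup>2))"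
    unfolding M_def using ln_joint_density_expansion by blast
  then obtain E where E: "\<And>N. N > 0 \<Longrightarrow> joint_density N t u = exp (M N + E N)"
    "\<And>N. N > 0 \<Longrightarrow> \<bar>E N\<bar> \<le> (\<delta> N * \<bar>u\<bar> + \<bar>t\<bar> / sqrt N) * (2 * (u\<^sup>2 * \<theta> + t\<^sup>2))" by metis
  have M: "M \<longlonglongrightarrow> - (u\<^sup>2 / 2) + (u\<^sup>2 * P + 2 * u * t * Q + t\<^sup>2 * V) / 2"
    unfolding M_def by (intro tendsto_intros limP limQ limV) auto
  have "(\<lambda>N. \<bar>t\<bar> / sqrt (real N)) \<longlonglongrightarrow> 0" by real_asymp
  then have "(\<lambda>N. (\<delta> N * \<bar>u\<bar> + \<bar>t\<bar> / sqrt N) * (2 * (u\<^sup>2 * \<theta> + t\<^sup>2))) \<longlonglongrightarrow> (0 * \<bar>u\<bar> + 0) * (2 * (u\<^sup>2 * \<theta> + t\<^sup>2))"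
    by (intro tendsto_intros \<delta>)
  then have "E \<longlonglongrightarrow> 0"
    by (intro Lim_null_comparison[where f = E and g = "\<lambda>N. (\<delta> N * \<bar>u\<bar> + \<bar>t\<bar> / sqrt N) * (2 * (u\<^sup>2 * \<theta> + t\<^sup>2))"])
      (use E(2) in \<open>auto intro: eventually_sequentiallyI[of 1]\<close>)
  then have "(\<lambda>N. exp (M N + E N)) \<longlonglongrightarrow> exp (- (u\<^sup>2 / 2) + (u\<^sup>2 * P + 2 * u * t * Q + t\<^sup>2 * V) / 2 + 0)"
    by (intro tendsto_intros M)
  also have "exp (- (u\<^sup>2 / 2) + (u\<^sup>2 * P + 2 * u * t * Q + t\<^sup>2 * V) / 2 + 0)
     = exp (- ((1 - P) * u\<^sup>2 / 2) + (t * Q) * u) * exp (V * t\<^sup>2 / 2)"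
    by (simp add: exp_add[symmetric] field_simps)
  finally show ?thesis
    by (rule Lim_transform_eventually) (use E(1) in \<open>auto intro: eventually_sequentiallyI[of 1]\<close>)
qed

text \<open>The bound for \<open>t = 0\<close> is the quadratic bound on the potential. A nonzero \<open>t\<close> costs only
  \<open>\<bar>t\<bar> \<bar>u\<bar> (\<Sum> a\<^sub>i) / sqrt N\<close>, since \<open>tanh\<close> is Lipschitz.\<close>

lemma joint_density_bound:
  "\<forall>\<^sub>F N in sequentially. \<forall>u. joint_density N t u \<le> exp (- (c * u\<^sup>2)) * exp (\<bar>t\<bar> * K * \<bar>u\<bar> + t\<^sup>2 / 2)"
  using quad eventually_gt_at_top[of 0]
proof eventually_elim
  case (elim N)
  show ?case
  proof
    fix u
    define n where "n = sqrt (real N)"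
    have n: "n > 0" "n\<^sup>2 = real N" using elim(2) by (auto simp: n_def)
    have "(\<Sum>i\<in>{1..N}. ln (cosh (a N i * (y N + u) + B + t / n)) - ln (cosh (a N i * (y N + u) + B)) - t / n * tanh (a N i * y N + B))
       \<le> (\<Sum>i\<in>{1..N}. \<bar>t\<bar> * \<bar>u\<bar> * (a N i / n) + t\<^sup>2 / 2 / N)"
    proof (rule sum_mono)
      fix i assume i: "i \<in> {1..N}"
      have "ln (cosh (a N i * (y N + u) + B + t / n)) - ln (cosh (a N i * (y N + u) + B)) - t / n * tanh (a N i * y N + B)
        \<le> t / n * (tanh (a N i * (y N + u) + B) - tanh (a N i * y N + B)) + (t / n)\<^sup>2 / 2"
        using ln_cosh_taylor2[of "a N i * (y N + u) + B" "t / n"] by (simp add: algebra_simps)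
      also have "t / n * (tanh (a N i * (y N + u) + B) - tanh (a N i * y N + B)) \<le> \<bar>t / n\<bar> * \<bar>tanh (a N i * (y N + u) + B) - tanh (a N i * y N + B)\<bar>"
        by (metis abs_ge_self abs_mult)
      also have "\<dots> \<le> \<bar>t / n\<bar> * \<bar>(a N i * (y N + u) + B) - (a N i * y N + B)\<bar>"
        by (intro mult_left_mono tanh_lipschitz) auto
      also have "\<dots> = \<bar>t\<bar> * \<bar>u\<bar> * (a N i / n)"
        using n a_nonneg[OF i] by (simp add: algebra_simps abs_mult)
      finally show "ln (cosh (a N i * (y N + u) + B + t / n)) - ln (cosh (a N i * (y N + u) + B)) - t / n * tanh (a N i * y N + B)
        \<le> \<bar>t\<bar> * \<bar>u\<bar> * (a N i / n) + t\<^sup>2 / 2 / N"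
        by (simp add: power_divide n)
    qed
    also have "\<dots> = \<bar>t\<bar> * \<bar>u\<bar> * ((\<Sum>i\<in>{1..N}. a N i) / n) + t\<^sup>2 / 2"
      using elim(2) by (simp add: sum.distrib sum_distrib_left[symmetric] sum_divide_distrib[symmetric])
    also have "\<dots> \<le> \<bar>t\<bar> * K * \<bar>u\<bar> + t\<^sup>2 / 2"
      using mult_left_mono[OF sum_lin[of N], of "\<bar>t\<bar> * \<bar>u\<bar>"] by (simp add: n_def mult_ac)
    finally show "joint_density N t u \<le> exp (- (c * u\<^sup>2)) * exp (\<bar>t\<bar> * K * \<bar>u\<bar> + t\<^sup>2 / 2)"
      unfolding joint_density_eq[OF elim(2)] n_def using elim(1) by (intro mult_mono) auto
  qed
qed

text \<open>The pointwise limit \<open>exp (- (1 - P) u\<^sup>2 / 2)\<close> inherits the bound \<open>exp (- c u\<^sup>2)\<close>. So the limiting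
  Gaussian integral converges.\<close>

lemma one_minus_P: "1 - P \<ge> 2 * c"
proof -
  have "\<forall>\<^sub>F N in sequentially. joint_density N 0 1 \<le> exp (- c)"
    using joint_density_bound[of 0] by eventually_elim (auto dest: spec[of _ 1])
  then have "exp (- ((1 - P) * 1\<^sup>2 / 2) + (0 * Q) * 1) * exp (V * 0\<^sup>2 / 2) \<le> exp (- c)"
    by (intro tendsto_upperbound[OF joint_density_tendsto]) auto
  then show ?thesis by simp
qed

text \<open>\<open>V\<close> is the variance of the spins in a fixed field, and \<open>Q\<^sup>2 / (1 - P)\<close> is the contribution of the
  Gaussian fluctuations of the field, which have variance \<open>1 / (1 - P)\<close>.\<close>

definition limit_variance :: real where "limit_variance = V + Q\<^sup>2 / (1 - P)"

lemma joint_density_nonneg: "joint_density N t u \<ge> 0"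
  unfolding joint_density_def
  by (intro mult_nonneg_nonneg sum_nonneg spin_weight_nonneg) (auto simp: mixture_density_def)

lemma joint_density_measurable [measurable]: "joint_density N t \<in> borel_measurable borel"
proof -
  have "(\<lambda>u. spins_at N u \<sigma>) \<in> borel_measurable borel" for \<sigma>
    unfolding spin_weight_def by (intro borel_measurable_continuous_onI continuous_intros) auto
  then show ?thesis unfolding joint_density_def[abs_def]
    by (intro borel_measurable_times borel_measurable_sum) auto
qed

lemma integral_joint_density_tendsto:
  "(\<lambda>N. \<integral>u. joint_density N t u \<partial>lborel) \<longlonglongrightarrow> sqrt (2 * pi / (1 - P)) * exp (limit_variance * t\<^sup>2 / 2)"
proof -
  have P: "1 - P > 0" using one_minus_P c_pos by linarith
  obtain N0 where N0: "\<And>N u. N \<ge> N0 \<Longrightarrow> joint_density N t u \<le> exp (- (c * u\<^sup>2)) * exp (\<bar>t\<bar> * K * \<bar>u\<bar> + t\<^sup>2 / 2)"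
    using joint_density_bound[of t] by (auto simp: eventually_sequentially)
  have "(\<lambda>N. \<integral>u. joint_density (N + N0) t u \<partial>lborel) \<longlonglongrightarrow> (\<integral>u. exp (- ((1 - P) * u\<^sup>2 / 2) + (t * Q) * u) * exp (V * t\<^sup>2 / 2) \<partial>lborel)"
  proof (rule integral_dominated_convergence)
    show "integrable lborel (\<lambda>u. exp (- (c * u\<^sup>2)) * exp ((\<bar>t\<bar> * K) * \<bar>u\<bar> + t\<^sup>2 / 2))"
      by (rule exp_quadratic_abs_integrable[OF c_pos])
    show "AE u in lborel. (\<lambda>N. joint_density (N + N0) t u) \<longlonglongrightarrow> exp (- ((1 - P) * u\<^sup>2 / 2) + (t * Q) * u) * exp (V * t\<^sup>2 / 2)"
      by (intro AE_I2 LIMSEQ_ignore_initial_segment joint_density_tendsto)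
    show "AE u in lborel. norm (joint_density (N + N0) t u) \<le> exp (- (c * u\<^sup>2)) * exp ((\<bar>t\<bar> * K) * \<bar>u\<bar> + t\<^sup>2 / 2)" for N
      using N0[of "N + N0"] joint_density_nonneg by (intro AE_I2) simp
  qed auto
  also have "(\<integral>u. exp (- ((1 - P) * u\<^sup>2 / 2) + (t * Q) * u) * exp (V * t\<^sup>2 / 2) \<partial>lborel)
     = sqrt (2 * pi / (1 - P)) * exp ((t * Q)\<^sup>2 / (2 * (1 - P))) * exp (V * t\<^sup>2 / 2)"
    using gaussian_integral[OF P, of "t * Q"] by (simp add: has_bochner_integral_iff)
  also have "\<dots> = sqrt (2 * pi / (1 - P)) * exp (limit_variance * t\<^sup>2 / 2)"
    using P by (simp add: mult.assoc exp_add[symmetric] limit_variance_def power_mult_distrib field_simps)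
  finally show ?thesis by (rule LIMSEQ_offset)
qed

end

section \<open>Concentration of the residual interaction\<close>

lemma has_bochner_integral_mono:
  fixes f g :: "'b \<Rightarrow> real"
  assumes "has_bochner_integral M f x" "has_bochner_integral M g y" "\<And>u. f u \<le> g u"
  shows "x \<le> y"
  using assms integral_mono[of M f g] by (auto simp: has_bochner_integral_iff)

lemma spin_weight_sum: "(\<Sum>\<sigma>\<in>spin_configs N. spin_weight N h \<sigma>) = 1"
  using spin_weight_moment[of "{}" N h] by simp

lemma vertex_pairsD:
  assumes "e \<in> vertex_pairs N"
  shows "fst e \<in> {1..N}" "snd e \<in> {1..N}" "fst e \<noteq> snd e"
  using assms by (auto simp: vertex_pairs_def)

lemma abs_diff_mult_le:
  fixes p q p' q' :: real
  assumes "\<bar>p\<bar> \<le> 1" "\<bar>q'\<bar> \<le> 1" "\<bar>p - p'\<bar> \<le> d" "\<bar>q - q'\<bar> \<le> d"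
  shows "\<bar>p * q - p' * q'\<bar> \<le> 2 * d"
proof -
  have "p * q - p' * q' = p * (q - q') + (p - p') * q'" by (simp add: algebra_simps)
  also have "\<bar>\<dots>\<bar> \<le> \<bar>p\<bar> * \<bar>q - q'\<bar> + \<bar>p - p'\<bar> * \<bar>q'\<bar>"
    by (metis abs_mult abs_triangle_ineq)
  also have "\<dots> \<le> 1 * d + d * 1" using assms by (intro add_mono mult_mono) auto
  finally show ?thesis by simp
qed

lemma disjoint_pairs_covariance:
  assumes e: "e \<in> vertex_pairs N" and f: "f \<in> vertex_pairs N"
    and disj: "{fst e, snd e} \<inter> {fst f, snd f} = {}"
  shows "(\<Sum>\<sigma>\<in>spin_configs N. (\<sigma> (fst e) * \<sigma> (snd e) - \<tau>) * (\<sigma> (fst f) * \<sigma> (snd f) - \<tau>') * spin_weight N h \<sigma>)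
     = (tanh (h (fst e)) * tanh (h (snd e)) - \<tau>) * (tanh (h (fst f)) * tanh (h (snd f)) - \<tau>')"
proof -
  note E = vertex_pairsD[OF e] and F = vertex_pairsD[OF f]
  have ef: "(\<Sum>\<sigma>\<in>spin_configs N. (\<sigma> (fst e) * \<sigma> (snd e) * (\<sigma> (fst f) * \<sigma> (snd f))) * spin_weight N h \<sigma>)
     = tanh (h (fst e)) * tanh (h (snd e)) * (tanh (h (fst f)) * tanh (h (snd f)))"
    using spin_weight_moment[of "{fst e, snd e, fst f, snd f}" N h] E F disj by (simp add: mult.assoc)
  have pair: "(\<Sum>\<sigma>\<in>spin_configs N. (\<sigma> (fst g) * \<sigma> (snd g)) * spin_weight N h \<sigma>) = tanh (h (fst g)) * tanh (h (snd g))"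
    if "g \<in> vertex_pairs N" for g
    using spin_weight_moment[of "{fst g, snd g}" N h] vertex_pairsD[OF that] by simp
  have "(\<Sum>\<sigma>\<in>spin_configs N. (\<sigma> (fst e) * \<sigma> (snd e) - \<tau>) * (\<sigma> (fst f) * \<sigma> (snd f) - \<tau>') * spin_weight N h \<sigma>)
    = (\<Sum>\<sigma>\<in>spin_configs N. (\<sigma> (fst e) * \<sigma> (snd e) * (\<sigma> (fst f) * \<sigma> (snd f))) * spin_weight N h \<sigma>
        - \<tau>' * ((\<sigma> (fst e) * \<sigma> (snd e)) * spin_weight N h \<sigma>)
        - \<tau> * ((\<sigma> (fst f) * \<sigma> (snd f)) * spin_weight N h \<sigma>) + \<tau> * \<tau>' * spin_weight N h \<sigma>)"
    by (intro sum.cong) (auto simp: algebra_simps)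
  also have "\<dots> = (tanh (h (fst e)) * tanh (h (snd e)) - \<tau>) * (tanh (h (fst f)) * tanh (h (snd f)) - \<tau>')"
    unfolding sum.distrib sum_subtractf sum_distrib_left[symmetric] ef pair[OF e] pair[OF f] spin_weight_sum
    by (simp add: algebra_simps)
  finally show ?thesis .
qed

text \<open>Expand the square into pairs of edges \<open>e, f\<close>. If they are disjoint, independence splits the
  expectation into two factors, and each is at most \<open>2 d\<close> because the means \<open>tanh (h'\<^sub>i)\<close> and
  \<open>tanh (h\<^sub>i)\<close> differ by at most \<open>d\<close>. Pairs that share a vertex contribute at most \<open>4\<close> times their
  couplings, and a given edge meets others of total coupling at most \<open>2 \<gamma>\<close>.\<close>

lemma pair_energy_second_moment:
  fixes r :: "nat \<times> nat \<Rightarrow> real" and h h' :: "nat \<Rightarrow> real"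
  assumes R: "(\<Sum>e\<in>vertex_pairs N. \<bar>r e\<bar>) \<le> R"
    and \<gamma>: "\<And>i. i \<in> {1..N} \<Longrightarrow> (\<Sum>e\<in>{e \<in> vertex_pairs N. i = fst e \<or> i = snd e}. \<bar>r e\<bar>) \<le> \<gamma>"
    and d: "\<And>i. i \<in> {1..N} \<Longrightarrow> \<bar>h' i - h i\<bar> \<le> d" and d0: "d \<ge> 0" and \<gamma>0: "\<gamma> \<ge> 0"
  shows "(\<Sum>\<sigma>\<in>spin_configs N. (pair_energy N r \<sigma> - (\<Sum>e\<in>vertex_pairs N. r e * (tanh (h (fst e)) * tanh (h (snd e)))))\<^sup>2 * spin_weight N h' \<sigma>)
    \<le> 4 * R\<^sup>2 * d\<^sup>2 + 8 * R * \<gamma>"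
proof -
  define V where "V = vertex_pairs N"
  define \<tau> where "\<tau> e = tanh (h (fst e)) * tanh (h (snd e))" for e
  define X where "X \<sigma> e = \<sigma> (fst e) * \<sigma> (snd e) - \<tau> e" for \<sigma> :: "nat \<Rightarrow> real" and e
  define G where "G e f = (\<Sum>\<sigma>\<in>spin_configs N. X \<sigma> e * X \<sigma> f * spin_weight N h' \<sigma>)" for e f
  define meet where "meet e f \<longleftrightarrow> {fst e, snd e} \<inter> {fst f, snd f} \<noteq> {}" for e f :: "nat \<times> nat"
  have finV[simp]: "finite V" by (simp add: V_def)
  have R0: "R \<ge> 0" using R by (rule order_trans[rotated]) (simp add: sum_nonneg)
  have eq: "pair_energy N r \<sigma> - (\<Sum>e\<in>V. r e * \<tau> e) = (\<Sum>e\<in>V. r e * X \<sigma> e)" for \<sigma>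
    unfolding pair_energy_def V_def[symmetric] sum_subtractf[symmetric] X_def by (simp add: algebra_simps)
  have "(\<Sum>\<sigma>\<in>spin_configs N. (\<Sum>e\<in>V. r e * X \<sigma> e)\<^sup>2 * spin_weight N h' \<sigma>)
     = (\<Sum>\<sigma>\<in>spin_configs N. \<Sum>e\<in>V. \<Sum>f\<in>V. r e * r f * (X \<sigma> e * X \<sigma> f * spin_weight N h' \<sigma>))"
    by (simp only: power2_eq_square sum_product) (simp only: sum_distrib_right, simp only: mult_ac)
  also have "\<dots> = (\<Sum>e\<in>V. \<Sum>f\<in>V. r e * r f * G e f)"
    unfolding G_def sum_distrib_left by (subst sum.swap, rule sum.cong[OF refl], subst sum.swap, rule refl)
  also have "\<dots> \<le> (\<Sum>e\<in>V. \<Sum>f\<in>V. \<bar>r e\<bar> * \<bar>r f\<bar> * (4 * d\<^sup>2 + (if meet e f then 4 else 0)))"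
  proof (intro sum_mono)
    fix e f assume ef: "e \<in> V" "f \<in> V"
    have t1: "\<bar>\<tau> g\<bar> \<le> 1" for g
      unfolding \<tau>_def abs_mult using abs_tanh_le_1 by (intro mult_le_one) auto
    have "\<bar>G e f\<bar> \<le> 4 * d\<^sup>2 + (if meet e f then 4 else 0)"
    proof (cases "meet e f")
      case True
      have "\<bar>X \<sigma> g\<bar> \<le> 2" if "\<sigma> \<in> spin_configs N" "g \<in> V" for \<sigma> g
      proof -
        have "\<bar>\<sigma> (fst g) * \<sigma> (snd g)\<bar> = 1"
          using abs_spin[OF that(1)] vertex_pairsD[of g N] that(2) by (simp add: abs_mult V_def)
        then show ?thesis unfolding X_def using t1[of g] by linarith
      qed
      then have "\<bar>X \<sigma> e * X \<sigma> f * spin_weight N h' \<sigma>\<bar> \<le> 4 * spin_weight N h' \<sigma>" if "\<sigma> \<in> spin_configs N" for \<sigma>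
        using mult_mono[of "\<bar>X \<sigma> e\<bar>" 2 "\<bar>X \<sigma> f\<bar>" 2] ef that spin_weight_nonneg[of N h' \<sigma>]
        by (auto simp: abs_mult intro!: mult_right_mono)
      then have "\<bar>G e f\<bar> \<le> (\<Sum>\<sigma>\<in>spin_configs N. 4 * spin_weight N h' \<sigma>)"
        unfolding G_def by (intro sum_abs[THEN order_trans] sum_mono)
      then show ?thesis using True by (simp add: sum_distrib_left[symmetric] spin_weight_sum add_increasing)
    next
      case False
      have m: "\<bar>tanh (h' (fst g)) * tanh (h' (snd g)) - \<tau> g\<bar> \<le> 2 * d" if "g \<in> V" for g
        unfolding \<tau>_def using vertex_pairsD[of g N] that
        by (intro abs_diff_mult_le abs_tanh_le_1 order_trans[OF tanh_lipschitz d]) (auto simp: V_def)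
      have "G e f = (tanh (h' (fst e)) * tanh (h' (snd e)) - \<tau> e) * (tanh (h' (fst f)) * tanh (h' (snd f)) - \<tau> f)"
        unfolding G_def X_def using ef False by (intro disjoint_pairs_covariance) (auto simp: V_def meet_def)
      then have "\<bar>G e f\<bar> \<le> (2 * d) * (2 * d)"
        unfolding abs_mult using m[OF ef(1)] m[OF ef(2)] d0 by (simp only: abs_mult) (intro mult_mono, auto)
      then show ?thesis using False by (simp add: power2_eq_square)
    qed
    then have "\<bar>r e\<bar> * \<bar>r f\<bar> * \<bar>G e f\<bar> \<le> \<bar>r e\<bar> * \<bar>r f\<bar> * (4 * d\<^sup>2 + (if meet e f then 4 else 0))"
      by (intro mult_left_mono) auto
    moreover have "r e * r f * G e f \<le> \<bar>r e\<bar> * \<bar>r f\<bar> * \<bar>G e f\<bar>" by (metis abs_ge_self abs_mult)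
    ultimately show "r e * r f * G e f \<le> \<bar>r e\<bar> * \<bar>r f\<bar> * (4 * d\<^sup>2 + (if meet e f then 4 else 0))" by linarith
  qed
  also have "\<dots> = 4 * d\<^sup>2 * ((\<Sum>e\<in>V. \<bar>r e\<bar>) * (\<Sum>f\<in>V. \<bar>r f\<bar>)) + (\<Sum>e\<in>V. \<bar>r e\<bar> * (4 * (\<Sum>f\<in>{f \<in> V. meet e f}. \<bar>r f\<bar>)))"
  proof -
    have "(\<Sum>f\<in>V. \<bar>r e\<bar> * \<bar>r f\<bar> * (4 * d\<^sup>2 + (if meet e f then 4 else 0)))
      = 4 * d\<^sup>2 * (\<bar>r e\<bar> * (\<Sum>f\<in>V. \<bar>r f\<bar>)) + \<bar>r e\<bar> * (4 * (\<Sum>f\<in>{f \<in> V. meet e f}. \<bar>r f\<bar>))" for e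
    proof -
      have "(\<Sum>f\<in>{f \<in> V. meet e f}. \<bar>r f\<bar>) = (\<Sum>f\<in>V. if meet e f then \<bar>r f\<bar> else 0)"
        by (rule sum.inter_filter) simp
      then show ?thesis
        by (simp only: sum_distrib_left sum.distrib[symmetric]) (auto intro!: sum.cong simp: algebra_simps)
    qed
    then show ?thesis by (simp only: sum.distrib sum_distrib_left[symmetric] sum_distrib_right[symmetric])
  qed
  also have "\<dots> \<le> 4 * d\<^sup>2 * (R * R) + (\<Sum>e\<in>V. \<bar>r e\<bar> * (8 * \<gamma>))"
  proof -
    have "4 * (\<Sum>f\<in>{f \<in> V. meet e f}. \<bar>r f\<bar>) \<le> 8 * \<gamma>" if e: "e \<in> V" for e
    proof -
      define A where "A i = {f \<in> V. i = fst f \<or> i = snd f}" for i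
      have "{f \<in> V. meet e f} \<subseteq> A (fst e) \<union> A (snd e)" by (auto simp: meet_def A_def)
      then have "(\<Sum>f\<in>{f \<in> V. meet e f}. \<bar>r f\<bar>) \<le> (\<Sum>f\<in>A (fst e) \<union> A (snd e). \<bar>r f\<bar>)"
        by (intro sum_mono2) (auto simp: A_def)
      also have "\<dots> \<le> (\<Sum>f\<in>A (fst e). \<bar>r f\<bar>) + (\<Sum>f\<in>A (snd e). \<bar>r f\<bar>)"
      proof -
        have "0 \<le> (\<Sum>f\<in>A (fst e) \<inter> A (snd e). \<bar>r f\<bar>)" by (simp add: sum_nonneg)
        moreover have "(\<Sum>f\<in>A (fst e) \<union> A (snd e). \<bar>r f\<bar>) = (\<Sum>f\<in>A (fst e). \<bar>r f\<bar>) + (\<Sum>f\<in>A (snd e). \<bar>r f\<bar>) - (\<Sum>f\<in>A (fst e) \<inter> A (snd e). \<bar>r f\<bar>)"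
          by (rule sum_Un) (auto simp: A_def)
        ultimately show ?thesis by linarith
      qed
      also have "\<dots> \<le> \<gamma> + \<gamma>"
        using vertex_pairsD[of e N] e unfolding A_def V_def by (intro add_mono \<gamma>) auto
      finally show ?thesis by simp
    qed
    then have "(\<Sum>e\<in>V. \<bar>r e\<bar> * (4 * (\<Sum>f\<in>{f \<in> V. meet e f}. \<bar>r f\<bar>))) \<le> (\<Sum>e\<in>V. \<bar>r e\<bar> * (8 * \<gamma>))"
      by (intro sum_mono mult_left_mono) auto
    moreover have "(\<Sum>e\<in>V. \<bar>r e\<bar>) * (\<Sum>f\<in>V. \<bar>r f\<bar>) \<le> R * R"
      using R R0 unfolding V_def by (intro mult_mono) (auto simp: sum_nonneg)
    then have "4 * d\<^sup>2 * ((\<Sum>e\<in>V. \<bar>r e\<bar>) * (\<Sum>f\<in>V. \<bar>r f\<bar>)) \<le> 4 * d\<^sup>2 * (R * R)"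
      by (intro mult_left_mono) auto
    ultimately show ?thesis by linarith
  qed
  also have "(\<Sum>e\<in>V. \<bar>r e\<bar> * (8 * \<gamma>)) \<le> R * (8 * \<gamma>)"
    using R \<gamma>0 unfolding sum_distrib_right[symmetric] V_def by (intro mult_right_mono) auto
  finally show ?thesis
    unfolding \<tau>_def[symmetric] V_def[symmetric] eq by (simp add: power2_eq_square mult_ac)
qed

context curie_weiss_array begin

text \<open>A choice of the constants \<open>K\<close> of the Gaussian linearisation for all \<open>N\<close> at once, absorbed into the
  weights \<open>\<omega>\<close>.\<close>

lemma spin_average_cw:
  obtains \<omega> :: "nat \<Rightarrow> (nat \<Rightarrow> real) \<Rightarrow> real" and \<kappa> :: "nat \<Rightarrow> real"
  where "\<And>N. \<kappa> N > 0" "\<And>N \<sigma>. \<omega> N \<sigma> = \<kappa> N * cw_weight N (a N) B \<sigma>"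
    "\<And>N F. has_bochner_integral lborel
      (\<lambda>u. mixture_density N (a N) B (y N) u * (\<Sum>\<sigma>\<in>spin_configs N. F \<sigma> * spins_at N u \<sigma>))
      (\<Sum>\<sigma>\<in>spin_configs N. F \<sigma> * \<omega> N \<sigma>)"
proof -
  have "\<forall>N. \<exists>K>0. \<forall>F. has_bochner_integral lborel
      (\<lambda>u. mixture_density N (a N) B (y N) u * (\<Sum>\<sigma>\<in>spin_configs N. F \<sigma> * spins_at N u \<sigma>))
      (K * (\<Sum>\<sigma>\<in>spin_configs N. F \<sigma> * cw_weight N (a N) B \<sigma>))"
    using hubbard_stratonovich by blast
  from choice[OF this] obtain \<kappa> where \<kappa>: "\<And>N. \<kappa> N > 0"
    "\<And>N F. has_bochner_integral lborel
      (\<lambda>u. mixture_density N (a N) B (y N) u * (\<Sum>\<sigma>\<in>spin_configs N. F \<sigma> * spins_at N u \<sigma>))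
      (\<kappa> N * (\<Sum>\<sigma>\<in>spin_configs N. F \<sigma> * cw_weight N (a N) B \<sigma>))"
    by blast
  show ?thesis
    by (rule that[of \<kappa> "\<lambda>N \<sigma>. \<kappa> N * cw_weight N (a N) B \<sigma>"])
      (use \<kappa> in \<open>auto simp: sum_distrib_left mult_ac\<close>)
qed

text \<open>The residual energy \<open>D\<close>, centred at its value \<open>\<rho>\<close> for the mean spins, is bounded by \<open>2 R\<close> and tends
  to \<open>0\<close> in mean square. By the Cauchy--Schwarz inequality the factor \<open>exp (- D)\<close> then changes the
  moment generating function by a vanishing amount; the second factor in that inequality is the
  generating function at \<open>2 t\<close>, which is bounded.\<close>

theorem perturbed_mgf_tendsto:
  fixes r :: "nat \<Rightarrow> nat \<times> nat \<Rightarrow> real" and \<gamma> :: "nat \<Rightarrow> real"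
  assumes R: "\<And>N. (\<Sum>e\<in>vertex_pairs N. \<bar>r N e\<bar>) \<le> R"
    and \<gamma>: "\<And>N i. i \<in> {1..N} \<Longrightarrow> (\<Sum>e\<in>{e \<in> vertex_pairs N. i = fst e \<or> i = snd e}. \<bar>r N e\<bar>) \<le> \<gamma> N"
    and \<gamma>0: "\<gamma> \<longlonglongrightarrow> 0"
  shows "(\<lambda>N. (\<Sum>\<sigma>\<in>spin_configs N. exp (t * fluct N \<sigma>) * (cw_weight N (a N) B \<sigma> * exp (- pair_energy N (r N) \<sigma>)))
      / (\<Sum>\<sigma>\<in>spin_configs N. cw_weight N (a N) B \<sigma> * exp (- pair_energy N (r N) \<sigma>)))
    \<longlonglongrightarrow> exp (limit_variance * t\<^sup>2 / 2)"
proof -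
  obtain \<omega> \<kappa> where \<kappa>: "\<And>N. \<kappa> N > 0" and \<omega>: "\<And>N \<sigma>. \<omega> N \<sigma> = \<kappa> N * cw_weight N (a N) B \<sigma>"
    and hs: "\<And>N F. has_bochner_integral lborel
      (\<lambda>u. mixture_density N (a N) B (y N) u * (\<Sum>\<sigma>\<in>spin_configs N. F \<sigma> * spins_at N u \<sigma>))
      (\<Sum>\<sigma>\<in>spin_configs N. F \<sigma> * \<omega> N \<sigma>)"
    by (rule spin_average_cw) blast
  have \<omega>0: "\<omega> N \<sigma> \<ge> 0" for N \<sigma> unfolding \<omega> using \<kappa>[of N] by (simp add: cw_weight_def)
  define L where "L = sqrt (2 * pi / (1 - P))"
  have L: "L > 0" using one_minus_P c_pos by (simp add: L_def)
  have R0: "R \<ge> 0" using R[of 0] by (rule order_trans[rotated]) (simp add: sum_nonneg)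
  have mgf: "(\<lambda>N. \<Sum>\<sigma>\<in>spin_configs N. exp (s * fluct N \<sigma>) * \<omega> N \<sigma>) \<longlonglongrightarrow> L * exp (limit_variance * s\<^sup>2 / 2)" for s
  proof -
    have "(\<Sum>\<sigma>\<in>spin_configs N. exp (s * fluct N \<sigma>) * \<omega> N \<sigma>) = (\<integral>u. joint_density N s u \<partial>lborel)" for N
      using hs[of N "\<lambda>\<sigma>. exp (s * fluct N \<sigma>)"] unfolding joint_density_def
      by (simp add: has_bochner_integral_iff)
    then show ?thesis using integral_joint_density_tendsto[of s] by (simp add: L_def)
  qed
  define \<rho> where "\<rho> N = (\<Sum>e\<in>vertex_pairs N. r N e * (tanh (a N (fst e) * y N + B) * tanh (a N (snd e) * y N + B)))" for N
  define D where "D N \<sigma> = pair_energy N (r N) \<sigma> - \<rho> N" for N \<sigma>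
  \<comment> \<open>Conditionally on \<open>u\<close> the fields move by at most \<open>\<delta> \<bar>u\<bar>\<close>, so the second moment is of order \<open>\<delta>\<^sup>2 u\<^sup>2 + \<gamma>\<close>.\<close>
  have second: "(\<lambda>N. \<Sum>\<sigma>\<in>spin_configs N. (D N \<sigma>)\<^sup>2 * \<omega> N \<sigma>) \<longlonglongrightarrow> 0"
  proof -
    let ?k = "\<lambda>N. 4 * R\<^sup>2 * (\<delta> N)\<^sup>2 * (2 / c) + 8 * R * \<gamma> N"
    define b where "b N = ?k N * sqrt (pi / (c / 2))" for N
    have "\<forall>\<^sub>F N in sequentially. norm (\<Sum>\<sigma>\<in>spin_configs N. (D N \<sigma>)\<^sup>2 * \<omega> N \<sigma>) \<le> b N"
      using quad eventually_gt_at_top[of 0]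
    proof eventually_elim
      case (elim N)
      have \<delta>N: "\<delta> N \<ge> 0" using a_nonneg[of N N] a_le[of N N] elim(2) by simp
      have \<gamma>N: "\<gamma> N \<ge> 0" using \<gamma>[of N N] elim(2) by (intro order_trans[OF _ \<gamma>[of N N]] sum_nonneg) auto
      have "(\<Sum>\<sigma>\<in>spin_configs N. (D N \<sigma>)\<^sup>2 * \<omega> N \<sigma>) \<le> b N"
      proof (rule has_bochner_integral_mono)
        show "has_bochner_integral lborel (\<lambda>u. ?k N * exp (- (c / 2 * u\<^sup>2))) (b N)"
          unfolding b_def using c_pos by (intro has_bochner_integral_mult_right exp_neg_sq_integral) auto
        show "has_bochner_integral lborel
          (\<lambda>u. mixture_density N (a N) B (y N) u * (\<Sum>\<sigma>\<in>spin_configs N. (D N \<sigma>)\<^sup>2 * spins_at N u \<sigma>))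
          (\<Sum>\<sigma>\<in>spin_configs N. (D N \<sigma>)\<^sup>2 * \<omega> N \<sigma>)" by (rule hs)
        fix u :: real
        define m where "m = (\<Sum>\<sigma>\<in>spin_configs N. (D N \<sigma>)\<^sup>2 * spins_at N u \<sigma>)"
        have m0: "m \<ge> 0" unfolding m_def by (intro sum_nonneg mult_nonneg_nonneg spin_weight_nonneg) auto
        have "m \<le> 4 * R\<^sup>2 * (\<delta> N * \<bar>u\<bar>)\<^sup>2 + 8 * R * \<gamma> N"
          unfolding m_def D_def \<rho>_def
        proof (rule pair_energy_second_moment[OF R \<gamma>])
          fix i assume i: "i \<in> {1..N}"
          have "a N i * (y N + u) + B - (a N i * y N + B) = a N i * u" by (simp add: algebra_simps)
          then show "\<bar>a N i * (y N + u) + B - (a N i * y N + B)\<bar> \<le> \<delta> N * \<bar>u\<bar>"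
            using a_nonneg[OF i] a_le[OF i] by (simp add: abs_mult mult_right_mono)
        qed (use \<delta>N \<gamma>N in auto)
        also have "\<dots> = 4 * R\<^sup>2 * (\<delta> N)\<^sup>2 * u\<^sup>2 + 8 * R * \<gamma> N" by (simp add: power_mult_distrib)
        finally have m: "m \<le> 4 * R\<^sup>2 * (\<delta> N)\<^sup>2 * u\<^sup>2 + 8 * R * \<gamma> N" .
        \<comment> \<open>Half of the Gaussian decay absorbs the factor \<open>u\<^sup>2\<close>.\<close>
        have e1: "1 \<le> exp (c / 2 * u\<^sup>2)" using c_pos by simp
        have "c / 2 * u\<^sup>2 \<le> exp (c / 2 * u\<^sup>2)" using exp_ge_add_one_self[of "c / 2 * u\<^sup>2"] by linarith
        then have e2: "u\<^sup>2 \<le> 2 / c * exp (c / 2 * u\<^sup>2)" using c_pos by (simp add: field_simps)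
        have "m \<le> 4 * R\<^sup>2 * (\<delta> N)\<^sup>2 * (2 / c * exp (c / 2 * u\<^sup>2)) + 8 * R * \<gamma> N * exp (c / 2 * u\<^sup>2)"
          using mult_left_mono[OF e2, of "4 * R\<^sup>2 * (\<delta> N)\<^sup>2"] mult_left_mono[OF e1, of "8 * R * \<gamma> N"] m R0 \<gamma>N by simp
        then have m2: "m \<le> ?k N * exp (c / 2 * u\<^sup>2)" by (simp add: algebra_simps)
        have "mixture_density N (a N) B (y N) u * m \<le> exp (- (c * u\<^sup>2)) * (?k N * exp (c / 2 * u\<^sup>2))"
          using elim(1) m2 m0 by (intro mult_mono) auto
        also have "exp (- (c * u\<^sup>2)) * (?k N * exp (c / 2 * u\<^sup>2))
          = ?k N * exp (- (c / 2 * u\<^sup>2))"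
        proof -
          have "exp (- (c * u\<^sup>2)) * exp (c / 2 * u\<^sup>2) = exp (- (c / 2 * u\<^sup>2))"
            unfolding exp_add[symmetric] by simp
          moreover have "p * (q * r) = q * (p * r)" for p q r :: real by simp
          ultimately show ?thesis by simp
        qed
        finally show "mixture_density N (a N) B (y N) u * (\<Sum>\<sigma>\<in>spin_configs N. (D N \<sigma>)\<^sup>2 * spins_at N u \<sigma>)
          \<le> ?k N * exp (- (c / 2 * u\<^sup>2))"
          unfolding m_def .
      qed
      moreover have "(\<Sum>\<sigma>\<in>spin_configs N. (D N \<sigma>)\<^sup>2 * \<omega> N \<sigma>) \<ge> 0" using \<omega>0 by (intro sum_nonneg) auto
      ultimately show ?case by simp
    qed
    moreover have "b \<longlonglongrightarrow> (4 * R\<^sup>2 * 0\<^sup>2 * (2 / c) + 8 * R * 0) * sqrt (pi / (c / 2))"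
      unfolding b_def by (intro tendsto_intros \<delta> \<gamma>0)
    then have "b \<longlonglongrightarrow> 0" by simp
    ultimately show ?thesis by (rule Lim_null_comparison)
  qed
  have D_le: "\<bar>D N \<sigma>\<bar> \<le> 2 * R" if "\<sigma> \<in> spin_configs N" for N \<sigma>
  proof -
    have "\<bar>pair_energy N (r N) \<sigma>\<bar> \<le> (\<Sum>e\<in>vertex_pairs N. \<bar>r N e\<bar>)"
      unfolding pair_energy_def
    proof (rule order_trans[OF sum_abs sum_mono])
      fix e assume e: "e \<in> vertex_pairs N"
      show "\<bar>r N e * (\<sigma> (fst e) * \<sigma> (snd e))\<bar> \<le> \<bar>r N e\<bar>"
        using abs_spin[OF that vertex_pairsD(1)[OF e]] abs_spin[OF that vertex_pairsD(2)[OF e]] by (simp add: abs_mult)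
    qed
    moreover have "\<bar>\<rho> N\<bar> \<le> (\<Sum>e\<in>vertex_pairs N. \<bar>r N e\<bar>)"
      unfolding \<rho>_def
    proof (rule order_trans[OF sum_abs sum_mono])
      fix e
      have "\<bar>tanh (a N (fst e) * y N + B)\<bar> * \<bar>tanh (a N (snd e) * y N + B)\<bar> \<le> 1"
        using abs_tanh_le_1 by (intro mult_le_one) auto
      then show "\<bar>r N e * (tanh (a N (fst e) * y N + B) * tanh (a N (snd e) * y N + B))\<bar> \<le> \<bar>r N e\<bar>"
        by (simp add: abs_mult mult_left_le)
    qed
    ultimately show ?thesis unfolding D_def using R[of N] by linarith
  qed
  have pert: "(\<lambda>N. \<Sum>\<sigma>\<in>spin_configs N. exp (s * fluct N \<sigma>) * exp (- D N \<sigma>) * \<omega> N \<sigma>) \<longlonglongrightarrow> L * exp (limit_variance * s\<^sup>2 / 2)" for s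
  proof -
    let ?M = "\<lambda>N. \<Sum>\<sigma>\<in>spin_configs N. exp ((2 * s) * fluct N \<sigma>) * \<omega> N \<sigma>"
    let ?D = "\<lambda>N. \<Sum>\<sigma>\<in>spin_configs N. (D N \<sigma>)\<^sup>2 * \<omega> N \<sigma>"
    let ?f = "\<lambda>N \<sigma>. exp (s * fluct N \<sigma>) * sqrt (\<omega> N \<sigma>)"
    let ?g = "\<lambda>N \<sigma>. \<bar>D N \<sigma>\<bar> * sqrt (\<omega> N \<sigma>)"
    define d where "d N = (\<Sum>\<sigma>\<in>spin_configs N. exp (s * fluct N \<sigma>) * exp (- D N \<sigma>) * \<omega> N \<sigma>) - (\<Sum>\<sigma>\<in>spin_configs N. exp (s * fluct N \<sigma>) * \<omega> N \<sigma>)" for N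
    have nb: "norm (d N) \<le> exp (2 * R) * sqrt (?M N * ?D N)" for N
    proof -
      have "\<bar>d N\<bar> = \<bar>\<Sum>\<sigma>\<in>spin_configs N. exp (s * fluct N \<sigma>) * (exp (- D N \<sigma>) - 1) * \<omega> N \<sigma>\<bar>"
        unfolding d_def sum_subtractf[symmetric] by (simp add: algebra_simps)
      also have "\<dots> \<le> (\<Sum>\<sigma>\<in>spin_configs N. exp (2 * R) * (?f N \<sigma> * ?g N \<sigma>))"
      proof (rule order_trans[OF sum_abs sum_mono])
        fix \<sigma> assume \<sigma>: "\<sigma> \<in> spin_configs N"
        have "\<bar>exp (- D N \<sigma>) - 1\<bar> \<le> exp (2 * R) * \<bar>D N \<sigma>\<bar>"
        proof -
          have 1: "exp x - 1 \<le> exp (2 * R) * \<bar>x\<bar>" "1 - exp x \<le> exp (2 * R) * \<bar>x\<bar>" if "\<bar>x\<bar> \<le> 2 * R" for x :: real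
          proof -
            have "1 - exp x \<le> - x" using exp_ge_add_one_self[of x] by linarith
            moreover have "exp x * (1 - x) \<le> 1"
            proof -
              have "exp x * (1 - x) \<le> exp x * exp (- x)" using exp_ge_add_one_self[of "- x"] by (intro mult_left_mono) auto
              then show ?thesis by (simp add: exp_minus)
            qed
            then have "exp x - 1 \<le> exp x * x" by (simp add: algebra_simps)
            moreover have "exp x * x \<le> exp x * \<bar>x\<bar>" by (intro mult_left_mono) auto
            moreover have "exp x * \<bar>x\<bar> \<le> exp (2 * R) * \<bar>x\<bar>" using that by (intro mult_right_mono) auto
            moreover have "1 * \<bar>x\<bar> \<le> exp (2 * R) * \<bar>x\<bar>" using R0 by (intro mult_right_mono) auto
            ultimately show "exp x - 1 \<le> exp (2 * R) * \<bar>x\<bar>" "1 - exp x \<le> exp (2 * R) * \<bar>x\<bar>" by linarith+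
          qed
          show ?thesis using 1[of "- D N \<sigma>"] D_le[OF \<sigma>] by (auto simp: abs_le_iff)
        qed
        then have "exp (s * fluct N \<sigma>) * \<bar>exp (- D N \<sigma>) - 1\<bar> * \<omega> N \<sigma> \<le> exp (s * fluct N \<sigma>) * (exp (2 * R) * \<bar>D N \<sigma>\<bar>) * \<omega> N \<sigma>"
          using \<omega>0 by (intro mult_left_mono mult_right_mono) auto
        also have "\<dots> = exp (2 * R) * (?f N \<sigma> * ?g N \<sigma>)"
        proof -
          have "sqrt (\<omega> N \<sigma>) * sqrt (\<omega> N \<sigma>) = \<omega> N \<sigma>" using \<omega>0 by simp
          then have "exp (s * fluct N \<sigma>) * (exp (2 * R) * \<bar>D N \<sigma>\<bar>) * \<omega> N \<sigma>
            = exp (s * fluct N \<sigma>) * (exp (2 * R) * \<bar>D N \<sigma>\<bar>) * (sqrt (\<omega> N \<sigma>) * sqrt (\<omega> N \<sigma>))" by (simp only:)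
          also have "\<dots> = exp (2 * R) * (?f N \<sigma> * ?g N \<sigma>)"
            by (simp only: mult_ac)
          finally show ?thesis .
        qed
        finally show "\<bar>exp (s * fluct N \<sigma>) * (exp (- D N \<sigma>) - 1) * \<omega> N \<sigma>\<bar>
          \<le> exp (2 * R) * (?f N \<sigma> * ?g N \<sigma>)"
          using \<omega>0[of N \<sigma>] by (simp only: abs_mult abs_exp_cancel abs_of_nonneg)
      qed
      also have "\<dots> = exp (2 * R) * (\<Sum>\<sigma>\<in>spin_configs N. ?f N \<sigma> * ?g N \<sigma>)"
        by (simp add: sum_distrib_left)
      also have "\<dots> \<le> exp (2 * R) * sqrt (?M N * ?D N)"
      proof (rule mult_left_mono[OF real_le_rsqrt])
        have "(\<Sum>\<sigma>\<in>spin_configs N. ?f N \<sigma> * ?g N \<sigma>)\<^sup>2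
          \<le> (\<Sum>\<sigma>\<in>spin_configs N. (?f N \<sigma>)\<^sup>2) * (\<Sum>\<sigma>\<in>spin_configs N. (?g N \<sigma>)\<^sup>2)"
          by (rule Cauchy_Schwarz_ineq_sum)
        then show "(\<Sum>\<sigma>\<in>spin_configs N. ?f N \<sigma> * ?g N \<sigma>)\<^sup>2
          \<le> ?M N * ?D N"
          using \<omega>0 by (simp add: power_mult_distrib exp_double[symmetric] mult.assoc)
      qed auto
      finally show ?thesis by simp
    qed
    have "(\<lambda>N. exp (2 * R) * sqrt (?M N * ?D N))
      \<longlonglongrightarrow> exp (2 * R) * sqrt (L * exp (limit_variance * (2 * s)\<^sup>2 / 2) * 0)"
      by (intro tendsto_intros mgf second)
    then have "(\<lambda>N. exp (2 * R) * sqrt (?M N * ?D N))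
      \<longlonglongrightarrow> 0" by simp
    with always_eventually[OF allI[OF nb]] have "d \<longlonglongrightarrow> 0"
      by (rule Lim_null_comparison)
    from tendsto_add[OF this mgf[of s]] show ?thesis by (simp add: d_def)
  qed
  have "(\<lambda>N. (\<Sum>\<sigma>\<in>spin_configs N. exp (t * fluct N \<sigma>) * exp (- D N \<sigma>) * \<omega> N \<sigma>) / (\<Sum>\<sigma>\<in>spin_configs N. exp (0 * fluct N \<sigma>) * exp (- D N \<sigma>) * \<omega> N \<sigma>))
     \<longlonglongrightarrow> (L * exp (limit_variance * t\<^sup>2 / 2)) / (L * exp (limit_variance * 0\<^sup>2 / 2))"
    using L by (intro tendsto_divide pert) auto
  also have "(L * exp (limit_variance * t\<^sup>2 / 2)) / (L * exp (limit_variance * 0\<^sup>2 / 2)) = exp (limit_variance * t\<^sup>2 / 2)"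
    using L by simp
  also have "(\<lambda>N. (\<Sum>\<sigma>\<in>spin_configs N. exp (t * fluct N \<sigma>) * exp (- D N \<sigma>) * \<omega> N \<sigma>) / (\<Sum>\<sigma>\<in>spin_configs N. exp (0 * fluct N \<sigma>) * exp (- D N \<sigma>) * \<omega> N \<sigma>))
    = (\<lambda>N. (\<Sum>\<sigma>\<in>spin_configs N. exp (t * fluct N \<sigma>) * (cw_weight N (a N) B \<sigma> * exp (- pair_energy N (r N) \<sigma>)))
      / (\<Sum>\<sigma>\<in>spin_configs N. cw_weight N (a N) B \<sigma> * exp (- pair_energy N (r N) \<sigma>)))"
  proof
    fix N
    have *: "f * exp (- D N \<sigma>) * \<omega> N \<sigma> = (exp (\<rho> N) * \<kappa> N) * (f * (cw_weight N (a N) B \<sigma> * exp (- pair_energy N (r N) \<sigma>)))" for f \<sigma>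
    proof -
      have "exp (- D N \<sigma>) = exp (\<rho> N) * exp (- pair_energy N (r N) \<sigma>)"
        unfolding D_def exp_add[symmetric] by simp
      then show ?thesis unfolding \<omega> by (simp only: mult_ac)
    qed
    show "(\<Sum>\<sigma>\<in>spin_configs N. exp (t * fluct N \<sigma>) * exp (- D N \<sigma>) * \<omega> N \<sigma>) / (\<Sum>\<sigma>\<in>spin_configs N. exp (0 * fluct N \<sigma>) * exp (- D N \<sigma>) * \<omega> N \<sigma>)
      = (\<Sum>\<sigma>\<in>spin_configs N. exp (t * fluct N \<sigma>) * (cw_weight N (a N) B \<sigma> * exp (- pair_energy N (r N) \<sigma>)))
      / (\<Sum>\<sigma>\<in>spin_configs N. cw_weight N (a N) B \<sigma> * exp (- pair_energy N (r N) \<sigma>))"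
      unfolding * sum_distrib_left[symmetric] using \<kappa>[of N] by simp
  qed
  finally show ?thesis .
qed

end

section \<open>Empirical averages of the weights\<close>

text \<open>Dominated convergence with majorants \<open>g n\<close> that vary but whose integrals converge: by Scheffe's
  lemma \<open>g n\<close> converges in \<open>L\<^sup>1\<close>, and the part of \<open>\<bar>f n - f'\<bar>\<close> that exceeds \<open>\<bar>g n - g'\<bar>\<close> is at most
  \<open>2 g'\<close>.\<close>

lemma tendsto_integral_dominated_scheffe:
  fixes f :: "nat \<Rightarrow> 'b \<Rightarrow> real" and g :: "nat \<Rightarrow> 'b \<Rightarrow> real"
  assumes [measurable]: "\<And>n. f n \<in> borel_measurable M" "f' \<in> borel_measurable M"
    and g: "\<And>n. integrable M (g n)" "integrable M g'"
    and nonneg: "\<And>n x. g n x \<ge> 0" "\<And>x. g' x \<ge> 0"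
    and fg: "\<And>n x. \<bar>f n x\<bar> \<le> g n x" "\<And>x. \<bar>f' x\<bar> \<le> g' x"
    and limf: "\<And>x. x \<in> space M \<Longrightarrow> (\<lambda>n. f n x) \<longlonglongrightarrow> f' x"
    and limg: "\<And>x. x \<in> space M \<Longrightarrow> (\<lambda>n. g n x) \<longlonglongrightarrow> g' x"
    and intg: "(\<lambda>n. integral\<^sup>L M (g n)) \<longlonglongrightarrow> integral\<^sup>L M g'"
  shows "(\<lambda>n. integral\<^sup>L M (f n)) \<longlonglongrightarrow> integral\<^sup>L M f'"
proof -
  have gm[measurable]: "\<And>n. g n \<in> borel_measurable M" "g' \<in> borel_measurable M" using g by auto
  have fint: "integrable M (f n)" for n
    by (rule Bochner_Integration.integrable_bound[OF g(1)]) (use fg nonneg in \<open>auto\<close>)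
  have fint': "integrable M f'"
    by (rule Bochner_Integration.integrable_bound[OF g(2)]) (use fg nonneg in \<open>auto\<close>)
  define G where "G n x = max (\<bar>f n x - f' x\<bar> - \<bar>g n x - g' x\<bar>) 0" for n x
  have G0: "(\<lambda>n. integral\<^sup>L M (G n)) \<longlonglongrightarrow> integral\<^sup>L M (\<lambda>x. 0)"
  proof (rule integral_dominated_convergence[where w = "\<lambda>x. 2 * g' x"])
    show "integrable M (\<lambda>x. 2 * g' x)" using g by simp
    have "(\<lambda>n. G n x) \<longlonglongrightarrow> max (\<bar>f' x - f' x\<bar> - \<bar>g' x - g' x\<bar>) 0" if "x \<in> space M" for x
      unfolding G_def using limf[OF that] limg[OF that] by (intro tendsto_intros)
    then show "AE x in M. (\<lambda>n. G n x) \<longlonglongrightarrow> 0" by auto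
    have "norm (G n x) \<le> 2 * g' x" for n x
      using fg(1)[of n x] fg(2)[of x] nonneg(1)[of n x] nonneg(2)[of x] by (auto simp: G_def)
    then show "AE x in M. norm (G n x) \<le> 2 * g' x" for n by auto
    show "G n \<in> borel_measurable M" for n unfolding G_def[abs_def] by measurable
  qed simp
  have gd: "(\<lambda>n. \<integral>x. \<bar>g n x - g' x\<bar> \<partial>M) \<longlonglongrightarrow> 0"
  proof -
    have "(\<lambda>n. \<integral>\<^sup>+ x. norm (g n x - g' x) \<partial>M) \<longlonglongrightarrow> 0"
    proof (rule Scheffe_lemma1[OF g])
      show "AE x in M. (\<lambda>n. g n x) \<longlonglongrightarrow> g' x" using limg by auto
      have "(\<integral>\<^sup>+ x. norm (g n x) \<partial>M) = ennreal (integral\<^sup>L M (g n))" for n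
        using nonneg by (subst nn_integral_eq_integral[symmetric]) (auto simp: g)
      moreover have "(\<integral>\<^sup>+ x. norm (g' x) \<partial>M) = ennreal (integral\<^sup>L M g')"
        using nonneg by (subst nn_integral_eq_integral[symmetric]) (auto simp: g)
      moreover have "(\<lambda>n. ennreal (integral\<^sup>L M (g n))) \<longlonglongrightarrow> ennreal (integral\<^sup>L M g')"
        using intg by (intro tendsto_ennrealI)
      ultimately show "limsup (\<lambda>n. \<integral>\<^sup>+ x. norm (g n x) \<partial>M) \<le> (\<integral>\<^sup>+ x. norm (g' x) \<partial>M)"
        by (simp add: lim_imp_Limsup)
    qed
    moreover have "(\<integral>\<^sup>+ x. norm (g n x - g' x) \<partial>M) = ennreal (\<integral>x. \<bar>g n x - g' x\<bar> \<partial>M)" for n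
      by (subst nn_integral_eq_integral[symmetric]) (auto intro!: integrable_abs Bochner_Integration.integrable_diff g)
    ultimately have "(\<lambda>n. ennreal (\<integral>x. \<bar>g n x - g' x\<bar> \<partial>M)) \<longlonglongrightarrow> ennreal 0" by simp
    then show ?thesis by (rule tendsto_ennrealD) auto
  qed
  have "\<bar>integral\<^sup>L M (f n) - integral\<^sup>L M f'\<bar> \<le> integral\<^sup>L M (G n) + (\<integral>x. \<bar>g n x - g' x\<bar> \<partial>M)" for n
  proof -
    have Gint: "integrable M (G n)"
      unfolding G_def by (intro Bochner_Integration.integrable_max Bochner_Integration.integrable_diff integrable_abs fint fint' g) auto
    have "\<bar>integral\<^sup>L M (f n) - integral\<^sup>L M f'\<bar> = \<bar>\<integral>x. f n x - f' x \<partial>M\<bar>"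
      by (simp add: fint fint')
    also have "\<dots> \<le> (\<integral>x. \<bar>f n x - f' x\<bar> \<partial>M)" by (rule integral_abs_bound)
    also have "\<dots> \<le> (\<integral>x. G n x + \<bar>g n x - g' x\<bar> \<partial>M)"
      by (intro integral_mono Bochner_Integration.integrable_add integrable_abs Bochner_Integration.integrable_diff fint fint' g Gint) (auto simp: G_def)
    also have "\<dots> = integral\<^sup>L M (G n) + (\<integral>x. \<bar>g n x - g' x\<bar> \<partial>M)"
      by (intro Bochner_Integration.integral_add Gint integrable_abs Bochner_Integration.integrable_diff g)
    finally show ?thesis .
  qed
  then have "(\<lambda>n. integral\<^sup>L M (f n) - integral\<^sup>L M f') \<longlonglongrightarrow> 0"
    by (intro Lim_null_comparison[OF _ tendsto_add_zero[OF G0[simplified] gd]]) auto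
  then show ?thesis by (simp add: LIM_zero_iff)
qed

lemma expectation_uniform_vertex:
  fixes f :: "nat \<Rightarrow> real"
  assumes "N > 0"
  shows "measure_pmf.expectation (pmf_of_set {1..N}) f = (\<Sum>i\<in>{1..N}. f i) / real N"
  using assms by (subst integral_pmf_of_set) auto

text \<open>By Skorohod's theorem the weak convergence of \<open>W\<^sub>N\<close> is pointwise convergence of suitable copies. The
  majorants \<open>C (1 + W\<^sub>N\<^sup>2)\<close> have convergent integrals, which is the second-moment part of the
  regularity condition. The second argument of \<open>F\<close> carries a parameter that itself converges, here
  the position of the saddle point.\<close>

theorem empirical_average_limit:
  fixes F :: "real \<Rightarrow> real \<Rightarrow> real"
  assumes reg: "weight_regularity w \<Omega> W"
    and cont: "continuous_on UNIV (\<lambda>p. F (fst p) (snd p))"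
    and bound: "\<And>x y. \<bar>F x y\<bar> \<le> C * (1 + x\<^sup>2)"
    and ys: "ys \<longlonglongrightarrow> y"
  shows "(\<lambda>N. (\<Sum>i\<in>{1..N}. F (w N i) (ys N)) / real N) \<longlonglongrightarrow> (\<integral>\<omega>. F (W \<omega>) y \<partial>\<Omega>)"
proof -
  interpret Om: prob_space \<Omega> using reg by (simp add: weight_regularity_def)
  have Wm[measurable]: "W \<in> borel_measurable \<Omega>" using reg by (simp add: weight_regularity_def)
  define \<mu> where "\<mu> N = distr (measure_pmf (pmf_of_set {1..N})) borel (w N)" for N
  have \<mu>: "real_distribution (\<mu> N)" for N
    unfolding \<mu>_def real_distribution_def real_distribution_axioms_def
    by (auto intro!: prob_space.prob_space_distr measure_pmf.prob_space_axioms)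
  have M: "real_distribution (distr \<Omega> borel W)"
    unfolding real_distribution_def real_distribution_axioms_def
    by (auto intro!: Om.prob_space_distr)
  have wc: "weak_conv_m \<mu> (distr \<Omega> borel W)"
    using reg unfolding \<mu>_def by (simp add: weight_regularity_def)
  have "\<exists> (\<Lambda> :: real measure) (Y_seq :: nat \<Rightarrow> real \<Rightarrow> real) (Y :: real \<Rightarrow> real).
    prob_space \<Lambda> \<and> (\<forall>n. Y_seq n \<in> measurable \<Lambda> borel) \<and> (\<forall>n. distr \<Lambda> borel (Y_seq n) = \<mu> n) \<and>
    Y \<in> borel_measurable \<Lambda> \<and> distr \<Lambda> borel Y = distr \<Omega> borel W \<and>
    (\<forall>x \<in> space \<Lambda>. (\<lambda>n. Y_seq n x) \<longlonglongrightarrow> Y x)"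
    using Skorohod[OF \<mu> M wc] by simp
  then obtain \<Lambda> :: "real measure" and X Y where sk: "prob_space \<Lambda>"
    and X[measurable]: "\<And>n. X n \<in> borel_measurable \<Lambda>"
    and dX: "\<And>n. distr \<Lambda> borel (X n) = \<mu> n"
    and Y[measurable]: "Y \<in> borel_measurable \<Lambda>" and dY: "distr \<Lambda> borel Y = distr \<Omega> borel W"
    and lim: "\<And>x. x \<in> space \<Lambda> \<Longrightarrow> (\<lambda>n. X n x) \<longlonglongrightarrow> Y x" by metis
  interpret L: prob_space \<Lambda> by (rule sk)
  have F1[measurable]: "(\<lambda>x. F x z) \<in> borel_measurable borel" for z
  proof -
    have "continuous_on UNIV (\<lambda>x. F (fst (x, z)) (snd (x, z)))"
      by (rule continuous_on_compose2[OF cont]) (auto intro!: continuous_intros)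
    then show ?thesis by (intro borel_measurable_continuous_onI) simp
  qed
  have avg: "(\<integral>x. f (X N x) \<partial>\<Lambda>) = (\<Sum>i\<in>{1..N}. f (w N i)) / real N"
    and intX: "integrable \<Lambda> (\<lambda>x. f (X N x))"
    if "N > 0" and [measurable]: "f \<in> borel_measurable borel" for N and f :: "real \<Rightarrow> real"
  proof -
    have "(\<integral>x. f (X N x) \<partial>\<Lambda>) = integral\<^sup>L (\<mu> N) f"
      unfolding dX[symmetric] by (rule integral_distr[symmetric]) auto
    also have "\<dots> = measure_pmf.expectation (pmf_of_set {1..N}) (\<lambda>i. f (w N i))"
      unfolding \<mu>_def by (rule integral_distr) auto
    finally show "(\<integral>x. f (X N x) \<partial>\<Lambda>) = (\<Sum>i\<in>{1..N}. f (w N i)) / real N"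
      using expectation_uniform_vertex[OF \<open>N > 0\<close>] by simp
    have "integrable (measure_pmf (pmf_of_set {1..N})) (\<lambda>i. f (w N i))"
      using \<open>N > 0\<close> by (intro integrable_measure_pmf_finite) (auto simp: set_pmf_of_set)
    then have "integrable (\<mu> N) f" unfolding \<mu>_def by (subst integrable_distr_eq) auto
    then show "integrable \<Lambda> (\<lambda>x. f (X N x))"
      unfolding dX[symmetric] by (subst (asm) integrable_distr_eq) auto
  qed
  have avgY: "(\<integral>x. f (Y x) \<partial>\<Lambda>) = (\<integral>\<omega>. f (W \<omega>) \<partial>\<Omega>)"
    and intY: "integrable \<Lambda> (\<lambda>x. f (Y x)) = integrable \<Omega> (\<lambda>\<omega>. f (W \<omega>))"
    if [measurable]: "f \<in> borel_measurable borel" for f :: "real \<Rightarrow> real"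
  proof -
    show "(\<integral>x. f (Y x) \<partial>\<Lambda>) = (\<integral>\<omega>. f (W \<omega>) \<partial>\<Omega>)"
      using integral_distr[of Y \<Lambda> borel f] integral_distr[of W \<Omega> borel f] dY by simp
    show "integrable \<Lambda> (\<lambda>x. f (Y x)) = integrable \<Omega> (\<lambda>\<omega>. f (W \<omega>))"
      using integrable_distr_eq[of Y \<Lambda> borel f] integrable_distr_eq[of W \<Omega> borel f] dY by simp
  qed
  have C: "C \<ge> 0" using bound[of 0 0] by simp
  \<comment> \<open>The sequences are shifted by one because the uniform law on \<open>{1..0}\<close> is meaningless.\<close>
  define g where "g n x = C * (1 + (X (Suc n) x)\<^sup>2)" for n x
  define g' where "g' x = C * (1 + (Y x)\<^sup>2)" for x
  have W2: "integrable \<Omega> (\<lambda>x. (W x)\<^sup>2)" using reg by (simp add: weight_regularity_def)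
  have g'i: "integrable \<Lambda> g'"
    unfolding g'_def by (subst intY) (use W2 in auto)
  have gi: "integrable \<Lambda> (g n)" for n
    unfolding g_def by (rule intX) auto
  have "(\<lambda>n. \<integral>x. F (X (Suc n) x) (ys (Suc n)) \<partial>\<Lambda>) \<longlonglongrightarrow> (\<integral>x. F (Y x) y \<partial>\<Lambda>)"
  proof (rule tendsto_integral_dominated_scheffe[where g = g and g' = g'])
    show "(\<lambda>n. F (X (Suc n) x) (ys (Suc n))) \<longlonglongrightarrow> F (Y x) y" if "x \<in> space \<Lambda>" for x
    proof -
      have "(\<lambda>n. (X n x, ys n)) \<longlonglongrightarrow> (Y x, y)" using lim[OF that] ys by (intro tendsto_intros)
      then have "(\<lambda>n. F (fst (X n x, ys n)) (snd (X n x, ys n))) \<longlonglongrightarrow> F (fst (Y x, y)) (snd (Y x, y))"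
        using continuous_on_tendsto_compose[OF cont, of "\<lambda>n. (X n x, ys n)" "(Y x, y)" sequentially] by simp
      from LIMSEQ_Suc[OF this] show ?thesis by simp
    qed
    show "(\<lambda>n. g n x) \<longlonglongrightarrow> g' x" if "x \<in> space \<Lambda>" for x
      unfolding g_def g'_def using LIMSEQ_Suc[OF lim[OF that]] by (intro tendsto_intros)
    show "(\<lambda>n. integral\<^sup>L \<Lambda> (g n)) \<longlonglongrightarrow> integral\<^sup>L \<Lambda> g'"
    proof -
      have "(\<lambda>N. measure_pmf.expectation (pmf_of_set {1..N}) (\<lambda>i. (w N i)\<^sup>2)) \<longlonglongrightarrow> integral\<^sup>L \<Omega> (\<lambda>x. (W x)\<^sup>2)"
        using reg by (simp add: weight_regularity_def)
      from LIMSEQ_Suc[OF this] have l: "(\<lambda>n. (\<Sum>i\<in>{1..Suc n}. (w (Suc n) i)\<^sup>2) / real (Suc n)) \<longlonglongrightarrow> integral\<^sup>L \<Omega> (\<lambda>x. (W x)\<^sup>2)"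
        by (subst (asm) expectation_uniform_vertex) auto
      have "integral\<^sup>L \<Lambda> (g n) = C * (1 + (\<Sum>i\<in>{1..Suc n}. (w (Suc n) i)\<^sup>2) / real (Suc n))" for n
        using avg[of "Suc n" "\<lambda>x. x\<^sup>2"] intX[of "Suc n" "\<lambda>x. x\<^sup>2"] unfolding g_def by (simp add: L.prob_space)
      moreover have "integral\<^sup>L \<Lambda> g' = C * (1 + integral\<^sup>L \<Omega> (\<lambda>x. (W x)\<^sup>2))"
        using avgY[of "\<lambda>x. x\<^sup>2"] intY[of "\<lambda>x. x\<^sup>2"] W2 unfolding g'_def by (simp add: L.prob_space)
      ultimately show ?thesis using l by (auto intro!: tendsto_intros simp del: of_nat_Suc)
    qed
  qed (use bound C gi g'i in \<open>auto simp: g_def g'_def\<close>)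
  also have "(\<lambda>n. \<integral>x. F (X (Suc n) x) (ys (Suc n)) \<partial>\<Lambda>) = (\<lambda>n. (\<Sum>i\<in>{1..Suc n}. F (w (Suc n) i) (ys (Suc n))) / real (Suc n))"
    by (intro ext avg) auto
  also have "(\<integral>x. F (Y x) y \<partial>\<Lambda>) = (\<integral>\<omega>. F (W \<omega>) y \<partial>\<Omega>)" by (rule avgY) auto
  finally show ?thesis by (rule LIMSEQ_imp_Suc)
qed

section \<open>From moment generating functions to the central limit theorem\<close>

lemma LIMSEQ_if_sub_subsequences:
  fixes X :: "nat \<Rightarrow> 'a::metric_space"
  assumes "\<And>r :: nat \<Rightarrow> nat. strict_mono r \<Longrightarrow> \<exists>s :: nat \<Rightarrow> nat. strict_mono s \<and> (\<lambda>n. X (r (s n))) \<longlonglongrightarrow> L"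
  shows "X \<longlonglongrightarrow> L"
proof (rule ccontr)
  assume "\<not> X \<longlonglongrightarrow> L"
  then obtain e where e: "e > 0" "\<not> (\<forall>\<^sub>F n in sequentially. dist (X n) L < e)"
    unfolding tendsto_iff by blast
  then obtain r :: "nat \<Rightarrow> nat" where r: "strict_mono r" "\<And>n. \<not> dist (X (r n)) L < e"
    using not_eventually_sequentiallyD by blast
  obtain s where "(\<lambda>n. X (r (s n))) \<longlonglongrightarrow> L" using assms[OF r(1)] by blast
  then have "\<forall>\<^sub>F n in sequentially. dist (X (r (s n))) L < e" using e(1) unfolding tendsto_iff by blast
  then show False using r(2) by (auto simp: eventually_sequentially)
qed

lemma higher_deriv_exp_sum:
  fixes p x :: "'i \<Rightarrow> real"
  assumes "finite A"
  shows "(deriv ^^ m) (\<lambda>z :: complex. \<Sum>k\<in>A. of_real (p k) * exp (z * of_real (x k)))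
       = (\<lambda>z. \<Sum>k\<in>A. of_real (p k * x k ^ m) * exp (z * of_real (x k)))"
proof (induction m)
  case (Suc m)
  have "deriv (\<lambda>z. \<Sum>k\<in>A. of_real (p k * x k ^ m) * exp (z * of_real (x k))) z
      = (\<Sum>k\<in>A. of_real (p k * x k ^ Suc m) * exp (z * of_real (x k)))" for z :: complex
    by (rule DERIV_imp_deriv) (auto intro!: derivative_eq_intros sum.cong simp: mult_ac)
  then show ?case by (simp only: funpow.simps o_apply Suc.IH)
qed simp

text \<open>The generating functions are entire, and \<open>\<bar>M n z\<bar> \<le> M n r + M n (- r)\<close> for \<open>\<bar>z\<bar> \<le> r\<close>, so they form a
  normal family. A limit along a subsequence agrees with \<open>exp (\<kappa> z\<^sup>2 / 2)\<close> on the real axis, hence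
  everywhere. Locally uniform convergence of holomorphic functions carries over to derivatives,
  and those at \<open>0\<close> are the moments.\<close>

theorem gaussian_mgf_convergence:
  fixes p x :: "nat \<Rightarrow> 'i \<Rightarrow> real" and \<kappa> :: real
  assumes fin: "\<And>n. finite (A n)" and p: "\<And>n k. k \<in> A n \<Longrightarrow> p n k \<ge> 0"
    and mgf: "\<And>t :: real. (\<lambda>n. \<Sum>k\<in>A n. p n k * exp (t * x n k)) \<longlonglongrightarrow> exp (\<kappa> * t\<^sup>2 / 2)"
  shows "(\<lambda>n. \<Sum>k\<in>A n. of_real (p n k) * exp (z * of_real (x n k))) \<longlonglongrightarrow> exp (of_real \<kappa> * z\<^sup>2 / 2 :: complex)"
    and "(\<lambda>n. \<Sum>k\<in>A n. p n k * x n k) \<longlonglongrightarrow> 0"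
    and "(\<lambda>n. \<Sum>k\<in>A n. p n k * (x n k)\<^sup>2) \<longlonglongrightarrow> \<kappa>"
proof -
  define M where "M n z = (\<Sum>k\<in>A n. of_real (p n k) * exp (z * of_real (x n k)))" for n and z :: complex
  define G where "G z = exp (of_real \<kappa> * z\<^sup>2 / 2)" for z :: complex
  have Mhol: "M n holomorphic_on S" for n S
    unfolding M_def[abs_def] by (intro holomorphic_intros)
  have Ghol: "G holomorphic_on S" for S
    unfolding G_def[abs_def] by (intro holomorphic_intros) auto
  have Mreal: "M n (of_real t) = of_real (\<Sum>k\<in>A n. p n k * exp (t * x n k))" for n t
    by (simp add: M_def exp_of_real[symmetric])
  have limreal: "(\<lambda>n. M n (of_real t)) \<longlonglongrightarrow> G (of_real t)" for t :: real
    using tendsto_of_real[OF mgf[of t], where 'a = complex] unfolding Mreal G_def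
    by (simp add: exp_of_real[symmetric])
  have bdd: "\<exists>b. \<forall>h\<in>range M. \<forall>z\<in>K. norm (h z) \<le> b" if "compact K" for K
  proof -
    obtain r where r: "\<And>z. z \<in> K \<Longrightarrow> norm z \<le> r"
      using compact_imp_bounded[OF \<open>compact K\<close>] by (auto simp: bounded_iff)
    define c where "c n = (\<Sum>k\<in>A n. p n k * exp (r * x n k)) + (\<Sum>k\<in>A n. p n k * exp ((- r) * x n k))" for n
    have "convergent c" unfolding c_def using mgf[of r] mgf[of "- r"] by (intro convergent_add) (auto simp: convergent_def)
    then obtain b where b: "\<And>n. norm (c n) \<le> b" by (meson convergent_imp_Bseq BseqE)
    have "norm (M n z) \<le> b" if "z \<in> K" for n z
    proof -
      have "norm (M n z) \<le> (\<Sum>k\<in>A n. norm (of_real (p n k) * exp (z * of_real (x n k))))"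
        unfolding M_def by (rule norm_sum)
      also have "\<dots> \<le> (\<Sum>k\<in>A n. p n k * exp (r * x n k) + p n k * exp ((- r) * x n k))"
      proof (rule sum_mono)
        fix k assume k: "k \<in> A n"
        have "\<bar>Re z\<bar> \<le> r" using r[OF that] abs_Re_le_cmod[of z] by linarith
        then have "\<bar>Re z * x n k\<bar> \<le> r * \<bar>x n k\<bar>" by (simp add: abs_mult mult_right_mono)
        then have "Re z * x n k \<le> r * x n k \<or> Re z * x n k \<le> (- r) * x n k"
          by (cases "x n k \<ge> 0") auto
        then have "exp (Re z * x n k) \<le> exp (r * x n k) \<or> exp (Re z * x n k) \<le> exp ((- r) * x n k)"
          by (simp only: exp_le_cancel_iff)
        then have "exp (Re z * x n k) \<le> exp (r * x n k) + exp ((- r) * x n k)"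
          by (smt (verit) exp_gt_zero)
        then have "p n k * exp (Re z * x n k) \<le> p n k * (exp (r * x n k) + exp ((- r) * x n k))"
          using p[OF k] by (rule mult_left_mono)
        then show "norm (of_real (p n k) * exp (z * of_real (x n k))) \<le> p n k * exp (r * x n k) + p n k * exp ((- r) * x n k)"
          using p[OF k] by (simp add: norm_mult algebra_simps)
      qed
      also have "\<dots> = c n" by (simp add: c_def sum.distrib)
      also have "\<dots> \<le> b" using b[of n] by simp
      finally show ?thesis .
    qed
    then show ?thesis by blast
  qed
  have sub: "\<exists>s :: nat \<Rightarrow> nat. strict_mono s \<and> (\<forall>m z. (\<lambda>n. (deriv ^^ m) (M (r (s n))) z) \<longlonglongrightarrow> (deriv ^^ m) G z)"
    if r: "strict_mono (r :: nat \<Rightarrow> nat)" for r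
  proof -
    obtain g s where g: "g holomorphic_on UNIV" and s: "strict_mono (s :: nat \<Rightarrow> nat)"
      and pw: "\<And>z. z \<in> UNIV \<Longrightarrow> (\<lambda>n. (\<lambda>n. M (r n)) (s n) z) \<longlonglongrightarrow> g z"
      and unif: "\<And>K. compact K \<Longrightarrow> K \<subseteq> UNIV \<Longrightarrow> uniform_limit K ((\<lambda>n. M (r n)) \<circ> s) g sequentially"
      by (rule Montel[of UNIV "range M" "\<lambda>n. M (r n)"]) (use Mhol bdd in auto)
    have greal: "g (of_real t) = G (of_real t)" for t :: real
    proof (rule LIMSEQ_unique)
      show "(\<lambda>n. M (r (s n)) (of_real t)) \<longlonglongrightarrow> g (of_real t)" using pw by simp
      show "(\<lambda>n. M (r (s n)) (of_real t)) \<longlonglongrightarrow> G (of_real t)"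
        using LIMSEQ_subseq_LIMSEQ[OF limreal strict_mono_o[OF r s]] by (simp add: o_def)
    qed
    have gG: "g z = G z" for z
    proof -
      have "(\<lambda>z. g z - G z) z = 0"
      proof (rule analytic_continuation[of "\<lambda>z. g z - G z" UNIV "range of_real" 0])
        show "(\<lambda>z. g z - G z) holomorphic_on UNIV" using g Ghol by (intro holomorphic_intros)
        show "(0::complex) islimpt range of_real"
        proof (rule islimptI)
          fix T :: "complex set" assume "0 \<in> T" "open T"
          then obtain e where e: "e > 0" "ball 0 e \<subseteq> T" by (meson open_contains_ball)
          then have "of_real (e / 2) \<in> T" "complex_of_real (e / 2) \<noteq> 0" by (auto simp: subset_eq)
          then show "\<exists>y\<in>range of_real. y \<in> T \<and> y \<noteq> 0" by blast
        qed
      qed (use greal in auto)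
      then show ?thesis by simp
    qed
    have "(\<lambda>n. (deriv ^^ m) (M (r (s n))) z) \<longlonglongrightarrow> (deriv ^^ m) G z" for m z
    proof (rule higher_deriv_complex_uniform_limit[where A = "ball z 1"])
      have "uniform_limit (cball z 1) (\<lambda>n. M (r (s n))) g sequentially"
        using unif[of "cball z 1"] by (simp add: o_def)
      then have "uniform_limit (ball z 1) (\<lambda>n. M (r (s n))) g sequentially"
        by (rule uniform_limit_on_subset) auto
      moreover have "g = G" using gG by auto
      ultimately show "uniform_limit (ball z 1) (\<lambda>n. M (r (s n))) G sequentially" by simp
    qed (use Mhol in auto)
    with s show ?thesis by blast
  qed
  have lim: "(\<lambda>n. (deriv ^^ m) (M n) z) \<longlonglongrightarrow> (deriv ^^ m) G z" for m z
    by (rule LIMSEQ_if_sub_subsequences) (use sub in blast)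
  have dM: "(deriv ^^ m) (M n) 0 = of_real (\<Sum>k\<in>A n. p n k * x n k ^ m)" for m n
    using higher_deriv_exp_sum[OF fin[of n], of m "p n" "x n"] unfolding M_def[abs_def] by simp
  have dG: "deriv G = (\<lambda>z. of_real \<kappa> * z * G z)"
    unfolding G_def[abs_def] by (rule ext, rule DERIV_imp_deriv) (auto intro!: derivative_eq_intros)
  have ddG: "deriv (\<lambda>z. of_real \<kappa> * z * G z) 0 = of_real \<kappa>"
    unfolding G_def[abs_def] by (rule DERIV_imp_deriv) (auto intro!: derivative_eq_intros)
  show "(\<lambda>n. \<Sum>k\<in>A n. of_real (p n k) * exp (z * of_real (x n k))) \<longlonglongrightarrow> exp (of_real \<kappa> * z\<^sup>2 / 2 :: complex)"
    using lim[of 0 z] by (simp add: M_def G_def)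
  have "(\<lambda>n. complex_of_real (\<Sum>k\<in>A n. p n k * x n k ^ 1)) \<longlonglongrightarrow> of_real 0"
    using lim[of 1 0] unfolding dM by (simp add: dG)
  then show "(\<lambda>n. \<Sum>k\<in>A n. p n k * x n k) \<longlonglongrightarrow> 0" by (simp only: tendsto_of_real_iff power_one_right)
  have "(\<lambda>n. complex_of_real (\<Sum>k\<in>A n. p n k * x n k ^ 2)) \<longlonglongrightarrow> of_real \<kappa>"
    using lim[of 2 0] unfolding dM by (simp add: numeral_2_eq_2 dG ddG)
  then show "(\<lambda>n. \<Sum>k\<in>A n. p n k * (x n k)\<^sup>2) \<longlonglongrightarrow> \<kappa>" by (simp only: tendsto_of_real_iff)
qed

text \<open>For \<open>v = 0\<close> the law is the point mass at \<open>0\<close>, and the formula gives its characteristic function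
  \<open>1\<close>.\<close>

lemma char_centered_normal:
  assumes "v \<ge> 0"
  shows "char (centered_normal v) t = exp (- (complex_of_real v * (of_real t)\<^sup>2 / 2))"
    and "real_distribution (centered_normal v)"
proof -
  have "char (centered_normal v) t = exp (- (complex_of_real v * (of_real t)\<^sup>2 / 2)) \<and> real_distribution (centered_normal v)"
  proof (cases "v = 0")
    case True
    have "prob_space (return borel (0::real))" by (rule prob_space_return) simp
    moreover have "char (return borel (0::real)) t = 1"
      unfolding char_def by (subst integral_return) auto
    ultimately show ?thesis using True by (simp add: centered_normal_def real_distribution_def real_distribution_axioms_def)
  next
    case False
    then have v: "sqrt v > 0" using assms by simp
    have d: "distr std_normal_distribution borel (\<lambda>x. sqrt v * x) = centered_normal v"
    proof -
      interpret prob_space std_normal_distribution by (rule prob_space_normal_density) simp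
      have "distributed std_normal_distribution lborel (\<lambda>x. x) (normal_density 0 1)"
        by (auto simp: distributed_def distr_id2 intro!: distr_id2)
      then have "distributed std_normal_distribution lborel (\<lambda>x. 0 + sqrt v * x) (normal_density (0 + sqrt v * 0) (\<bar>sqrt v\<bar> * 1))"
        by (intro normal_density_affine) (use v in auto)
      moreover have "distr std_normal_distribution borel (\<lambda>x. sqrt v * x)
          = distr std_normal_distribution lborel (\<lambda>x. sqrt v * x)" by (rule distr_cong) auto
      ultimately show ?thesis using v False by (simp add: distributed_def centered_normal_def)
    qed
    have "char (centered_normal v) t = char std_normal_distribution (t * sqrt v)"
      unfolding d[symmetric] char_def by (subst integral_distr) (auto simp: mult_ac)
    also have "\<dots> = exp (- (complex_of_real v * (of_real t)\<^sup>2 / 2))"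
      using assms unfolding char_std_normal_distribution
      by (simp add: power_mult_distrib exp_of_real[symmetric] mult.commute)
    moreover have "real_distribution (centered_normal v)"
      using prob_space_normal_density[OF v] False
      by (simp add: centered_normal_def real_distribution_def real_distribution_axioms_def)
    ultimately show ?thesis by simp
  qed
  then show "char (centered_normal v) t = exp (- (complex_of_real v * (of_real t)\<^sup>2 / 2))"
    "real_distribution (centered_normal v)" by auto
qed

section \<open>Saddle points for regular weights\<close>

lemma abs_le_one_plus_square: "\<bar>x\<bar> \<le> 1 * (1 + (x::real)\<^sup>2)"
  using sum_squares_bound[of 1 "\<bar>x\<bar>"] by simp

lemma scaled_average: "q * real N * ((\<Sum>i\<in>{1..N}. f i) / real N) = (\<Sum>i\<in>{1..N}. q * f i)"
  by (cases "N = 0") (simp_all add: sum_distrib_left[symmetric])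

lemma convergent_bound:
  fixes X :: "nat \<Rightarrow> real"
  assumes "X \<longlonglongrightarrow> L"
  obtains b where "\<And>n. X n \<le> b"
proof -
  obtain b where "\<And>n. norm (X n) \<le> b" using assms by (meson convergentI convergent_imp_Bseq BseqE)
  then show ?thesis using that[of b] by (auto simp: abs_le_iff)
qed

lemma tanh_arg_continuous:
  "continuous_on UNIV (\<lambda>p :: real \<times> real. tanh (fst p * snd p + B))"
  by (intro continuous_intros) auto

lemma sech_sq_bounds: "\<bar>1 - (tanh (x::real))\<^sup>2\<bar> \<le> 1"
  using tanh_sq_le_1[of x] by simp

lemma incident_sum_le:
  fixes f :: "nat \<times> nat \<Rightarrow> real" and g :: "nat \<Rightarrow> real"
  assumes i: "i \<in> {1..N}" and g: "\<And>j. j \<in> {1..N} \<Longrightarrow> g j \<ge> 0"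
    and fg: "\<And>j. j \<in> {1..N} \<Longrightarrow> f (i, j) \<le> g j" "\<And>j. j \<in> {1..N} \<Longrightarrow> f (j, i) \<le> g j"
    and f0: "\<And>e. f e \<ge> 0"
  shows "(\<Sum>e\<in>{e \<in> vertex_pairs N. i = fst e \<or> i = snd e}. f e) \<le> 2 * (\<Sum>j\<in>{1..N}. g j)"
proof -
  have "(\<Sum>e\<in>{e \<in> vertex_pairs N. i = fst e \<or> i = snd e}. f e) \<le> (\<Sum>e\<in>(\<lambda>j. (i, j)) ` {1..N} \<union> (\<lambda>j. (j, i)) ` {1..N}. f e)"
    by (intro sum_mono2) (auto simp: vertex_pairs_def f0)
  also have "\<dots> \<le> (\<Sum>e\<in>(\<lambda>j. (i, j)) ` {1..N}. f e) + (\<Sum>e\<in>(\<lambda>j. (j, i)) ` {1..N}. f e)"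
    by (subst sum_Un) (auto simp: f0 sum_nonneg)
  also have "\<dots> = (\<Sum>j\<in>{1..N}. f (i, j)) + (\<Sum>j\<in>{1..N}. f (j, i))"
    by (subst (1 2) sum.reindex) (auto simp: inj_on_def)
  also have "\<dots> \<le> (\<Sum>j\<in>{1..N}. g j) + (\<Sum>j\<in>{1..N}. g j)"
    by (intro add_mono sum_mono fg)
  finally show ?thesis by simp
qed

text \<open>In this locale the couplings are \<open>a\<^sub>i = w\<^sub>i q\<close> with a common factor \<open>q\<close>, called \<open>scale\<close>, so the field at
  vertex \<open>i\<close> is \<open>w\<^sub>i \<eta> + B\<close> with \<open>\<eta> = q y\<close>. It is \<open>\<eta>\<close>, not the saddle point \<open>y\<close> itself, that has a
  limit.\<close>

locale regular_weights =
  fixes w :: "nat \<Rightarrow> nat \<Rightarrow> real" and \<Omega> :: "'a measure" and W :: "'a \<Rightarrow> real"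
  assumes w_pos: "\<And>N i. i \<in> {1..N} \<Longrightarrow> w N i > 0"
    and regular: "weight_regularity w \<Omega> W"
begin

definition mean1 :: real where "mean1 = integral\<^sup>L \<Omega> W"
definition mean2 :: real where "mean2 = integral\<^sup>L \<Omega> (\<lambda>x. (W x)\<^sup>2)"

lemma mean1_pos: "mean1 > 0"
  using regular by (simp add: mean1_def weight_regularity_def)

lemma average_limit:
  fixes F :: "real \<Rightarrow> real \<Rightarrow> real"
  assumes "continuous_on UNIV (\<lambda>p. F (fst p) (snd p))"
    and "\<And>x y. \<bar>F x y\<bar> \<le> C * (1 + x\<^sup>2)"
    and "ys \<longlonglongrightarrow> y"
  shows "(\<lambda>N. (\<Sum>i\<in>{1..N}. F (w N i) (ys N)) / real N) \<longlonglongrightarrow> (\<integral>\<omega>. F (W \<omega>) y \<partial>\<Omega>)"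
  by (rule empirical_average_limit[OF regular assms])

lemma average_weight: "(\<lambda>N. total_weight N (w N) / real N) \<longlonglongrightarrow> mean1"
  unfolding total_weight_def mean1_def
  by (rule average_limit[where F = "\<lambda>x y. x" and ys = "\<lambda>_. 0" and C = 1, OF _ abs_le_one_plus_square tendsto_const])
    (intro continuous_intros)

lemma average_weight_square: "(\<lambda>N. (\<Sum>i\<in>{1..N}. (w N i)\<^sup>2) / real N) \<longlonglongrightarrow> mean2"
  unfolding mean2_def
  by (rule average_limit[where F = "\<lambda>x y. x\<^sup>2" and ys = "\<lambda>_. 0" and C = 1, OF _ _ tendsto_const])
    (auto intro!: continuous_intros)

text \<open>The limiting form of \<open>0 \<le> (1/N) \<Sum> (w\<^sub>i - E W)\<^sup>2\<close>, which gives \<open>E W\<^sup>2 \<ge> (E W)\<^sup>2\<close>.\<close>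

lemma mean2_pos: "mean2 > 0"
proof -
  have "\<forall>\<^sub>F N in sequentially. 2 * mean1 * (total_weight N (w N) / real N) - mean1\<^sup>2 \<le> (\<Sum>i\<in>{1..N}. (w N i)\<^sup>2) / real N"
    using eventually_gt_at_top[of 0]
  proof eventually_elim
    case (elim N)
    have "(\<Sum>i\<in>{1..N}. 2 * mean1 * w N i - mean1\<^sup>2) \<le> (\<Sum>i\<in>{1..N}. (w N i)\<^sup>2)"
    proof (rule sum_mono)
      show "2 * mean1 * w N i - mean1\<^sup>2 \<le> (w N i)\<^sup>2" for i
        using sum_squares_bound[of mean1 "w N i"] by simp
    qed
    then have "(2 * mean1 * total_weight N (w N) - N * mean1\<^sup>2) / N \<le> (\<Sum>i\<in>{1..N}. (w N i)\<^sup>2) / N"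
      by (intro divide_right_mono) (simp_all add: sum_subtractf sum_distrib_left total_weight_def)
    then show ?case using elim by (simp add: diff_divide_distrib)
  qed
  moreover have "(\<lambda>N. 2 * mean1 * (total_weight N (w N) / real N) - mean1\<^sup>2) \<longlonglongrightarrow> 2 * mean1 * mean1 - mean1\<^sup>2"
    by (intro tendsto_intros average_weight)
  ultimately have "2 * mean1 * mean1 - mean1\<^sup>2 \<le> mean2"
    by (intro tendsto_le[OF _ average_weight_square]) auto
  moreover have "mean1\<^sup>2 > 0" using mean1_pos by simp
  ultimately show ?thesis by (simp add: power2_eq_square)
qed

lemma inverse_average_weight: "(\<lambda>N. real N / total_weight N (w N)) \<longlonglongrightarrow> 1 / mean1"
proof -
  have "(\<lambda>N. 1 / (total_weight N (w N) / real N)) \<longlonglongrightarrow> 1 / mean1"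
    using mean1_pos by (intro tendsto_intros average_weight) auto
  then show ?thesis by simp
qed

definition max_weight :: "nat \<Rightarrow> real" where
  "max_weight N = Max (w N ` {1..N})"

lemma le_max_weight: "i \<in> {1..N} \<Longrightarrow> w N i \<le> max_weight N"
  unfolding max_weight_def by (intro Max_ge) auto

lemma max_weight_pos: "N > 0 \<Longrightarrow> max_weight N > 0"
  using le_max_weight[of N N] w_pos[of N N] by force

text \<open>Uniform integrability of \<open>W\<^sub>N\<^sup>2\<close>: the square of the largest weight is at most
  \<open>k + \<Sum> max (w\<^sub>i\<^sup>2 - k) 0\<close>, and the average of the sum tends to \<open>E (max (W\<^sup>2 - k) 0)\<close>, which is
  small for large \<open>k\<close>.\<close>

lemma max_weight_negligible: "(\<lambda>N. (max_weight N)\<^sup>2 / real N) \<longlonglongrightarrow> 0"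
proof (rule tendstoI)
  fix e :: real assume e: "e > 0"
  interpret prob_space \<Omega> using regular by (simp add: weight_regularity_def)
  have [measurable]: "W \<in> borel_measurable \<Omega>" and W2: "integrable \<Omega> (\<lambda>x. (W x)\<^sup>2)"
    using regular by (auto simp: weight_regularity_def)
  have "(\<lambda>k. \<integral>x. max ((W x)\<^sup>2 - real k) 0 \<partial>\<Omega>) \<longlonglongrightarrow> (\<integral>x. 0 \<partial>\<Omega>)"
  proof (rule integral_dominated_convergence[OF _ _ W2])
    show "AE x in \<Omega>. (\<lambda>k. max ((W x)\<^sup>2 - real k) 0) \<longlonglongrightarrow> 0"
    proof (rule AE_I2)
      fix x
      obtain k0 where "(W x)\<^sup>2 \<le> real k0" using real_arch_simple by blast
      then have "max ((W x)\<^sup>2 - real k) 0 = 0" if "k \<ge> k0" for k using that by (auto simp: max_def)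
      then show "(\<lambda>k. max ((W x)\<^sup>2 - real k) 0) \<longlonglongrightarrow> 0"
        by (intro tendsto_eventually eventually_sequentiallyI[of k0])
    qed
  qed auto
  then have "\<forall>\<^sub>F k in sequentially. (\<integral>x. max ((W x)\<^sup>2 - real k) 0 \<partial>\<Omega>) < e / 2"
    using e by (intro order_tendstoD) auto
  then obtain k :: nat where k: "(\<integral>x. max ((W x)\<^sup>2 - real k) 0 \<partial>\<Omega>) < e / 2"
    by (auto simp: eventually_sequentially)
  have "(\<lambda>N. real k / real N + (\<Sum>i\<in>{1..N}. max ((w N i)\<^sup>2 - real k) 0) / real N) \<longlonglongrightarrow> 0 + (\<integral>x. max ((W x)\<^sup>2 - real k) 0 \<partial>\<Omega>)"
  proof (rule tendsto_add)
    show "(\<lambda>N. real k / real N) \<longlonglongrightarrow> 0" by (rule lim_const_over_n)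
    show "(\<lambda>N. (\<Sum>i\<in>{1..N}. max ((w N i)\<^sup>2 - real k) 0) / real N) \<longlonglongrightarrow> (\<integral>x. max ((W x)\<^sup>2 - real k) 0 \<partial>\<Omega>)"
      by (rule average_limit[where F = "\<lambda>x y. max (x\<^sup>2 - real k) 0" and ys = "\<lambda>_. 0" and C = 1, OF _ _ tendsto_const])
        (auto intro!: continuous_intros)
  qed
  then have "\<forall>\<^sub>F N in sequentially. real k / real N + (\<Sum>i\<in>{1..N}. max ((w N i)\<^sup>2 - real k) 0) / real N < e"
    by (rule order_tendstoD) (use k e in auto)
  then show "\<forall>\<^sub>F N in sequentially. dist ((max_weight N)\<^sup>2 / real N) 0 < e"
    using eventually_gt_at_top[of 0]
  proof eventually_elim
    case (elim N)
    have "max_weight N \<in> w N ` {1..N}" unfolding max_weight_def using elim(2) by (intro Max_in) auto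
    then obtain j where j: "j \<in> {1..N}" "max_weight N = w N j" by auto
    have "max ((w N j)\<^sup>2 - real k) 0 \<le> (\<Sum>i\<in>{1..N}. max ((w N i)\<^sup>2 - real k) 0)"
      by (rule member_le_sum[OF j(1)]) auto
    then have "(max_weight N)\<^sup>2 \<le> real k + (\<Sum>i\<in>{1..N}. max ((w N i)\<^sup>2 - real k) 0)"
      unfolding j(2) by linarith
    then have "(max_weight N)\<^sup>2 / N \<le> (real k + (\<Sum>i\<in>{1..N}. max ((w N i)\<^sup>2 - real k) 0)) / N"
      by (intro divide_right_mono) auto
    then show ?case using elim by (simp add: add_divide_distrib)
  qed
qed

definition scale :: "real \<Rightarrow> nat \<Rightarrow> real" where
  "scale \<beta> N = sqrt (sinh \<beta> / total_weight N (w N))"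

abbreviation defect :: "real \<Rightarrow> nat \<Rightarrow> nat \<times> nat \<Rightarrow> real" where
  "defect \<beta> N \<equiv> edge_defect N (w N) \<beta>"

abbreviation coupling :: "real \<Rightarrow> nat \<Rightarrow> nat \<Rightarrow> real" where
  "coupling \<beta> N \<equiv> cw_coupling N (w N) \<beta>"

lemma coupling_eq: "coupling \<beta> N i = w N i * scale \<beta> N"
  by (simp add: cw_coupling_def scale_def)

lemma total_weight_nonneg: "total_weight N (w N) \<ge> 0"
  unfolding total_weight_def using w_pos by (intro sum_nonneg) (auto intro: less_imp_le)

lemma scale_nonneg: "\<beta> \<ge> 0 \<Longrightarrow> scale \<beta> N \<ge> 0"
  using total_weight_nonneg by (simp add: scale_def)

lemma scale_square: "\<beta> \<ge> 0 \<Longrightarrow> (scale \<beta> N)\<^sup>2 = sinh \<beta> / total_weight N (w N)"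
  using total_weight_nonneg by (simp add: scale_def)

lemma coupling_nonneg: "\<beta> \<ge> 0 \<Longrightarrow> i \<in> {1..N} \<Longrightarrow> coupling \<beta> N i \<ge> 0"
  using w_pos[of i N] scale_nonneg by (simp add: coupling_eq)

lemma scale_square_limit:
  assumes "\<beta> \<ge> 0"
  shows "(\<lambda>N. (scale \<beta> N)\<^sup>2 * N) \<longlonglongrightarrow> sinh \<beta> / mean1"
proof -
  have "(\<lambda>N. sinh \<beta> * (N / total_weight N (w N))) \<longlonglongrightarrow> sinh \<beta> * (1 / mean1)"
    by (intro tendsto_intros inverse_average_weight)
  then show ?thesis using assms by (simp add: scale_square)
qed

lemma scale_limit:
  assumes "\<beta> \<ge> 0"
  shows "(\<lambda>N. scale \<beta> N * sqrt N) \<longlonglongrightarrow> sqrt (sinh \<beta> / mean1)"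
proof -
  have "scale \<beta> N * sqrt N = sqrt ((scale \<beta> N)\<^sup>2 * N)" for N
    using scale_nonneg[OF assms, of N] by (simp add: real_sqrt_mult)
  then show ?thesis using tendsto_real_sqrt[OF scale_square_limit[OF assms]] by simp
qed

text \<open>The limit of \<open>\<Sum> a\<^sub>i\<^sup>2\<close>. At zero field it is the slope at \<open>0\<close> of the map whose fixed points are the
  saddle points, so criticality is the value \<open>1\<close>.\<close>

definition coupling_strength :: "real \<Rightarrow> real" where
  "coupling_strength \<beta> = sinh \<beta> * mean2 / mean1"

lemma coupling_square_sum:
  "(\<Sum>i\<in>{1..N}. (coupling \<beta> N i)\<^sup>2) = (scale \<beta> N)\<^sup>2 * N * ((\<Sum>i\<in>{1..N}. (w N i)\<^sup>2) / N)"
  unfolding scaled_average by (simp add: coupling_eq power_mult_distrib mult.commute)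

lemma coupling_square_sum_limit:
  assumes "\<beta> \<ge> 0"
  shows "(\<lambda>N. \<Sum>i\<in>{1..N}. (coupling \<beta> N i)\<^sup>2) \<longlonglongrightarrow> coupling_strength \<beta>"
  using tendsto_mult[OF scale_square_limit[OF assms] average_weight_square]
  unfolding coupling_square_sum coupling_strength_def by simp

lemma curie_weiss_array_if_saddle:
  assumes \<beta>: "\<beta> \<ge> 0" and c: "c > 0"
    and crit: "\<And>N. y N = (\<Sum>i\<in>{1..N}. coupling \<beta> N i * tanh (coupling \<beta> N i * y N + B))"
    and quad: "\<forall>\<^sub>F N in sequentially. \<forall>u. mixture_density N (coupling \<beta> N) B (y N) u \<le> exp (- (c * u\<^sup>2))"
    and \<eta>: "(\<lambda>N. scale \<beta> N * y N) \<longlonglongrightarrow> \<eta>"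
  obtains \<theta> K P Q V \<delta> where "curie_weiss_array (coupling \<beta>) B y c \<theta> K P Q V \<delta>"
proof -
  obtain \<theta> where \<theta>: "\<And>N. (\<Sum>i\<in>{1..N}. (coupling \<beta> N i)\<^sup>2) \<le> \<theta>"
    using convergent_bound[OF coupling_square_sum_limit[OF \<beta>]] by blast
  have "(\<Sum>i\<in>{1..N}. coupling \<beta> N i) / sqrt N = scale \<beta> N * sqrt N * (total_weight N (w N) / N)" for N
  proof (cases "N = 0")
    case False
    have "(\<Sum>i\<in>{1..N}. coupling \<beta> N i) = total_weight N (w N) * scale \<beta> N"
      by (simp add: coupling_eq total_weight_def sum_distrib_right)
    moreover have "real N = sqrt N * sqrt N" by simp
    ultimately show ?thesis using False by (simp add: field_simps)
  qed simp
  then have "(\<lambda>N. (\<Sum>i\<in>{1..N}. coupling \<beta> N i) / sqrt N) \<longlonglongrightarrow> sqrt (sinh \<beta> / mean1) * mean1"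
    using tendsto_mult[OF scale_limit[OF \<beta>] average_weight] by simp
  then obtain K where K: "\<And>N. (\<Sum>i\<in>{1..N}. coupling \<beta> N i) / sqrt N \<le> K"
    using convergent_bound by blast
  define \<delta> where "\<delta> N = max_weight N * scale \<beta> N" for N
  have \<delta>_lim: "\<delta> \<longlonglongrightarrow> 0"
  proof -
    have "(\<lambda>N. scale \<beta> N * sqrt N * sqrt ((max_weight N)\<^sup>2 / N)) \<longlonglongrightarrow> sqrt (sinh \<beta> / mean1) * sqrt 0"
      by (intro tendsto_intros scale_limit[OF \<beta>] max_weight_negligible)
    then have "(\<lambda>N. scale \<beta> N * sqrt N * sqrt ((max_weight N)\<^sup>2 / N)) \<longlonglongrightarrow> 0" by simp
    then show ?thesis
    proof (rule Lim_transform_eventually)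
      show "\<forall>\<^sub>F N in sequentially. scale \<beta> N * sqrt N * sqrt ((max_weight N)\<^sup>2 / N) = \<delta> N"
        using eventually_gt_at_top[of 0]
      proof eventually_elim
        case (elim N)
        then show ?case using max_weight_pos[OF elim] by (simp add: \<delta>_def real_sqrt_divide)
      qed
    qed
  qed
  have arg: "coupling \<beta> N i * y N + B = w N i * (scale \<beta> N * y N) + B" for N i by (simp add: coupling_eq)
  define s where "s N i = 1 - (tanh (w N i * (scale \<beta> N * y N) + B))\<^sup>2" for N i
  have cont: "continuous_on UNIV (\<lambda>p :: real \<times> real. 1 - (tanh (fst p * snd p + B))\<^sup>2)"
    by (intro continuous_intros tanh_arg_continuous)
  have sb: "\<bar>1 - (tanh (x * z + B))\<^sup>2\<bar> \<le> 1 * (1 + x\<^sup>2)" for x z :: real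
    using sech_sq_bounds[of "x * z + B"] by (simp add: add_increasing2 order_trans[of _ 1])
  have sb1: "\<bar>x * (1 - (tanh (x * z + B))\<^sup>2)\<bar> \<le> 1 * (1 + x\<^sup>2)" for x z :: real
    using mult_mono[OF abs_le_one_plus_square sech_sq_bounds, of x "x * z + B"] by (simp add: abs_mult)
  have sb2: "\<bar>x\<^sup>2 * (1 - (tanh (x * z + B))\<^sup>2)\<bar> \<le> 1 * (1 + x\<^sup>2)" for x z :: real
    using mult_mono[OF _ sech_sq_bounds, of "x\<^sup>2" "1 + x\<^sup>2" "x * z + B"] by (simp add: abs_mult)
  have V: "(\<lambda>N. (\<Sum>i\<in>{1..N}. s N i) / N) \<longlonglongrightarrow> (\<integral>\<omega>. 1 - (tanh (W \<omega> * \<eta> + B))\<^sup>2 \<partial>\<Omega>)" (is "_ \<longlonglongrightarrow> ?V")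
    unfolding s_def by (rule average_limit[OF cont sb \<eta>])
  have S1: "(\<lambda>N. (\<Sum>i\<in>{1..N}. w N i * s N i) / N) \<longlonglongrightarrow> (\<integral>\<omega>. W \<omega> * (1 - (tanh (W \<omega> * \<eta> + B))\<^sup>2) \<partial>\<Omega>)" (is "_ \<longlonglongrightarrow> ?S1")
    unfolding s_def by (rule average_limit[OF _ sb1 \<eta>]) (intro continuous_intros cont)
  have S2: "(\<lambda>N. (\<Sum>i\<in>{1..N}. (w N i)\<^sup>2 * s N i) / N) \<longlonglongrightarrow> (\<integral>\<omega>. (W \<omega>)\<^sup>2 * (1 - (tanh (W \<omega> * \<eta> + B))\<^sup>2) \<partial>\<Omega>)" (is "_ \<longlonglongrightarrow> ?S2")
    unfolding s_def by (rule average_limit[OF _ sb2 \<eta>]) (intro continuous_intros cont)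
  have "curie_weiss_array (coupling \<beta>) B y c \<theta> K (sinh \<beta> / mean1 * ?S2) (sqrt (sinh \<beta> / mean1) * ?S1) ?V \<delta>"
  proof
    show "0 \<le> coupling \<beta> N i" if "i \<in> {1..N}" for N i by (rule coupling_nonneg[OF \<beta> that])
    show "coupling \<beta> N i \<le> \<delta> N" if "i \<in> {1..N}" for N i
      unfolding coupling_eq \<delta>_def by (intro mult_right_mono le_max_weight that scale_nonneg \<beta>)
    have "(\<Sum>i\<in>{1..N}. (coupling \<beta> N i)\<^sup>2 * s N i) = (scale \<beta> N)\<^sup>2 * N * ((\<Sum>i\<in>{1..N}. (w N i)\<^sup>2 * s N i) / N)" for N
      unfolding scaled_average by (simp add: coupling_eq power_mult_distrib mult_ac)
    then show "(\<lambda>N. \<Sum>i\<in>{1..N}. (coupling \<beta> N i)\<^sup>2 * (1 - (tanh (coupling \<beta> N i * y N + B))\<^sup>2)) \<longlonglongrightarrow> sinh \<beta> / mean1 * ?S2"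
      unfolding arg s_def[symmetric] using tendsto_mult[OF scale_square_limit[OF \<beta>] S2] by simp
    have "(\<Sum>i\<in>{1..N}. coupling \<beta> N i * s N i) / sqrt N = scale \<beta> N * sqrt N * ((\<Sum>i\<in>{1..N}. w N i * s N i) / N)" for N
    proof (cases "N = 0")
      case False
      have "(\<Sum>i\<in>{1..N}. coupling \<beta> N i * s N i) = scale \<beta> N * (\<Sum>i\<in>{1..N}. w N i * s N i)"
        by (simp add: coupling_eq sum_distrib_left mult_ac)
      moreover have "real N = sqrt N * sqrt N" by simp
      ultimately show ?thesis using False by (simp add: field_simps)
    qed simp
    then show "(\<lambda>N. (\<Sum>i\<in>{1..N}. coupling \<beta> N i * (1 - (tanh (coupling \<beta> N i * y N + B))\<^sup>2)) / sqrt N) \<longlonglongrightarrow> sqrt (sinh \<beta> / mean1) * ?S1"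
      unfolding arg s_def[symmetric] using tendsto_mult[OF scale_limit[OF \<beta>] S1] by simp
    show "(\<lambda>N. (\<Sum>i\<in>{1..N}. 1 - (tanh (coupling \<beta> N i * y N + B))\<^sup>2) / N) \<longlonglongrightarrow> ?V"
      unfolding arg s_def[symmetric] by (rule V)
  qed (fact c crit quad \<delta>_lim \<theta> K)+
  then show ?thesis by (rule that)
qed

text \<open>The defect of a pair is at most a multiple of \<open>(w\<^sub>i\<^sup>2 / \<ell>\<^sub>N) (w\<^sub>j\<^sup>2 / \<ell>\<^sub>N)\<close>, and \<open>\<Sum> w\<^sub>i\<^sup>2 / \<ell>\<^sub>N\<close> converges. The sum
  over the pairs at one vertex gains the factor \<open>max w\<^sub>i\<^sup>2 / \<ell>\<^sub>N\<close>, which vanishes.\<close>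

lemma edge_defect_bounds:
  assumes \<beta>: "\<beta> \<ge> 0"
  obtains R \<gamma> where "\<And>N. (\<Sum>e\<in>vertex_pairs N. \<bar>defect \<beta> N e\<bar>) \<le> R"
    and "\<And>N i. i \<in> {1..N} \<Longrightarrow> (\<Sum>e\<in>{e \<in> vertex_pairs N. i = fst e \<or> i = snd e}. \<bar>defect \<beta> N e\<bar>) \<le> \<gamma> N"
    and "\<gamma> \<longlonglongrightarrow> 0"
proof -
  define l where "l N = total_weight N (w N)" for N
  define A where "A N = (\<Sum>i\<in>{1..N}. (w N i)\<^sup>2) / l N" for N
  define C where "C = exp (2 * \<beta>)"
  let ?v = "\<lambda>N i. (w N i)\<^sup>2 / l N"
  have C: "C > 0" by (simp add: C_def)
  have l0: "l N \<ge> 0" for N using total_weight_nonneg by (simp add: l_def)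
  have A0: "A N \<ge> 0" for N using l0 by (simp add: A_def sum_nonneg)
  have d: "\<bar>defect \<beta> N (i, j)\<bar> \<le> C * (?v N i * ?v N j)"
    if "i \<in> {1..N}" "j \<in> {1..N}" for N i j
  proof -
    have "w N i * w N j / l N \<ge> 0" using w_pos[OF that(1)] w_pos[OF that(2)] l0 by simp
    from abs_coupling_defect_le[OF \<beta> this] show ?thesis
      unfolding edge_defect_def C_def l_def by (simp add: power_mult_distrib power_divide power2_eq_square mult_ac)
  qed
  have Alim: "A \<longlonglongrightarrow> mean2 / mean1"
  proof -
    have "(\<lambda>N. ((\<Sum>i\<in>{1..N}. (w N i)\<^sup>2) / N) * (N / l N)) \<longlonglongrightarrow> mean2 * (1 / mean1)"
      unfolding l_def by (intro tendsto_mult average_weight_square inverse_average_weight)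
    moreover have "((\<Sum>i\<in>{1..N}. (w N i)\<^sup>2) / N) * (N / l N) = A N" for N
      by (cases "N = 0") (simp_all add: A_def)
    ultimately show ?thesis by simp
  qed
  have "(\<lambda>N. C * (A N * A N)) \<longlonglongrightarrow> C * (mean2 / mean1 * (mean2 / mean1))"
    by (intro tendsto_intros Alim)
  then obtain R where R: "\<And>N. C * (A N * A N) \<le> R" using convergent_bound by blast
  define \<gamma> where "\<gamma> N = 2 * (C * ((max_weight N)\<^sup>2 / l N * A N))" for N
  show ?thesis
  proof (rule that)
    fix N
    have "(\<Sum>e\<in>vertex_pairs N. \<bar>defect \<beta> N e\<bar>) \<le> (\<Sum>(i, j)\<in>vertex_pairs N. C * (?v N i * ?v N j))"
      by (intro sum_mono) (use d in \<open>auto simp: vertex_pairs_def\<close>)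
    also have "\<dots> \<le> (\<Sum>(i, j)\<in>{1..N} \<times> {1..N}. C * (?v N i * ?v N j))"
      using C l0 by (intro sum_mono2) (auto simp: vertex_pairs_def)
    also have "\<dots> = C * (A N * A N)"
      unfolding A_def sum_divide_distrib by (simp only: sum_product) (simp add: sum_distrib_left sum.cartesian_product split_beta)
    finally show "(\<Sum>e\<in>vertex_pairs N. \<bar>defect \<beta> N e\<bar>) \<le> R" using R[of N] by linarith
  next
    fix N i :: nat assume i: "i \<in> {1..N}"
    have m: "(w N i)\<^sup>2 \<le> (max_weight N)\<^sup>2"
      using w_pos[OF i] le_max_weight[OF i] by (intro power_mono) auto
    have g: "\<bar>defect \<beta> N (i, j)\<bar> \<le> C * ((max_weight N)\<^sup>2 / l N * ?v N j)"
      "\<bar>defect \<beta> N (j, i)\<bar> \<le> C * ((max_weight N)\<^sup>2 / l N * ?v N j)" if j: "j \<in> {1..N}" for j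
    proof -
      have "C * (?v N i * ?v N j) \<le> C * ((max_weight N)\<^sup>2 / l N * ?v N j)"
        using C l0 m by (intro mult_left_mono mult_right_mono divide_right_mono) auto
      then show "\<bar>defect \<beta> N (i, j)\<bar> \<le> C * ((max_weight N)\<^sup>2 / l N * ?v N j)"
        "\<bar>defect \<beta> N (j, i)\<bar> \<le> C * ((max_weight N)\<^sup>2 / l N * ?v N j)"
        using d[OF i j] d[OF j i] by (simp_all add: mult.commute)
    qed
    have "(\<Sum>e\<in>{e \<in> vertex_pairs N. i = fst e \<or> i = snd e}. \<bar>defect \<beta> N e\<bar>)
      \<le> 2 * (\<Sum>j\<in>{1..N}. C * ((max_weight N)\<^sup>2 / l N * ?v N j))"
      by (intro incident_sum_le[OF i] g) (use C l0 in auto)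
    also have "\<dots> = \<gamma> N" unfolding \<gamma>_def A_def by (simp only: sum_distrib_left sum_divide_distrib)
    finally show "(\<Sum>e\<in>{e \<in> vertex_pairs N. i = fst e \<or> i = snd e}. \<bar>defect \<beta> N e\<bar>) \<le> \<gamma> N" .
  next
    have "(\<lambda>N. 2 * (C * (((max_weight N)\<^sup>2 / N) * (N / l N) * A N))) \<longlonglongrightarrow> 2 * (C * (0 * (1 / mean1) * (mean2 / mean1)))"
      unfolding l_def by (intro tendsto_intros max_weight_negligible inverse_average_weight Alim)
    moreover have "2 * (C * (((max_weight N)\<^sup>2 / N) * (N / l N) * A N)) = \<gamma> N" for N
      by (cases "N = 0") (simp_all add: \<gamma>_def A_def)
    ultimately show "\<gamma> \<longlonglongrightarrow> 0" by simp
  qed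
qed

abbreviation spin_mean :: "real \<Rightarrow> real \<Rightarrow> (nat \<Rightarrow> real) \<Rightarrow> nat \<Rightarrow> nat \<Rightarrow> real" where
  "spin_mean \<beta> B y N i \<equiv> tanh (w N i * (scale \<beta> N * y N) + B)"

text \<open>A sequence of critical points of the potentials with a uniform quadratic bound and convergent
  rescaling.\<close>

definition saddle :: "real \<Rightarrow> real \<Rightarrow> (nat \<Rightarrow> real) \<Rightarrow> real \<Rightarrow> real \<Rightarrow> bool" where
  "saddle \<beta> B y \<eta> c \<longleftrightarrow> c > 0 \<and>
     (\<forall>N. y N = (\<Sum>i\<in>{1..N}. coupling \<beta> N i * tanh (coupling \<beta> N i * y N + B))) \<and>
     (\<forall>\<^sub>F N in sequentially. \<forall>u. mixture_density N (coupling \<beta> N) B (y N) u \<le> exp (- (c * u\<^sup>2))) \<and>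
     (\<lambda>N. scale \<beta> N * y N) \<longlonglongrightarrow> \<eta>"

lemma saddle_zero_field:
  assumes \<beta>: "\<beta> \<ge> 0" and sub: "coupling_strength \<beta> < 1"
  shows "saddle \<beta> 0 (\<lambda>N. 0) 0 ((1 - coupling_strength \<beta>) / 4)"
proof -
  define \<theta> where "\<theta> = (1 + coupling_strength \<beta>) / 2"
  have "\<forall>\<^sub>F N in sequentially. (\<Sum>i\<in>{1..N}. (coupling \<beta> N i)\<^sup>2) < \<theta>"
    by (rule order_tendstoD(2)[OF coupling_square_sum_limit[OF \<beta>]]) (use sub in \<open>simp add: \<theta>_def\<close>)
  then have "\<forall>\<^sub>F N in sequentially. \<forall>u. mixture_density N (coupling \<beta> N) 0 0 u \<le> exp (- ((1 - coupling_strength \<beta>) / 4 * u\<^sup>2))"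
  proof eventually_elim
    case (elim N)
    have "(1 - \<theta>) / 2 = (1 - coupling_strength \<beta>) / 4" by (simp add: \<theta>_def field_simps)
    then show ?case unfolding mixture_density_def
      unfolding \<open>(1 - \<theta>) / 2 = _\<close>[symmetric] using cw_potential_quadratic_bound_zero_field[where I = "{1..N}" and a = "coupling \<beta> N" and \<theta> = \<theta>] elim by simp
  qed
  then show ?thesis using sub by (simp add: saddle_def)
qed

lemma saddle_minus:
  assumes "saddle \<beta> (- B) y \<eta> c"
  shows "saddle \<beta> B (\<lambda>N. - y N) (- \<eta>) c"
proof -
  have y: "\<And>N. y N = (\<Sum>i\<in>{1..N}. coupling \<beta> N i * tanh (coupling \<beta> N i * y N + - B))" and c: "c > 0"
    and q: "\<forall>\<^sub>F N in sequentially. \<forall>u. mixture_density N (coupling \<beta> N) (- B) (y N) u \<le> exp (- (c * u\<^sup>2))"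
    and l: "(\<lambda>N. scale \<beta> N * y N) \<longlonglongrightarrow> \<eta>"
    using assms by (auto simp: saddle_def)
  have "- y N = (\<Sum>i\<in>{1..N}. coupling \<beta> N i * tanh (coupling \<beta> N i * (- y N) + B))" for N
  proof -
    have "tanh (coupling \<beta> N i * (- y N) + B) = - tanh (coupling \<beta> N i * y N + - B)" for i
      unfolding tanh_minus[symmetric] by simp
    then show ?thesis by (subst y) (simp add: sum_negf)
  qed
  moreover have "\<forall>\<^sub>F N in sequentially. \<forall>u. mixture_density N (coupling \<beta> N) B (- y N) u \<le> exp (- (c * u\<^sup>2))"
    using q
  proof eventually_elim
    case (elim N)
    have "mixture_density N (coupling \<beta> N) B (- y N) u = mixture_density N (coupling \<beta> N) (- B) (y N) (- u)" for u
      using cw_potential_minus[of "{1..N}" "coupling \<beta> N" "- B" "y N - u"] cw_potential_minus[of "{1..N}" "coupling \<beta> N" "- B" "y N"]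
      by (simp add: mixture_density_def)
    then show ?case using elim by (metis power2_minus)
  qed
  moreover have "(\<lambda>N. scale \<beta> N * (- y N)) \<longlonglongrightarrow> - \<eta>" using tendsto_minus[OF l] by simp
  ultimately show ?thesis using c unfolding saddle_def by blast
qed

text \<open>The map \<open>\<eta> \<mapsto> q \<Sum> a\<^sub>i tanh (w\<^sub>i \<eta> + B)\<close>, whose fixed point on the positive half-line is the rescaled
  saddle point; \<open>q\<^sup>2 = sinh \<beta> / \<ell>\<^sub>N\<close>.\<close>

definition field_map :: "real \<Rightarrow> real \<Rightarrow> nat \<Rightarrow> real \<Rightarrow> real" where
  "field_map \<beta> B N x = (\<Sum>i\<in>{1..N}. sinh \<beta> / total_weight N (w N) * w N i * tanh (w N i * x + B))"

lemma field_map_limit: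
  assumes "\<beta> \<ge> 0"
  shows "(\<lambda>N. field_map \<beta> B N x) \<longlonglongrightarrow> sinh \<beta> / mean1 * (\<integral>\<omega>. W \<omega> * tanh (W \<omega> * x + B) \<partial>\<Omega>)"
proof -
  have b: "\<bar>u * tanh (u * z + B)\<bar> \<le> 1 * (1 + u\<^sup>2)" for u z :: real
    using mult_mono[OF abs_le_one_plus_square abs_tanh_le_1, of u "u * z + B"] by (simp add: abs_mult)
  have "(\<lambda>N. (\<Sum>i\<in>{1..N}. w N i * tanh (w N i * x + B)) / N) \<longlonglongrightarrow> (\<integral>\<omega>. W \<omega> * tanh (W \<omega> * x + B) \<partial>\<Omega>)"
    by (rule average_limit[where F = "\<lambda>u z. u * tanh (u * z + B)", OF _ b tendsto_const]) (intro continuous_intros tanh_arg_continuous)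
  from tendsto_mult[OF scale_square_limit[OF assms] this]
  have "(\<lambda>N. (scale \<beta> N)\<^sup>2 * N * ((\<Sum>i\<in>{1..N}. w N i * tanh (w N i * x + B)) / N)) \<longlonglongrightarrow> sinh \<beta> / mean1 * (\<integral>\<omega>. W \<omega> * tanh (W \<omega> * x + B) \<partial>\<Omega>)" .
  moreover have "(scale \<beta> N)\<^sup>2 * N * ((\<Sum>i\<in>{1..N}. w N i * tanh (w N i * x + B)) / N) = field_map \<beta> B N x" for N
    unfolding scaled_average by (simp add: field_map_def scale_square[OF assms] mult_ac)
  ultimately show ?thesis by simp
qed

lemma limit_fixed_point_exists:
  assumes \<beta>: "\<beta> \<ge> 0" and B: "B > 0"
  obtains \<eta> where "\<eta> \<ge> 0" "\<eta> = sinh \<beta> / mean1 * (\<integral>\<omega>. W \<omega> * tanh (W \<omega> * \<eta> + B) \<partial>\<Omega>)"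
proof -
  interpret prob_space \<Omega> using regular by (simp add: weight_regularity_def)
  have [measurable]: "W \<in> borel_measurable \<Omega>" and W1: "integrable \<Omega> W"
    using regular by (auto simp: weight_regularity_def)
  define \<Phi> where "\<Phi> x = sinh \<beta> / mean1 * (\<integral>\<omega>. W \<omega> * tanh (W \<omega> * x + B) \<partial>\<Omega>)" for x
  have dom: "\<bar>W \<omega> * tanh (W \<omega> * x + B)\<bar> \<le> \<bar>W \<omega>\<bar>" for \<omega> x
    using abs_tanh_le_1 by (simp add: abs_mult mult_left_le)
  have tm: "(\<lambda>\<omega>. W \<omega> * tanh (W \<omega> * x + B)) \<in> borel_measurable \<Omega>" for x
  proof -
    have "tanh \<in> borel_measurable (borel :: real measure)"
      by (intro borel_measurable_continuous_onI continuous_intros) auto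
    then show ?thesis by measurable
  qed
  have cont: "isCont \<Phi> x" for x
    unfolding \<Phi>_def continuous_at_sequentially o_def
  proof (intro allI impI tendsto_intros)
    fix xs assume xs: "xs \<longlonglongrightarrow> x"
    show "(\<lambda>n. \<integral>\<omega>. W \<omega> * tanh (W \<omega> * xs n + B) \<partial>\<Omega>) \<longlonglongrightarrow> (\<integral>\<omega>. W \<omega> * tanh (W \<omega> * x + B) \<partial>\<Omega>)"
    proof (rule integral_dominated_convergence)
      show "integrable \<Omega> (\<lambda>\<omega>. \<bar>W \<omega>\<bar>)" using W1 by simp
      show "AE \<omega> in \<Omega>. (\<lambda>n. W \<omega> * tanh (W \<omega> * xs n + B)) \<longlonglongrightarrow> W \<omega> * tanh (W \<omega> * x + B)"
        by (intro AE_I2 tendsto_intros xs) auto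
    qed (use dom tm in auto)
  qed
  define M where "M = sinh \<beta> / mean1 * (\<integral>\<omega>. \<bar>W \<omega>\<bar> \<partial>\<Omega>)"
  have s: "sinh \<beta> / mean1 \<ge> 0" using \<beta> mean1_pos by simp
  have "\<exists>x. 0 \<le> x \<and> x \<le> M \<and> \<Phi> x - x = 0"
  proof (rule IVT2)
    show "0 \<le> M" unfolding M_def using s by (intro mult_nonneg_nonneg integral_nonneg_AE) auto
    have "\<Phi> M \<le> M" unfolding \<Phi>_def M_def
    proof (rule mult_left_mono[OF _ s], rule integral_mono)
      show "integrable \<Omega> (\<lambda>\<omega>. W \<omega> * tanh (W \<omega> * x + B))" for x
        by (rule Bochner_Integration.integrable_bound[OF W1 tm]) (use dom in auto)
      show "W \<omega> * tanh (W \<omega> * x + B) \<le> \<bar>W \<omega>\<bar>" for \<omega> x using dom[of \<omega> x] by linarith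
    qed (use W1 in auto)
    then show "\<Phi> M - M \<le> 0" by simp
    have "\<Phi> 0 = sinh \<beta> * tanh B" unfolding \<Phi>_def using mean1_pos by (simp add: mean1_def)
    then show "0 \<le> \<Phi> 0 - 0" using \<beta> B by simp
    show "\<forall>x. 0 \<le> x \<and> x \<le> M \<longrightarrow> isCont (\<lambda>x. \<Phi> x - x) x"
      using cont by (auto intro!: continuous_intros)
  qed
  then show ?thesis using that unfolding \<Phi>_def by force
qed

text \<open>Strong monotonicity at a fixed point \<open>\<eta>\<close> of the limiting map bounds the distance from the rescaled
  saddle point to \<open>\<eta>\<close> by \<open>\<bar>\<Phi>\<^sub>N \<eta> - \<eta>\<bar> / tanh B\<close>, where \<open>\<Phi>\<^sub>N\<close> is the map at size \<open>N\<close>; this tends to \<open>0\<close>.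
  The inequality itself is passed on for the analysis of the critical temperature.\<close>

lemma saddle_positive_field:
  assumes \<beta>: "\<beta> \<ge> 0" and B: "B > 0"
  obtains y \<eta> c where "saddle \<beta> B y \<eta> c"
    "\<And>N x. x \<ge> 0 \<Longrightarrow> (scale \<beta> N * y N - x) * (field_map \<beta> B N x - x) \<ge> tanh B * (scale \<beta> N * y N - x)\<^sup>2"
proof -
  have "\<exists>y\<ge>0. y = (\<Sum>i\<in>{1..N}. coupling \<beta> N i * tanh (coupling \<beta> N i * y + B))" for N
    by (rule fixed_point_exists[of "{1..N}" "coupling \<beta> N" "coupling \<beta> N" B]) (use coupling_nonneg[OF \<beta>] B in auto)
  then obtain y where y0: "\<And>N. y N \<ge> 0"
    and crit: "\<And>N. y N = (\<Sum>i\<in>{1..N}. coupling \<beta> N i * tanh (coupling \<beta> N i * y N + B))"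
    by metis
  obtain \<theta> where \<theta>: "\<And>N. (\<Sum>i\<in>{1..N}. (coupling \<beta> N i)\<^sup>2) \<le> \<theta>"
    using convergent_bound[OF coupling_square_sum_limit[OF \<beta>]] by blast
  have \<theta>0: "\<theta> \<ge> 0" using \<theta>[of 0] by simp
  define c where "c = tanh B / (50 * (2 + \<theta>))"
  have c: "c > 0" using B \<theta>0 by (simp add: c_def)
  have quad: "mixture_density N (coupling \<beta> N) B (y N) u \<le> exp (- (c * u\<^sup>2))" for N u
    using cw_potential_quadratic_bound[of "{1..N}" "coupling \<beta> N" B "y N" \<theta> "y N + u"] coupling_nonneg[OF \<beta>] B crit y0 \<theta>
    unfolding mixture_density_def c_def by simp
  have mono: "(scale \<beta> N * y N - x) * (field_map \<beta> B N x - x) \<ge> tanh B * (scale \<beta> N * y N - x)\<^sup>2" if x: "x \<ge> 0" for N x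
    unfolding field_map_def
  proof (rule fixed_point_strong_monotone)
    have "scale \<beta> N * y N = (\<Sum>i\<in>{1..N}. (scale \<beta> N)\<^sup>2 * w N i * tanh (w N i * (scale \<beta> N * y N) + B))"
      by (subst crit) (simp add: sum_distrib_left coupling_eq power2_eq_square mult_ac)
    then show "scale \<beta> N * y N = (\<Sum>i\<in>{1..N}. sinh \<beta> / total_weight N (w N) * w N i * tanh (w N i * (scale \<beta> N * y N) + B))"
      unfolding scale_square[OF \<beta>] .
  qed (use w_pos \<beta> B x total_weight_nonneg scale_nonneg[OF \<beta>] y0 in \<open>auto intro!: divide_nonneg_nonneg mult_nonneg_nonneg intro: less_imp_le\<close>)
  obtain \<eta> where \<eta>0: "\<eta> \<ge> 0" and \<eta>: "\<eta> = sinh \<beta> / mean1 * (\<integral>\<omega>. W \<omega> * tanh (W \<omega> * \<eta> + B) \<partial>\<Omega>)"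
    by (rule limit_fixed_point_exists[OF \<beta> B])
  have lim: "(\<lambda>N. scale \<beta> N * y N) \<longlonglongrightarrow> \<eta>"
  proof -
    have bound: "norm (scale \<beta> N * y N - \<eta>) \<le> \<bar>field_map \<beta> B N \<eta> - \<eta>\<bar> / tanh B" for N
    proof (cases "scale \<beta> N * y N = \<eta>")
      case False
      define d where "d = scale \<beta> N * y N - \<eta>"
      have "tanh B * d\<^sup>2 \<le> d * (field_map \<beta> B N \<eta> - \<eta>)" using mono[OF \<eta>0] by (simp add: d_def)
      also have "\<dots> \<le> \<bar>d\<bar> * \<bar>field_map \<beta> B N \<eta> - \<eta>\<bar>" by (metis abs_ge_self abs_mult)
      finally have "\<bar>d\<bar> * (tanh B * \<bar>d\<bar>) \<le> \<bar>d\<bar> * \<bar>field_map \<beta> B N \<eta> - \<eta>\<bar>"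
        by (simp add: power2_eq_square mult_ac)
      then have "tanh B * \<bar>d\<bar> \<le> \<bar>field_map \<beta> B N \<eta> - \<eta>\<bar>" by (rule mult_left_le_imp_le) (use False in \<open>simp add: d_def\<close>)
      then show ?thesis using B by (simp add: d_def field_simps)
    qed (use B in simp)
    have "(\<lambda>N. field_map \<beta> B N \<eta>) \<longlonglongrightarrow> \<eta>" using field_map_limit[OF \<beta>, of B \<eta>] \<eta> by simp
    then have "(\<lambda>N. \<bar>field_map \<beta> B N \<eta> - \<eta>\<bar> / tanh B) \<longlonglongrightarrow> \<bar>\<eta> - \<eta>\<bar> / tanh B" using B by (intro tendsto_intros) auto
    then have "(\<lambda>N. \<bar>field_map \<beta> B N \<eta> - \<eta>\<bar> / tanh B) \<longlonglongrightarrow> 0" by simp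
    then have "(\<lambda>N. scale \<beta> N * y N - \<eta>) \<longlonglongrightarrow> 0"
      by (rule Lim_null_comparison[OF always_eventually[OF allI[OF bound]]])
    then show ?thesis by (simp add: LIM_zero_iff)
  qed
  have "saddle \<beta> B y \<eta> c" unfolding saddle_def using c crit quad lim by auto
  then show ?thesis using mono by (rule that)
qed

end

section \<open>Moments of the total spin\<close>

lemma boltzmann_field: "boltzmann N E \<beta> b \<sigma> = exp (b * total_spin N \<sigma>) * boltzmann N E \<beta> 0 \<sigma>"
  by (simp add: boltzmann_def exp_add[symmetric] add.commute)

lemma annealed_weight_field: "annealed_weight N v \<beta> b \<sigma> = exp (b * total_spin N \<sigma>) * annealed_weight N v \<beta> 0 \<sigma>"
  unfolding annealed_weight_def by (subst boltzmann_field) simp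

lemma annealed_weight_pos:
  assumes v: "\<forall>i\<in>{1..N}. v i > 0"
  shows "annealed_weight N v \<beta> B \<sigma> > 0"
proof -
  have v': "\<And>i. i \<in> {1..N} \<Longrightarrow> v i > 0" using v by blast
  have "1 - p + p * exp x > 0" if "p \<in> {0..1}" for p x :: real
    using that by (cases "p = 0") (auto intro: add_nonneg_pos)
  then have "0 < (\<Prod>(i, j)\<in>vertex_pairs N. 1 - edge_prob N v i j + edge_prob N v i j * exp (\<beta> * (\<sigma> i * \<sigma> j)))"
    using edge_prob_bounds[of N v] v' by (intro prod_pos) auto
  then show ?thesis by (subst annealed_weight_product) (use v in auto)
qed

definition annealed_prob :: "nat \<Rightarrow> (nat \<Rightarrow> real) \<Rightarrow> real \<Rightarrow> real \<Rightarrow> (nat \<Rightarrow> real) \<Rightarrow> real" where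
  "annealed_prob N v \<beta> B \<sigma> = annealed_weight N v \<beta> B \<sigma> / (\<Sum>\<tau>\<in>spin_configs N. annealed_weight N v \<beta> B \<tau>)"

lemma sum_annealed_weight_pos:
  assumes "\<forall>i\<in>{1..N}. v i > 0"
  shows "(\<Sum>\<sigma>\<in>spin_configs N. annealed_weight N v \<beta> B \<sigma>) > 0"
  using annealed_weight_pos[OF assms] by (intro sum_pos spin_configs_nonempty) auto

lemma annealed_prob_nonneg: "annealed_prob N v \<beta> B \<sigma> \<ge> 0"
  by (simp add: annealed_prob_def annealed_weight_nonneg sum_nonneg)

lemma sum_annealed_prob:
  assumes "\<forall>i\<in>{1..N}. v i > 0"
  shows "(\<Sum>\<sigma>\<in>spin_configs N. annealed_prob N v \<beta> B \<sigma>) = 1"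
  using sum_annealed_weight_pos[OF assms, of \<beta> B] by (simp add: annealed_prob_def sum_divide_distrib[symmetric])

lemma annealed_measure_eq:
  "annealed_measure N v \<beta> B = point_measure (spin_configs N) (\<lambda>\<sigma>. ennreal (annealed_prob N v \<beta> B \<sigma>))"
proof -
  have "measure_pmf.expectation (grg N v) (\<lambda>E. partition_function N E \<beta> B)
      = (\<Sum>\<sigma>\<in>spin_configs N. annealed_weight N v \<beta> B \<sigma>)"
    unfolding partition_function_def annealed_weight_def
    by (rule Bochner_Integration.integral_sum) (auto intro!: integrable_measure_pmf_finite finite_set_pmf_grg)
  then show ?thesis unfolding annealed_measure_def annealed_prob_def annealed_weight_def[symmetric] by simp
qed

lemma annealed_integral:
  fixes F :: "(nat \<Rightarrow> real) \<Rightarrow> 'b :: {banach, second_countable_topology}"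
  shows "(\<integral>\<sigma>. F \<sigma> \<partial>annealed_measure N v \<beta> B) = (\<Sum>\<sigma>\<in>spin_configs N. annealed_prob N v \<beta> B \<sigma> *\<^sub>R F \<sigma>)"
  unfolding annealed_measure_eq by (simp add: lebesgue_integral_point_measure_finite annealed_prob_nonneg)

lemma prob_space_annealed_measure:
  assumes "\<forall>i\<in>{1..N}. v i > 0"
  shows "prob_space (annealed_measure N v \<beta> B)"
proof
  show "emeasure (annealed_measure N v \<beta> B) (space (annealed_measure N v \<beta> B)) = 1"
    unfolding annealed_measure_eq space_point_measure
    by (subst emeasure_point_measure_finite) (auto simp: sum_ennreal annealed_prob_nonneg sum_annealed_prob[OF assms])
qed

text \<open>The field enters the annealed weight only through the factor \<open>exp (b S\<^sub>N)\<close>, so this is the usual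
  fluctuation formula.\<close>

lemma magnetization_has_derivative_variance:
  fixes F :: "(nat \<Rightarrow> real) \<Rightarrow> real"
  assumes v: "\<forall>i\<in>{1..N}. v i > 0"
  shows "((\<lambda>b. magnetization N v \<beta> b) has_real_derivative
     ((\<Sum>\<sigma>\<in>spin_configs N. annealed_prob N v \<beta> B \<sigma> * (total_spin N \<sigma>)\<^sup>2)
       - (\<Sum>\<sigma>\<in>spin_configs N. annealed_prob N v \<beta> B \<sigma> * total_spin N \<sigma>)\<^sup>2) / real N) (at B)"
proof -
  define S where "S = total_spin N"
  define q where "q \<sigma> = annealed_weight N v \<beta> 0 \<sigma>" for \<sigma>
  define Z where "Z b = (\<Sum>\<sigma>\<in>spin_configs N. exp (b * S \<sigma>) * q \<sigma>)" for b
  define Z1 where "Z1 b = (\<Sum>\<sigma>\<in>spin_configs N. S \<sigma> * (exp (b * S \<sigma>) * q \<sigma>))" for b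
  define Z2 where "Z2 b = (\<Sum>\<sigma>\<in>spin_configs N. (S \<sigma>)\<^sup>2 * (exp (b * S \<sigma>) * q \<sigma>))" for b
  have aw: "annealed_weight N v \<beta> b \<sigma> = exp (b * S \<sigma>) * q \<sigma>" for b \<sigma>
    unfolding S_def q_def by (rule annealed_weight_field)
  have Zpos: "Z b > 0" for b
    using sum_annealed_weight_pos[OF v, of \<beta> b] unfolding aw Z_def by simp
  have prob: "annealed_prob N v \<beta> b \<sigma> = exp (b * S \<sigma>) * q \<sigma> / Z b" for b \<sigma>
    by (simp add: annealed_prob_def aw Z_def)
  have m: "magnetization N v \<beta> b = Z1 b / Z b / N" for b
    unfolding magnetization_def annealed_integral prob Z1_def S_def[symmetric]
    by (simp add: sum_divide_distrib mult_ac)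
  have dZ: "(Z has_real_derivative Z1 B) (at B)"
    unfolding Z_def[abs_def] Z1_def by (auto intro!: derivative_eq_intros sum.cong simp: mult_ac)
  have dZ1: "(Z1 has_real_derivative Z2 B) (at B)"
    unfolding Z1_def[abs_def] Z2_def by (auto intro!: derivative_eq_intros sum.cong simp: mult_ac power2_eq_square)
  have "((\<lambda>b. Z1 b / Z b / N) has_real_derivative ((Z2 B * Z B - Z1 B * Z1 B) / (Z B * Z B)) / N) (at B)"
    by (intro DERIV_cdivide DERIV_divide dZ dZ1) (use Zpos[of B] in simp)
  moreover have "(\<Sum>\<sigma>\<in>spin_configs N. annealed_prob N v \<beta> B \<sigma> * (total_spin N \<sigma>)\<^sup>2) = Z2 B / Z B"
    "(\<Sum>\<sigma>\<in>spin_configs N. annealed_prob N v \<beta> B \<sigma> * total_spin N \<sigma>) = Z1 B / Z B"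
    unfolding prob Z2_def Z1_def S_def[symmetric] by (simp_all add: sum_divide_distrib mult_ac)
  moreover have "(Z2 B * Z B - Z1 B * Z1 B) / (Z B * Z B) = Z2 B / Z B - (Z1 B / Z B)\<^sup>2"
    using Zpos[of B] by (simp add: diff_divide_distrib power2_eq_square)
  ultimately show ?thesis unfolding m by simp
qed

lemma annealed_square_mean_le:
  assumes v: "\<forall>i\<in>{1..N}. v i > 0"
  shows "(\<Sum>\<sigma>\<in>spin_configs N. annealed_prob N v \<beta> B \<sigma> * X \<sigma>)\<^sup>2 \<le> (\<Sum>\<sigma>\<in>spin_configs N. annealed_prob N v \<beta> B \<sigma> * (X \<sigma>)\<^sup>2)"
proof -
  define p where "p = annealed_prob N v \<beta> B"
  have p: "p \<sigma> \<ge> 0" for \<sigma> by (simp add: p_def annealed_prob_nonneg)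
  have "(\<Sum>\<sigma>\<in>spin_configs N. sqrt (p \<sigma>) * (sqrt (p \<sigma>) * X \<sigma>))\<^sup>2
    \<le> (\<Sum>\<sigma>\<in>spin_configs N. (sqrt (p \<sigma>))\<^sup>2) * (\<Sum>\<sigma>\<in>spin_configs N. (sqrt (p \<sigma>) * X \<sigma>)\<^sup>2)"
    by (rule Cauchy_Schwarz_ineq_sum)
  moreover have "sqrt (p \<sigma>) * (sqrt (p \<sigma>) * X \<sigma>) = p \<sigma> * X \<sigma>" for \<sigma>
    using p[of \<sigma>] by (simp add: mult.assoc[symmetric])
  ultimately show ?thesis
    using sum_annealed_prob[OF v, of \<beta> B] p by (simp add: power_mult_distrib p_def[symmetric])
qed

text \<open>The derivative is a variance.\<close>

lemma magnetization_mono: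
  assumes v: "\<forall>i\<in>{1..N}. v i > 0" and "b \<le> b'"
  shows "magnetization N v \<beta> b \<le> magnetization N v \<beta> b'"
proof (rule DERIV_nonneg_imp_nondecreasing[OF \<open>b \<le> b'\<close>])
  show "\<exists>D. ((\<lambda>b. magnetization N v \<beta> b) has_real_derivative D) (at x) \<and> 0 \<le> D" for x
    using magnetization_has_derivative_variance[OF v, of \<beta> x] annealed_square_mean_le[OF v, of \<beta> x "total_spin N"]
    by (intro exI conjI) auto
qed

section \<open>The central limit theorem at a saddle point\<close>

context regular_weights begin

lemma w_pos_ball: "\<forall>i\<in>{1..N}. w N i > 0"
  using w_pos by blast

lemma saddle_mgf:
  assumes \<beta>: "\<beta> \<ge> 0" and saddle: "saddle \<beta> B y \<eta> c"
  obtains \<kappa> where "\<And>t. (\<lambda>N. \<Sum>\<sigma>\<in>spin_configs N. annealed_prob N (w N) \<beta> B \<sigma> *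
      exp (t * ((total_spin N \<sigma> - (\<Sum>i\<in>{1..N}. spin_mean \<beta> B y N i)) / sqrt N))) \<longlonglongrightarrow> exp (\<kappa> * t\<^sup>2 / 2)"
proof -
  have y: "\<And>N. y N = (\<Sum>i\<in>{1..N}. coupling \<beta> N i * tanh (coupling \<beta> N i * y N + B))" and c: "c > 0"
    and q: "\<forall>\<^sub>F N in sequentially. \<forall>u. mixture_density N (coupling \<beta> N) B (y N) u \<le> exp (- (c * u\<^sup>2))"
    and l: "(\<lambda>N. scale \<beta> N * y N) \<longlonglongrightarrow> \<eta>"
    using saddle by (auto simp: saddle_def)
  obtain \<theta> K P Q V \<delta> where "curie_weiss_array (coupling \<beta>) B y c \<theta> K P Q V \<delta>"
    by (rule curie_weiss_array_if_saddle[OF \<beta> c y q l]) blast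
  then interpret cw: curie_weiss_array "coupling \<beta>" B y c \<theta> K P Q V \<delta> .
  obtain R \<gamma> where R: "\<And>N. (\<Sum>e\<in>vertex_pairs N. \<bar>defect \<beta> N e\<bar>) \<le> R"
    and \<gamma>: "\<And>N i. i \<in> {1..N} \<Longrightarrow> (\<Sum>e\<in>{e \<in> vertex_pairs N. i = fst e \<or> i = snd e}. \<bar>defect \<beta> N e\<bar>) \<le> \<gamma> N"
    and \<gamma>0: "\<gamma> \<longlonglongrightarrow> 0"
    by (rule edge_defect_bounds[OF \<beta>]) blast
  let ?g = "\<lambda>N \<sigma>. cw_weight N (coupling \<beta> N) B \<sigma> * exp (- pair_energy N (defect \<beta> N) \<sigma>)"
  show ?thesis
  proof (rule that)
    fix t
    have "(\<lambda>N. (\<Sum>\<sigma>\<in>spin_configs N. exp (t * cw.fluct N \<sigma>) * ?g N \<sigma>)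
      / (\<Sum>\<sigma>\<in>spin_configs N. ?g N \<sigma>))
      \<longlonglongrightarrow> exp (cw.limit_variance * t\<^sup>2 / 2)"
      by (rule cw.perturbed_mgf_tendsto[OF R \<gamma> \<gamma>0])
    then show "(\<lambda>N. \<Sum>\<sigma>\<in>spin_configs N. annealed_prob N (w N) \<beta> B \<sigma> *
      exp (t * ((total_spin N \<sigma> - (\<Sum>i\<in>{1..N}. spin_mean \<beta> B y N i)) / sqrt N))) \<longlonglongrightarrow> exp (cw.limit_variance * t\<^sup>2 / 2)"
    proof (rule Lim_transform_eventually)
      show "\<forall>\<^sub>F N in sequentially. (\<Sum>\<sigma>\<in>spin_configs N. exp (t * cw.fluct N \<sigma>) * ?g N \<sigma>)
        / (\<Sum>\<sigma>\<in>spin_configs N. ?g N \<sigma>)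
        = (\<Sum>\<sigma>\<in>spin_configs N. annealed_prob N (w N) \<beta> B \<sigma> *
          exp (t * ((total_spin N \<sigma> - (\<Sum>i\<in>{1..N}. spin_mean \<beta> B y N i)) / sqrt N)))"
        using eventually_gt_at_top[of 0]
      proof eventually_elim
        case (elim N)
        define g where "g \<sigma> = ?g N \<sigma>" for \<sigma>
        have "\<exists>C>0. \<forall>\<sigma>\<in>spin_configs N. annealed_weight N (w N) \<beta> B \<sigma> = C * g \<sigma>"
          unfolding g_def by (rule annealed_weight_curie_weiss) (use w_pos \<beta> elim in auto)
        then obtain C where C: "C > 0" "\<And>\<sigma>. \<sigma> \<in> spin_configs N \<Longrightarrow> annealed_weight N (w N) \<beta> B \<sigma> = C * g \<sigma>" by blast
        have p: "annealed_prob N (w N) \<beta> B \<sigma> = g \<sigma> / (\<Sum>\<sigma>\<in>spin_configs N. g \<sigma>)" if "\<sigma> \<in> spin_configs N" for \<sigma>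
          using C that unfolding annealed_prob_def by (simp add: sum_distrib_left[symmetric] cong: sum.cong)
        have f: "cw.fluct N \<sigma> = (total_spin N \<sigma> - (\<Sum>i\<in>{1..N}. spin_mean \<beta> B y N i)) / sqrt N" for \<sigma>
          using elim by (simp add: cw.fluct_def cw.mean_spin_def coupling_eq mult_ac)
        show ?case unfolding g_def[symmetric] f sum_divide_distrib
          by (intro sum.cong) (auto simp: p)
      qed
    qed
  qed
qed

text \<open>Let \<open>T = (S\<^sub>N - m\<^sub>N) / sqrt N\<close> with the explicit centring \<open>m\<^sub>N = \<Sum> tanh (a\<^sub>i y + B)\<close>. Its generating
  functions converge, so its mean tends to \<open>0\<close> and its variance, the susceptibility, to \<open>\<kappa>\<close>. Hence
  centring at the true mean instead of \<open>m\<^sub>N\<close> does not change the limit law, and the magnetization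
  has the same limit as \<open>m\<^sub>N / N\<close>.\<close>

theorem saddle_central_limit:
  assumes \<beta>: "\<beta> \<ge> 0" and saddle: "saddle \<beta> B y \<eta> c"
  obtains \<kappa> where "\<kappa> \<ge> 0" "(\<lambda>N. susceptibility N (w N) \<beta> B) \<longlonglongrightarrow> \<kappa>"
    "weak_conv_m (\<lambda>N. distr (annealed_measure N (w N) \<beta> B) borel
        (\<lambda>\<sigma>. (total_spin N \<sigma> - (\<integral>\<tau>. total_spin N \<tau> \<partial>annealed_measure N (w N) \<beta> B)) / sqrt (real N)))
      (centered_normal \<kappa>)"
    "(\<lambda>N. magnetization N (w N) \<beta> B - (\<Sum>i\<in>{1..N}. spin_mean \<beta> B y N i) / N) \<longlonglongrightarrow> 0"
proof -
  let ?X = "\<lambda>N \<sigma>. (total_spin N \<sigma> - (\<integral>\<tau>. total_spin N \<tau> \<partial>annealed_measure N (w N) \<beta> B)) / sqrt (real N)"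
  let ?law = "\<lambda>N. distr (annealed_measure N (w N) \<beta> B) borel (?X N)"
  define p where "p N = annealed_prob N (w N) \<beta> B" for N
  define m where "m N = (\<Sum>i\<in>{1..N}. spin_mean \<beta> B y N i)" for N
  define T where "T N \<sigma> = (total_spin N \<sigma> - m N) / sqrt N" for N \<sigma>
  define E where "E N = (\<Sum>\<sigma>\<in>spin_configs N. p N \<sigma> * total_spin N \<sigma>)" for N
  define E1 where "E1 N = (\<Sum>\<sigma>\<in>spin_configs N. p N \<sigma> * T N \<sigma>)" for N
  define E2 where "E2 N = (\<Sum>\<sigma>\<in>spin_configs N. p N \<sigma> * (T N \<sigma>)\<^sup>2)" for N
  have p0: "p N \<sigma> \<ge> 0" for N \<sigma> by (simp add: p_def annealed_prob_nonneg)
  have p1: "(\<Sum>\<sigma>\<in>spin_configs N. p N \<sigma>) = 1" for N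
    unfolding p_def by (rule sum_annealed_prob[OF w_pos_ball])
  obtain \<kappa> where \<kappa>: "\<And>t. (\<lambda>N. \<Sum>\<sigma>\<in>spin_configs N. p N \<sigma> * exp (t * T N \<sigma>)) \<longlonglongrightarrow> exp (\<kappa> * t\<^sup>2 / 2)"
    unfolding p_def T_def m_def by (rule saddle_mgf[OF \<beta> saddle]) blast
  note lims = gaussian_mgf_convergence[of spin_configs p T \<kappa>, OF finite_spin_configs p0 \<kappa>]
  have E1: "E1 \<longlonglongrightarrow> 0" and E2: "E2 \<longlonglongrightarrow> \<kappa>"
    using lims(2,3) by (simp_all add: E1_def E2_def[abs_def] E1_def[abs_def])
  have \<kappa>0: "\<kappa> \<ge> 0"
    using E2 by (rule LIMSEQ_le_const) (auto simp: E2_def intro!: sum_nonneg mult_nonneg_nonneg p0)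
  have E1_eq: "E1 N = (E N - m N) / sqrt N" for N
    unfolding E1_def T_def E_def using p1[of N]
    by (simp add: algebra_simps sum_subtractf sum_divide_distrib[symmetric] sum_distrib_left[symmetric] diff_divide_distrib)
  have EN: "E N = m N + sqrt N * E1 N" if "N > 0" for N
    using that by (simp add: E1_eq)
  have SE: "total_spin N \<sigma> - E N = sqrt N * (T N \<sigma> - E1 N)" if "N > 0" for N \<sigma>
    using that unfolding E1_eq T_def diff_divide_distrib[symmetric] by simp
  have susc: "susceptibility N (w N) \<beta> B = E2 N - (E1 N)\<^sup>2" if N: "N > 0" for N
  proof -
    have "susceptibility N (w N) \<beta> B = ((\<Sum>\<sigma>\<in>spin_configs N. p N \<sigma> * (total_spin N \<sigma>)\<^sup>2) - (E N)\<^sup>2) / N"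
      unfolding susceptibility_def p_def E_def
      by (rule DERIV_imp_deriv) (rule magnetization_has_derivative_variance[OF w_pos_ball])
    also have "(\<Sum>\<sigma>\<in>spin_configs N. p N \<sigma> * (total_spin N \<sigma>)\<^sup>2) = (m N)\<^sup>2 + 2 * m N * sqrt N * E1 N + N * E2 N"
    proof -
      have "p N \<sigma> * (total_spin N \<sigma>)\<^sup>2 = (m N)\<^sup>2 * p N \<sigma> + 2 * m N * sqrt N * (p N \<sigma> * T N \<sigma>) + N * (p N \<sigma> * (T N \<sigma>)\<^sup>2)" for \<sigma>
      proof -
        have S: "total_spin N \<sigma> = m N + sqrt N * T N \<sigma>" using N by (simp add: T_def)
        have n: "(sqrt N * T N \<sigma>)\<^sup>2 = N * (T N \<sigma>)\<^sup>2" by (simp add: power_mult_distrib)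
        show ?thesis unfolding S power2_sum n by (simp add: algebra_simps)
      qed
      then show ?thesis unfolding E1_def E2_def by (simp add: sum.distrib sum_distrib_left[symmetric] p1)
    qed
    also have "((m N)\<^sup>2 + 2 * m N * sqrt N * E1 N + N * E2 N - (E N)\<^sup>2) / N = E2 N - (E1 N)\<^sup>2"
    proof -
      have n: "(sqrt N * E1 N)\<^sup>2 = N * (E1 N)\<^sup>2" by (simp add: power_mult_distrib)
      have "(m N)\<^sup>2 + 2 * m N * sqrt N * E1 N + N * E2 N - (E N)\<^sup>2 = N * (E2 N - (E1 N)\<^sup>2)"
        unfolding EN[OF N] power2_sum n by (simp add: algebra_simps)
      then show ?thesis using N by simp
    qed
    finally show ?thesis .
  qed
  have ev: "\<forall>\<^sub>F N :: nat in sequentially. N > 0" by (rule eventually_gt_at_top)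
  have 1: "(\<lambda>N. susceptibility N (w N) \<beta> B) \<longlonglongrightarrow> \<kappa>"
  proof (rule Lim_transform_eventually)
    have "(\<lambda>N. E2 N - (E1 N)\<^sup>2) \<longlonglongrightarrow> \<kappa> - 0\<^sup>2" by (intro tendsto_intros E1 E2)
    then show "(\<lambda>N. E2 N - (E1 N)\<^sup>2) \<longlonglongrightarrow> \<kappa>" by simp
    show "\<forall>\<^sub>F N in sequentially. E2 N - (E1 N)\<^sup>2 = susceptibility N (w N) \<beta> B"
      using ev by eventually_elim (simp add: susc)
  qed
  have mag: "magnetization N (w N) \<beta> B = E N / N" for N
    unfolding magnetization_def annealed_integral E_def p_def[symmetric] by (simp add: sum_divide_distrib)
  have 2: "(\<lambda>N. magnetization N (w N) \<beta> B - m N / N) \<longlonglongrightarrow> 0"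
  proof (rule Lim_transform_eventually)
    have "(\<lambda>N. 1 / sqrt (real N)) \<longlonglongrightarrow> 0" by real_asymp
    then have "(\<lambda>N. E1 N * (1 / sqrt (real N))) \<longlonglongrightarrow> 0 * 0" by (intro tendsto_mult E1)
    then show "(\<lambda>N. E1 N * (1 / sqrt (real N))) \<longlonglongrightarrow> 0" by simp
    show "\<forall>\<^sub>F N in sequentially. E1 N * (1 / sqrt (real N)) = magnetization N (w N) \<beta> B - m N / N"
      using ev
    proof eventually_elim
      case (elim N)
      have "real N = sqrt N * sqrt N" by simp
      then have "sqrt N * E1 N / N = E1 N * (1 / sqrt N)" using elim by (simp add: field_simps)
      then show ?case unfolding mag EN[OF elim] by (simp add: add_divide_distrib)
    qed
  qed
  have 3: "weak_conv_m ?law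
      (centered_normal \<kappa>)"
  proof (rule levy_continuity)
    define X where "X N \<sigma> = ?X N \<sigma>" for N \<sigma>
    have Xm: "X N \<in> borel_measurable (annealed_measure N (w N) \<beta> B)" for N
      unfolding annealed_measure_eq measurable_point_measure_eq1 by auto
    show "real_distribution (?law N)" for N
      using prob_space.prob_space_distr[OF prob_space_annealed_measure[OF w_pos_ball] Xm, of N]
      by (simp add: X_def[symmetric] real_distribution_def real_distribution_axioms_def)
    show "real_distribution (centered_normal \<kappa>)" by (rule char_centered_normal[OF \<kappa>0])
    fix t
    have "(\<lambda>N. exp (- (\<i> * of_real t * of_real (E1 N))) * (\<Sum>\<sigma>\<in>spin_configs N. of_real (p N \<sigma>) * exp ((\<i> * of_real t) * of_real (T N \<sigma>))))
      \<longlonglongrightarrow> exp (- (\<i> * of_real t * of_real 0)) * exp (of_real \<kappa> * (\<i> * of_real t)\<^sup>2 / 2)"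
      by (intro tendsto_intros E1 lims(1))
    also have "exp (- (\<i> * of_real t * of_real 0)) * exp (of_real \<kappa> * (\<i> * of_real t)\<^sup>2 / 2) = char (centered_normal \<kappa>) t"
      unfolding char_centered_normal(1)[OF \<kappa>0] by (simp add: power_mult_distrib)
    finally show "(\<lambda>N. char (?law N) t)
       \<longlonglongrightarrow> char (centered_normal \<kappa>) t"
    proof (rule Lim_transform_eventually)
      show "\<forall>\<^sub>F N in sequentially. exp (- (\<i> * of_real t * of_real (E1 N))) * (\<Sum>\<sigma>\<in>spin_configs N. of_real (p N \<sigma>) * exp ((\<i> * of_real t) * of_real (T N \<sigma>)))
        = char (?law N) t"
        using ev
      proof eventually_elim
        case (elim N)
        have "(\<integral>\<tau>. total_spin N \<tau> \<partial>annealed_measure N (w N) \<beta> B) = E N"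
          unfolding annealed_integral E_def p_def by simp
        then have X: "X N \<sigma> = T N \<sigma> - E1 N" for \<sigma>
          unfolding X_def using SE[OF elim, of \<sigma>] elim by simp
        have "char (distr (annealed_measure N (w N) \<beta> B) borel (X N)) t
          = (\<Sum>\<sigma>\<in>spin_configs N. p N \<sigma> *\<^sub>R iexp (t * X N \<sigma>))"
          unfolding char_def p_def annealed_integral[symmetric]
          by (rule integral_distr[OF Xm]) simp
        also have "\<dots> = (\<Sum>\<sigma>\<in>spin_configs N. exp (- (\<i> * of_real t * of_real (E1 N))) * (of_real (p N \<sigma>) * exp ((\<i> * of_real t) * of_real (T N \<sigma>))))"
        proof (rule sum.cong[OF refl])
          fix \<sigma>
          have "\<i> * of_real (t * X N \<sigma>) = - (\<i> * of_real t * of_real (E1 N)) + (\<i> * of_real t) * of_real (T N \<sigma>)"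
            unfolding X by (simp add: algebra_simps)
          then show "p N \<sigma> *\<^sub>R iexp (t * X N \<sigma>) = exp (- (\<i> * of_real t * of_real (E1 N))) * (of_real (p N \<sigma>) * exp ((\<i> * of_real t) * of_real (T N \<sigma>)))"
            by (simp only: exp_add scaleR_conv_of_real mult_ac)
        qed
        finally show ?case unfolding X_def[abs_def] by (simp add: sum_distrib_left)
      qed
    qed
  qed
  show ?thesis by (rule that[OF \<kappa>0 1 3 2[unfolded m_def]])
qed

end

section \<open>The critical inverse temperature\<close>

lemma tendsto_at_right_of_mono:
  fixes f :: "real \<Rightarrow> real"
  assumes mono: "\<And>x y. 0 < x \<Longrightarrow> x \<le> y \<Longrightarrow> f x \<le> f y" and low: "\<And>x. 0 < x \<Longrightarrow> m \<le> f x"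
  obtains l where "m \<le> l" "(f \<longlongrightarrow> l) (at_right 0)"
proof (rule that)
  have bdd: "bdd_below (f ` {0<..})" using low by (intro bdd_belowI[of _ m]) auto
  show "m \<le> Inf (f ` {0<..})" using low by (intro cInf_greatest) auto
  show "(f \<longlongrightarrow> Inf (f ` {0<..})) (at_right 0)"
  proof (rule order_tendstoI)
    fix a assume "a < Inf (f ` {0<..})"
    then have "a < f x" if "0 < x" for x using cInf_lower[OF _ bdd, of "f x"] that by auto
    then show "\<forall>\<^sub>F x in at_right 0. a < f x" by (auto intro: eventually_at_right_less[THEN eventually_mono])
  next
    fix a assume "Inf (f ` {0<..}) < a"
    then obtain b where b: "0 < b" "f b < a" using cInf_lessD[of "f ` {0<..}" a] by auto
    have "\<forall>\<^sub>F x in at_right 0. x \<in> {0<..<b}" by (rule eventually_at_right_real[OF b(1)])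
    moreover have "f x < a" if "x \<in> {0<..<b}" for x using mono[of x b] that b by auto
    ultimately show "\<forall>\<^sub>F x in at_right 0. f x < a" by (rule eventually_mono)
  qed
qed

context regular_weights begin

lemma magnetization_tendsto:
  assumes \<beta>: "\<beta> \<ge> 0" and saddle: "saddle \<beta> B y \<eta> c"
  shows "(\<lambda>N. magnetization N (w N) \<beta> B) \<longlonglongrightarrow> (\<integral>\<omega>. tanh (W \<omega> * \<eta> + B) \<partial>\<Omega>)"
proof -
  have "(\<lambda>N. magnetization N (w N) \<beta> B - (\<Sum>i\<in>{1..N}. spin_mean \<beta> B y N i) / N) \<longlonglongrightarrow> 0"
    by (rule saddle_central_limit[OF \<beta> saddle]) blast
  moreover have "(\<lambda>N. (\<Sum>i\<in>{1..N}. spin_mean \<beta> B y N i) / N) \<longlonglongrightarrow> (\<integral>\<omega>. tanh (W \<omega> * \<eta> + B) \<partial>\<Omega>)"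
  proof (rule average_limit[OF tanh_arg_continuous])
    show "\<bar>tanh (x * z + B)\<bar> \<le> 1 * (1 + x\<^sup>2)" for x z
      using abs_tanh_le_1[of "x * z + B"] by (simp add: add_increasing2 order_trans[of _ 1])
    show "(\<lambda>N. scale \<beta> N * y N) \<longlonglongrightarrow> \<eta>" using saddle by (simp add: saddle_def)
  qed
  ultimately show ?thesis using tendsto_add by fastforce
qed

text \<open>At zero field the limiting map has slope \<open>coupling_strength \<beta> > 1\<close> at \<open>0\<close>, so it exceeds the
  identity at some small \<open>x\<close>. The bound \<open>tanh q \<ge> q / (1 + q)\<close> reduces this to
  \<open>E (W\<^sup>2 / (1 + \<bar>W\<bar> x)) \<rightarrow> E W\<^sup>2\<close> as \<open>x\<close> decreases to \<open>0\<close>.\<close>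

lemma supercritical_field_map:
  assumes \<beta>: "\<beta> \<ge> 0" and super: "coupling_strength \<beta> > 1"
  obtains x where "x > 0" "\<forall>\<^sub>F N in sequentially. field_map \<beta> 0 N x > x"
proof -
  interpret prob_space \<Omega> using regular by (simp add: weight_regularity_def)
  have [measurable]: "W \<in> borel_measurable \<Omega>" and W2: "integrable \<Omega> (\<lambda>x. (W x)\<^sup>2)"
    using regular by (auto simp: weight_regularity_def)
  define F where "F u z = u\<^sup>2 / (1 + \<bar>u\<bar> * \<bar>z\<bar>)" for u z :: real
  have F_le: "0 \<le> F u z" "F u z \<le> u\<^sup>2" for u z
  proof -
    have "1 \<le> 1 + \<bar>u\<bar> * \<bar>z\<bar>" by simp
    then show "0 \<le> F u z" "F u z \<le> u\<^sup>2" unfolding F_def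
      by (auto simp: divide_le_eq mult_left_le intro!: divide_nonneg_nonneg add_nonneg_nonneg mult_le_cancel_left1[THEN iffD2])
  qed
  have "(\<lambda>n. \<integral>\<omega>. F (W \<omega>) (1 / real (Suc n)) \<partial>\<Omega>) \<longlonglongrightarrow> (\<integral>\<omega>. (W \<omega>)\<^sup>2 \<partial>\<Omega>)"
  proof (rule integral_dominated_convergence[OF _ _ W2])
    show "AE \<omega> in \<Omega>. (\<lambda>n. F (W \<omega>) (1 / real (Suc n))) \<longlonglongrightarrow> (W \<omega>)\<^sup>2"
    proof (rule AE_I2)
      fix \<omega>
      have "(\<lambda>n. 1 / real (Suc n)) \<longlonglongrightarrow> 0" by real_asymp
      then have "(\<lambda>n. (W \<omega>)\<^sup>2 / (1 + \<bar>W \<omega>\<bar> * \<bar>1 / real (Suc n)\<bar>)) \<longlonglongrightarrow> (W \<omega>)\<^sup>2 / (1 + \<bar>W \<omega>\<bar> * \<bar>0\<bar>)"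
        by (intro tendsto_intros) auto
      then show "(\<lambda>n. F (W \<omega>) (1 / real (Suc n))) \<longlonglongrightarrow> (W \<omega>)\<^sup>2" by (simp add: F_def)
    qed
    show "(\<lambda>\<omega>. F (W \<omega>) (1 / real (Suc n))) \<in> borel_measurable \<Omega>" for n unfolding F_def by measurable
    show "AE \<omega> in \<Omega>. norm (F (W \<omega>) (1 / real (Suc n))) \<le> (W \<omega>)\<^sup>2" for n
      using F_le by (intro AE_I2) simp
  qed simp
  then have "(\<lambda>n. sinh \<beta> / mean1 * (\<integral>\<omega>. F (W \<omega>) (1 / real (Suc n)) \<partial>\<Omega>)) \<longlonglongrightarrow> sinh \<beta> / mean1 * mean2"
    unfolding mean2_def by (intro tendsto_intros)
  then have "\<forall>\<^sub>F n in sequentially. 1 < sinh \<beta> / mean1 * (\<integral>\<omega>. F (W \<omega>) (1 / real (Suc n)) \<partial>\<Omega>)"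
    by (rule order_tendstoD) (use super in \<open>simp add: coupling_strength_def\<close>)
  then obtain n where n: "1 < sinh \<beta> / mean1 * (\<integral>\<omega>. F (W \<omega>) (1 / real (Suc n)) \<partial>\<Omega>)"
    by (auto simp: eventually_sequentially)
  define x where "x = 1 / real (Suc n)"
  have x: "x > 0" by (simp add: x_def)
  have "(\<lambda>N. (\<Sum>i\<in>{1..N}. F (w N i) x) / N) \<longlonglongrightarrow> (\<integral>\<omega>. F (W \<omega>) x \<partial>\<Omega>)"
  proof (rule average_limit[OF _ _ tendsto_const])
    have "1 + \<bar>u\<bar> * \<bar>z\<bar> \<noteq> 0" for u z :: real by (smt (verit) mult_nonneg_nonneg abs_ge_zero)
    then show "continuous_on UNIV (\<lambda>p. F (fst p) (snd p))" unfolding F_def by (intro continuous_intros) auto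
    show "\<bar>F u z\<bar> \<le> 1 * (1 + u\<^sup>2)" for u z using F_le[of u z] by simp
  qed
  from tendsto_mult[OF scale_square_limit[OF \<beta>] this]
  have "(\<lambda>N. \<Sum>i\<in>{1..N}. (scale \<beta> N)\<^sup>2 * F (w N i) x) \<longlonglongrightarrow> sinh \<beta> / mean1 * (\<integral>\<omega>. F (W \<omega>) x \<partial>\<Omega>)"
    unfolding scaled_average .
  then have "\<forall>\<^sub>F N in sequentially. 1 < (\<Sum>i\<in>{1..N}. (scale \<beta> N)\<^sup>2 * F (w N i) x)"
    by (rule order_tendstoD) (use n in \<open>simp add: x_def\<close>)
  then have "\<forall>\<^sub>F N in sequentially. field_map \<beta> 0 N x > x"
  proof eventually_elim
    case (elim N)
    have "x * (\<Sum>i\<in>{1..N}. (scale \<beta> N)\<^sup>2 * F (w N i) x) \<le> field_map \<beta> 0 N x"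
      unfolding field_map_def sum_distrib_left scale_square[OF \<beta>]
    proof (rule sum_mono)
      fix i assume i: "i \<in> {1..N}"
      have "w N i * x / (1 + w N i * x) \<le> tanh (w N i * x)"
        using w_pos[OF i] x by (intro tanh_ge_frac) auto
      then have "sinh \<beta> / total_weight N (w N) * w N i * (w N i * x / (1 + w N i * x)) \<le> sinh \<beta> / total_weight N (w N) * w N i * tanh (w N i * x + 0)"
        using w_pos[OF i] total_weight_nonneg[of N] \<beta> by (intro mult_left_mono) (auto intro!: mult_nonneg_nonneg divide_nonneg_nonneg)
      moreover have "x * (sinh \<beta> / total_weight N (w N) * F (w N i) x) = sinh \<beta> / total_weight N (w N) * w N i * (w N i * x / (1 + w N i * x))"
        using w_pos[OF i] x by (simp add: F_def power2_eq_square)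
      ultimately show "x * (sinh \<beta> / total_weight N (w N) * F (w N i) x) \<le> sinh \<beta> / total_weight N (w N) * w N i * tanh (w N i * x + 0)"
        by simp
    qed
    moreover have "x * 1 < x * (\<Sum>i\<in>{1..N}. (scale \<beta> N)\<^sup>2 * F (w N i) x)"
      using elim x by (intro mult_strict_left_mono) auto
    ultimately show ?case by linarith
  qed
  with x show ?thesis by (rule that)
qed

text \<open>Take the \<open>x\<close> of the previous lemma. A positive field only increases the map, so it still exceeds
  the identity at \<open>x\<close>, and monotonicity forces the rescaled saddle point to be at least \<open>x\<close>,
  for every \<open>B > 0\<close>. The magnetization is then at least the limit of the averages of
  \<open>tanh (w\<^sub>i e)\<close> with \<open>e \<le> x\<close>, and \<open>tanh q \<ge> q - q\<^sup>2\<close> bounds it below by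
  \<open>e E W - e\<^sup>2 E W\<^sup>2 \<ge> e E W / 2\<close>, which is the reason for the choice of \<open>e\<close>.\<close>

lemma spontaneous_magnetization:
  assumes \<beta>: "\<beta> \<ge> 0" and super: "coupling_strength \<beta> > 1"
  obtains m where "m > 0" "((\<lambda>B. magnetization_limit w \<beta> B) \<longlongrightarrow> m) (at_right 0)"
proof -
  obtain x where x: "x > 0" and fm: "\<forall>\<^sub>F N in sequentially. field_map \<beta> 0 N x > x"
    by (rule supercritical_field_map[OF \<beta> super])
  define e where "e = min x (mean1 / (2 * mean2))"
  have e: "e > 0" "e \<le> x" "e * mean2 \<le> mean1 / 2"
  proof -
    show "e > 0" using x mean1_pos mean2_pos by (simp add: e_def)
    show "e \<le> x" by (simp add: e_def)
    have "e * mean2 \<le> mean1 / (2 * mean2) * mean2" unfolding e_def using mean2_pos by (intro mult_right_mono) auto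
    then show "e * mean2 \<le> mean1 / 2" using mean2_pos by simp
  qed
  have key: "\<exists>L. (\<lambda>N. magnetization N (w N) \<beta> B) \<longlonglongrightarrow> L \<and> e * mean1 / 2 \<le> L" if B: "B > 0" for B
  proof -
    obtain y \<eta> c where saddle: "saddle \<beta> B y \<eta> c"
      and mono: "\<And>N x. x \<ge> 0 \<Longrightarrow> (scale \<beta> N * y N - x) * (field_map \<beta> B N x - x) \<ge> tanh B * (scale \<beta> N * y N - x)\<^sup>2"
      by (rule saddle_positive_field[OF \<beta> B]) blast
    have ge: "\<forall>\<^sub>F N in sequentially. e * (total_weight N (w N) / N) - e\<^sup>2 * ((\<Sum>i\<in>{1..N}. (w N i)\<^sup>2) / N)
       \<le> (\<Sum>i\<in>{1..N}. spin_mean \<beta> B y N i) / N"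
      using fm
    proof eventually_elim
      case (elim N)
      have "field_map \<beta> 0 N x \<le> field_map \<beta> B N x"
        unfolding field_map_def using w_pos B \<beta> total_weight_nonneg
        by (intro sum_mono mult_left_mono) (auto intro!: mult_nonneg_nonneg divide_nonneg_nonneg intro: less_imp_le)
      then have pos: "field_map \<beta> B N x - x > 0" using elim by simp
      have "0 \<le> (scale \<beta> N * y N - x) * (field_map \<beta> B N x - x)"
        using mono[of x N] x B by (intro order_trans[OF _ mono]) auto
      then have ge_x: "x \<le> scale \<beta> N * y N" using pos by (simp add: zero_le_mult_iff)
      have "(\<Sum>i\<in>{1..N}. e * w N i - e\<^sup>2 * (w N i)\<^sup>2) \<le> (\<Sum>i\<in>{1..N}. spin_mean \<beta> B y N i)"
      proof (rule sum_mono)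
        fix i assume i: "i \<in> {1..N}"
        define q where "q = w N i * e"
        have q: "q \<ge> 0" using w_pos[OF i] e by (simp add: q_def)
        have "(q - q\<^sup>2) * (1 + q) \<le> q"
        proof -
          have "(q - q\<^sup>2) * (1 + q) = q - q ^ 3" by (simp add: power2_eq_square power3_eq_cube algebra_simps)
          then show ?thesis using q by simp
        qed
        then have "q - q\<^sup>2 \<le> q / (1 + q)" using q by (simp add: le_divide_eq)
        also have "\<dots> \<le> tanh q" by (rule tanh_ge_frac[OF q])
        also have "\<dots> \<le> tanh (w N i * (scale \<beta> N * y N) + B)"
        proof -
          have "w N i * e \<le> w N i * (scale \<beta> N * y N)" using w_pos[OF i] e(2) ge_x by (intro mult_left_mono) auto
          then have "q \<le> w N i * (scale \<beta> N * y N) + B" using B unfolding q_def by linarith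
          then show ?thesis by (simp only: tanh_real_le_iff)
        qed
        finally show "e * w N i - e\<^sup>2 * (w N i)\<^sup>2 \<le> tanh (w N i * (scale \<beta> N * y N) + B)"
          by (simp add: q_def power_mult_distrib mult.commute)
      qed
      then have "(e * total_weight N (w N) - e\<^sup>2 * (\<Sum>i\<in>{1..N}. (w N i)\<^sup>2)) / N \<le> (\<Sum>i\<in>{1..N}. spin_mean \<beta> B y N i) / N"
        by (intro divide_right_mono) (simp_all add: sum_subtractf sum_distrib_left total_weight_def)
      then show ?case by (simp add: diff_divide_distrib)
    qed
    have lim: "(\<lambda>N. magnetization N (w N) \<beta> B) \<longlonglongrightarrow> (\<integral>\<omega>. tanh (W \<omega> * \<eta> + B) \<partial>\<Omega>)"
      by (rule magnetization_tendsto[OF \<beta> saddle])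
    have "(\<lambda>N. magnetization N (w N) \<beta> B - (\<Sum>i\<in>{1..N}. spin_mean \<beta> B y N i) / N) \<longlonglongrightarrow> 0"
      by (rule saddle_central_limit[OF \<beta> saddle]) blast
    from tendsto_diff[OF lim this]
    have lim': "(\<lambda>N. (\<Sum>i\<in>{1..N}. spin_mean \<beta> B y N i) / N) \<longlonglongrightarrow> (\<integral>\<omega>. tanh (W \<omega> * \<eta> + B) \<partial>\<Omega>)" by simp
    have "(\<lambda>N. e * (total_weight N (w N) / N) - e\<^sup>2 * ((\<Sum>i\<in>{1..N}. (w N i)\<^sup>2) / N)) \<longlonglongrightarrow> e * mean1 - e\<^sup>2 * mean2"
      by (intro tendsto_intros average_weight average_weight_square)
    from tendsto_le[OF _ lim' this ge]
    have "e * mean1 - e\<^sup>2 * mean2 \<le> (\<integral>\<omega>. tanh (W \<omega> * \<eta> + B) \<partial>\<Omega>)" by simp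
    moreover have "e * (e * mean2) \<le> e * (mean1 / 2)" using e by (intro mult_left_mono) auto
    ultimately have "e * mean1 / 2 \<le> (\<integral>\<omega>. tanh (W \<omega> * \<eta> + B) \<partial>\<Omega>)" by (simp add: power2_eq_square)
    with lim show ?thesis by blast
  qed
  have lim: "(\<lambda>N. magnetization N (w N) \<beta> B) \<longlonglongrightarrow> magnetization_limit w \<beta> B" and low: "e * mean1 / 2 \<le> magnetization_limit w \<beta> B" if "B > 0" for B
    using key[OF that] by (auto simp: magnetization_limit_def limI)
  obtain l where "e * mean1 / 2 \<le> l" "(magnetization_limit w \<beta> \<longlongrightarrow> l) (at_right 0)"
  proof (rule tendsto_at_right_of_mono[of "magnetization_limit w \<beta>" "e * mean1 / 2"])
    show "magnetization_limit w \<beta> b \<le> magnetization_limit w \<beta> b'" if "0 < b" "b \<le> b'" for b b'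
      using that by (intro LIMSEQ_le[OF lim lim] exI allI impI magnetization_mono[OF w_pos_ball]) auto
  qed (use low in auto)
  moreover have "e * mean1 / 2 > 0" using e mean1_pos by simp
  ultimately show ?thesis by (intro that[of l]) auto
qed

text \<open>If the coupling strength at \<open>\<beta>\<close> were at least \<open>1\<close>, it would exceed \<open>1\<close> at every larger \<open>\<beta>'\<close>, which then belongs to the set
  whose infimum defines the critical value.\<close>

lemma subcritical_coupling_strength:
  assumes \<beta>: "0 < \<beta>" and crit: "\<beta> < annealed_critical w"
  shows "coupling_strength \<beta> < 1"
proof (rule ccontr)
  assume "\<not> coupling_strength \<beta> < 1"
  define \<beta>' where "\<beta>' = (\<beta> + annealed_critical w) / 2"
  have \<beta>': "\<beta> < \<beta>'" "\<beta>' < annealed_critical w" using crit by (auto simp: \<beta>'_def)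
  have "sinh \<beta> * (mean2 / mean1) < sinh \<beta>' * (mean2 / mean1)"
    using \<beta>' mean1_pos mean2_pos by (intro mult_strict_right_mono) auto
  then have "coupling_strength \<beta>' > 1" using \<open>\<not> coupling_strength \<beta> < 1\<close> by (simp add: coupling_strength_def)
  then obtain m where "m > 0" "((\<lambda>B. magnetization_limit w \<beta>' B) \<longlongrightarrow> m) (at_right 0)"
    using spontaneous_magnetization[of \<beta>'] \<beta> \<beta>' by force
  then have "annealed_critical w \<le> \<beta>'"
    unfolding annealed_critical_def using \<beta> \<beta>' by (intro cInf_lower bdd_belowI[of _ 0]) auto
  then show False using \<beta>' by simp
qed

lemma saddle_in_uniqueness_regime:
  assumes "(\<beta>, B) \<in> uniqueness_regime w"
  obtains y \<eta> c where "\<beta> \<ge> 0" "saddle \<beta> B y \<eta> c"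
proof -
  have \<beta>: "\<beta> \<ge> 0" using assms by (auto simp: uniqueness_regime_def)
  consider "B > 0" | "B < 0" | "B = 0" "0 < \<beta>" "\<beta> < annealed_critical w"
    using assms unfolding uniqueness_regime_def by (cases B "0 :: real" rule: linorder_cases) auto
  then show ?thesis
  proof cases
    case 1
    obtain y \<eta> c where "saddle \<beta> B y \<eta> c" by (rule saddle_positive_field[OF \<beta> 1])
    then show ?thesis by (rule that[OF \<beta>])
  next
    case 2
    then have "- B > 0" by simp
    then obtain y \<eta> c where "saddle \<beta> (- B) y \<eta> c" by (rule saddle_positive_field[OF \<beta>])
    then show ?thesis by (rule that[OF \<beta> saddle_minus])
  next
    case 3
    have "saddle \<beta> B (\<lambda>N. 0) 0 ((1 - coupling_strength \<beta>) / 4)"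
      using saddle_zero_field[OF \<beta> subcritical_coupling_strength[OF 3(2,3)]] 3(1) by simp
    then show ?thesis by (rule that[OF \<beta>])
  qed
qed

end

theorem theorem1p3:
  fixes w :: "nat \<Rightarrow> nat \<Rightarrow> real"
    and \<Omega> :: "'a measure" and W :: "'a \<Rightarrow> real"
    and \<beta> B :: real
  assumes "\<And>N i. i \<in> {1..N} \<Longrightarrow> w N i > 0"
    and "weight_regularity w \<Omega> W"
    and "(\<beta>, B) \<in> uniqueness_regime w"
  shows "convergent (\<lambda>N. susceptibility N (w N) \<beta> B) \<and>
    weak_conv_m
      (\<lambda>N. distr (annealed_measure N (w N) \<beta> B) borel
        (\<lambda>\<sigma>. (total_spin N \<sigma>
                - (\<integral>\<tau>. total_spin N \<tau> \<partial>annealed_measure N (w N) \<beta> B)) / sqrt (real N)))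
      (centered_normal (susceptibility_limit w \<beta> B))"
proof -
  interpret regular_weights w \<Omega> W using assms(1,2) by unfold_locales
  obtain y \<eta> c where \<beta>: "\<beta> \<ge> 0" and saddle: "saddle \<beta> B y \<eta> c"
    by (rule saddle_in_uniqueness_regime[OF assms(3)])
  obtain \<kappa> where susc: "(\<lambda>N. susceptibility N (w N) \<beta> B) \<longlonglongrightarrow> \<kappa>"
    and clt: "weak_conv_m (\<lambda>N. distr (annealed_measure N (w N) \<beta> B) borel
        (\<lambda>\<sigma>. (total_spin N \<sigma> - (\<integral>\<tau>. total_spin N \<tau> \<partial>annealed_measure N (w N) \<beta> B)) / sqrt (real N)))
      (centered_normal \<kappa>)"
    by (rule saddle_central_limit[OF \<beta> saddle])
  have "susceptibility_limit w \<beta> B = \<kappa>"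
    unfolding susceptibility_limit_def by (rule limI[OF susc])
  then show ?thesis using susc clt by (auto simp: convergent_def)
qed

end
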